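(* Let $S$ be any one of the following three sets of forbidden triangles in the language of two asymmetric binary relations $R,G$ (with $R^{\pm},G^{\pm}$ as in the context): \#8: $S=\{G^{+}G^{-}G^{+},\ R^{+}G^{-}G^{+}\}$; \#9: $S=\{G^{+}G^{+}G^{+},\ R^{+}G^{-}G^{+}\}$; \#10: $S=\{G^{+}G^{+}G^{+},\ G^{+}G^{-}G^{+},\ R^{+}G^{-}G^{+}\}$. Let $\mathrm{Forb}_c(S)$ be the set of all finite complete structures that do not embed any triangle from $S$. Then $\mathrm{Forb}_c(S)$ forms a prioritised semi-free amalgamation class with $\mathcal{L}'=\{R^{+},R^{-}\}$ and $R^{+}>R^{-}$. Moreover, if $\mathcal{M}_S$ denotes the Fraïssé limit of $\mathrm{Forb}_c(S)$, then $\mathrm{Aut}(\mathcal{M}_S)$ is simple.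
   Context: The language is $\mathcal{L}=\{R^{+},R^{-},G^{+},G^{-}\}$, encoding two asymmetric irreflexive binary relations $R$ and $G$: $R^{+}(a,b)$ means there is a directed $R$-edge from $a$ to $b$, with $R^{+}(a,b)\iff R^{-}(b,a)$, and likewise $G^{+}(a,b)\iff G^{-}(b,a)$. A structure is complete if for every two distinct elements $a,b$ exactly one of $R^{+},R^{-},G^{+},G^{-}$ holds of $(a,b)$; it is denoted $\mathbf{r}(a,b)$. A triangle is a complete structure on three points. A triangle written $XYZ$ with $X,Y,Z\in\mathcal{L}$ is the one on points $a,b,c$ with $X(a,b)$, $Y(a,c)$, $Z(b,c)$. (So $G^+G^-G^+$ is the directed 3-cycle with all edges $G$; $G^+G^+G^+$ is the transitive triangle with all edges $G$; $R^+G^-G^+$ is the directed 3-cycle with one $R$-edge and two $G$-edges.) Prioritised semi-free amalgamation: let $\mathcal{L}'=\{R_1,\dots,R_m\}\subsetneq\mathcal{L}$ be ordered as $R_1>\dots>R_m$. For $A,B,C\in\mathrm{Forb}_c(S)$ with $B\subseteq A,C$, amalgamate $A$ and $C$ over $B$ on the disjoint union of $A$ and $C$ over $B$ (keeping the structures of $A$ and $C$) as follows: for each $a\in A\setminus B$, $c\in C\setminus B$ let $\mathbf{r}(a,c)=R_i$ where $i$ is the smallest index such that colouring $(a,c)$ by $R_i$ makes $abc$ a triangle not in $S$ (up to isomorphism) for every $b\in B$ (so $i=1$ if $B=\emptyset$). The result is denoted $A\otimes_B C$. If for all $A,B,C\in \mathrm{Forb}_c(S)$ with $B\subseteq A,C$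 one has $A\otimes_B C\in\mathrm{Forb}_c(S)$ (in particular, such an $i$ always exists), then $\mathrm{Forb}_c(S)$ is called a prioritised semi-free amalgamation class with respect to the given ordering on $\mathcal{L}'$. *)

theory Defs
  imports "HOL-Algebra.Bij" "HOL-Algebra.Coset" "HOL-Library.Countable_Set"
begin

datatype sym = Rp | Rm | Gp | Gm

fun conv :: "sym \<Rightarrow> sym" where
  "conv Rp = Rm" | "conv Rm = Rp" | "conv Gp = Gm" | "conv Gm = Gp"

text \<open>
  Only the values of \<open>rel\<close> on the carrier matter: everything below that mentions \<open>rel\<close> is
  relativised to the carrier.
\<close>
record 'a lstruct = "'a partial_object" +
  rel :: "sym \<Rightarrow> 'a \<Rightarrow> 'a \<Rightarrow> bool"

definition lstructure :: "'a lstruct \<Rightarrow> bool" where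
  "lstructure A \<longleftrightarrow>
     (\<forall>a\<in>carrier A. \<forall>X. \<not> rel A X a a) \<and>
     (\<forall>a\<in>carrier A. \<forall>b\<in>carrier A. \<forall>X. rel A X a b \<longrightarrow> \<not> rel A X b a) \<and>
     (\<forall>a\<in>carrier A. \<forall>b\<in>carrier A. \<forall>X. rel A X a b \<longleftrightarrow> rel A (conv X) b a)"

definition complete_struct :: "'a lstruct \<Rightarrow> bool" where
  "complete_struct A \<longleftrightarrow> lstructure A \<and>
     (\<forall>a\<in>carrier A. \<forall>b\<in>carrier A. a \<noteq> b \<longrightarrow> (\<exists>!X. rel A X a b))"

definition edge :: "'a lstruct \<Rightarrow> 'a \<Rightarrow> 'a \<Rightarrow> sym" where
  "edge A a b = (THE X. rel A X a b)"

definition embedding :: "('a \<Rightarrow> 'b) \<Rightarrow> 'a lstruct \<Rightarrow> 'b lstruct \<Rightarrow> bool" where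
  "embedding f A B \<longleftrightarrow> inj_on f (carrier A) \<and> f ` carrier A \<subseteq> carrier B \<and>
     (\<forall>X. \<forall>a\<in>carrier A. \<forall>b\<in>carrier A. rel A X a b \<longleftrightarrow> rel B X (f a) (f b))"

definition isomorphism :: "('a \<Rightarrow> 'b) \<Rightarrow> 'a lstruct \<Rightarrow> 'b lstruct \<Rightarrow> bool" where
  "isomorphism f A B \<longleftrightarrow> embedding f A B \<and> f ` carrier A = carrier B"

definition embeds :: "'a lstruct \<Rightarrow> 'b lstruct \<Rightarrow> bool" where
  "embeds A B \<longleftrightarrow> (\<exists>f. embedding f A B)"

definition isomorphic :: "'a lstruct \<Rightarrow> 'b lstruct \<Rightarrow> bool" where
  "isomorphic A B \<longleftrightarrow> (\<exists>f. isomorphism f A B)"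

definition substruct :: "'a lstruct \<Rightarrow> 'a lstruct \<Rightarrow> bool" where
  "substruct B A \<longleftrightarrow> carrier B \<subseteq> carrier A \<and>
     (\<forall>X. \<forall>a\<in>carrier B. \<forall>b\<in>carrier B. rel B X a b \<longleftrightarrow> rel A X a b)"

text \<open>The triangle \<open>XYZ\<close>, on the points \<open>a = 0\<close>, \<open>b = 1\<close>, \<open>c = 2\<close>.\<close>
definition triangle :: "sym \<Rightarrow> sym \<Rightarrow> sym \<Rightarrow> nat lstruct" where
  "triangle X Y Z = \<lparr>carrier = {0, 1, 2},
     rel = (\<lambda>W i j. (W, i, j) \<in>
       {(X, 0, 1), (conv X, 1, 0), (Y, 0, 2), (conv Y, 2, 0), (Z, 1, 2), (conv Z, 2, 1)})\<rparr>"

definition Forb_c :: "nat lstruct set \<Rightarrow> 'a lstruct set" where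
  "Forb_c S = {A. finite (carrier A) \<and> complete_struct A \<and> (\<forall>T\<in>S. \<not> embeds T A)}"

text \<open>
  The priority order \<open>R\<^sub>1 > \<dots> > R\<^sub>m\<close> is the list \<open>[R\<^sub>1, \<dots>, R\<^sub>m]\<close>; the colour of a new pair \<open>(a, c)\<close> is
  the first admissible entry, and \<open>None\<close> if there is none.
\<close>
definition new_edge ::
  "nat lstruct set \<Rightarrow> sym list \<Rightarrow> 'a lstruct \<Rightarrow> 'a lstruct \<Rightarrow> 'a lstruct \<Rightarrow> 'a \<Rightarrow> 'a \<Rightarrow> sym option" where
  "new_edge S Rs B A C a c =
     find (\<lambda>X. \<forall>b\<in>carrier B. \<forall>T\<in>S. \<not> isomorphic (triangle (edge A a b) X (edge C b c)) T) Rs"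

text \<open>
  \<open>A \<otimes>\<^sub>B C\<close>. The disjoint union over \<open>B\<close> consists of a copy of \<open>A\<close> (left summand) and a copy of
  \<open>C \<setminus> B\<close> (right summand), so points of \<open>B\<close> are found on the left. If \<open>new_edge\<close> is
  \<open>None\<close>, the new pair carries no relation and the result is not complete.
\<close>
fun amalgam_rel ::
  "nat lstruct set \<Rightarrow> sym list \<Rightarrow> 'a lstruct \<Rightarrow> 'a lstruct \<Rightarrow> 'a lstruct
     \<Rightarrow> sym \<Rightarrow> 'a + 'a \<Rightarrow> 'a + 'a \<Rightarrow> bool" where
  "amalgam_rel S Rs B A C X (Inl a) (Inl a') \<longleftrightarrow> rel A X a a'"
| "amalgam_rel S Rs B A C X (Inr c) (Inr c') \<longleftrightarrow> rel C X c c'"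
| "amalgam_rel S Rs B A C X (Inl a) (Inr c) \<longleftrightarrow>
     (if a \<in> carrier B then rel C X a c else new_edge S Rs B A C a c = Some X)"
| "amalgam_rel S Rs B A C X (Inr c) (Inl a) \<longleftrightarrow>
     (if a \<in> carrier B then rel C X c a else new_edge S Rs B A C a c = Some (conv X))"

definition amalgam ::
  "nat lstruct set \<Rightarrow> sym list \<Rightarrow> 'a lstruct \<Rightarrow> 'a lstruct \<Rightarrow> 'a lstruct \<Rightarrow> ('a + 'a) lstruct" where
  "amalgam S Rs B A C =
     \<lparr>carrier = Inl ` carrier A \<union> Inr ` (carrier C - carrier B), rel = amalgam_rel S Rs B A C\<rparr>"

text \<open>The type argument is the type over which the points of \<open>A\<close>, \<open>B\<close>, \<open>C\<close> range.\<close>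
definition prioritised_semifree :: "'a itself \<Rightarrow> nat lstruct set \<Rightarrow> sym list \<Rightarrow> bool" where
  "prioritised_semifree _ S Rs \<longleftrightarrow> distinct Rs \<and> set Rs \<subset> UNIV \<and>
     (\<forall>A B C :: 'a lstruct. A \<in> Forb_c S \<longrightarrow> B \<in> Forb_c S \<longrightarrow> C \<in> Forb_c S \<longrightarrow>
        substruct B A \<longrightarrow> substruct B C \<longrightarrow> amalgam S Rs B A C \<in> Forb_c S)"

text \<open>Finite structures are represented, up to isomorphism, by structures on natural numbers.\<close>
definition age :: "'a lstruct \<Rightarrow> nat lstruct set" where
  "age M = {A. finite (carrier A) \<and> lstructure A \<and> embeds A M}"

definition Aut :: "'a lstruct \<Rightarrow> ('a \<Rightarrow> 'a) monoid" where
  "Aut M = BijGroup (carrier M) \<lparr>carrier := {f \<in> Bij (carrier M). isomorphism f M M}\<rparr>"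

definition homogeneous :: "'a lstruct \<Rightarrow> bool" where
  "homogeneous M \<longleftrightarrow>
     (\<forall>U V f. finite U \<and> U \<subseteq> carrier M \<and> V \<subseteq> carrier M \<and>
        isomorphism f (M\<lparr>carrier := U\<rparr>) (M\<lparr>carrier := V\<rparr>) \<longrightarrow>
        (\<exists>g\<in>carrier (Aut M). \<forall>x\<in>U. g x = f x))"

definition fraisse_limit :: "nat lstruct set \<Rightarrow> 'a lstruct \<Rightarrow> bool" where
  "fraisse_limit K M \<longleftrightarrow>
     lstructure M \<and> countable (carrier M) \<and> age M = K \<and> homogeneous M"

text \<open>
  The locale \<open>simple_group\<close> of \<open>HOL-Algebra\<close> is unsuitable here: it requires
  \<open>order G > 1\<close>, which is false for infinite groups because \<open>order\<close> is then \<open>0\<close>.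
\<close>
definition is_simple :: "('a, 'b) monoid_scheme \<Rightarrow> bool" where
  "is_simple G \<longleftrightarrow> group G \<and> carrier G \<noteq> {\<one>\<^bsub>G\<^esub>} \<and>
     (\<forall>N. N \<lhd> G \<longrightarrow> N = {\<one>\<^bsub>G\<^esub>} \<or> N = carrier G)"

end

theory Submission
  imports Defs
begin

text \<open>
  All three classes are given by one rule: if \<open>x \<rightarrow> y \<rightarrow> z\<close> is a path of \<open>G\<close>-edges, then the label
  of \<open>(x, z)\<close> lies in \<open>P\<close>, where \<open>P\<close> is \<open>{R\<^sup>+, G\<^sup>+}\<close>, \<open>{R\<^sup>+, G\<^sup>-}\<close> or \<open>{R\<^sup>+}\<close>. A triangle with
  two \<open>R\<close>-edges is never forbidden, and every consistent type over a finite set extends to a larger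
  set by labels \<open>R\<^sup>\<plusminus>\<close> only.

  Simplicity is proved by explicit back-and-forth constructions. Let \<open>g \<noteq> 1\<close> be an automorphism of
  the limit. Every type over a finite set has a realization that is moved by \<open>g\<close>. A generic \<open>f\<close>
  therefore makes \<open>w = g\<inverse> f\<inverse> g f\<close> act freely: \<open>w\<close> has no finite orbits, and every type over a finite
  set has a realization \<open>y\<close> whose orbit avoids that set and for which \<open>(y, w y)\<close> is an \<open>R\<close>-edge. Then
  every automorphism \<open>h\<close> is a product of five conjugates \<open>k\<^sub>i\<inverse> w k\<^sub>i\<close>. The \<open>k\<^sub>i\<close> are built from finite
  partial isomorphisms for which every orbit segment \<open>x\<^sub>0, x\<^sub>1, \<dots>\<close> under the five partial conjugates is
  either trivial or a full chain ending in \<open>h x\<^sub>0\<close>. A new chain is continued from both ends; after two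
  steps the new points have \<open>G\<close>-edges only to points of full chains, where both sides prescribe
  the same labels, so that the two halves can be joined.
\<close>

section \<open>Types and partial isomorphisms\<close>

text \<open>The number five comes from a chain \<open>x0, ..., x4\<close> that has to return to
  \<open>x0\<close>. The two links at \<open>x0\<close> are forced: their types are dictated by
  values assigned earlier, so \<open>x1\<close> and \<open>x4\<close> may have
  \<open>G\<close>-edges to arbitrary points. One generic link on each side repairs this: a
  \<open>G\<close>-edge from the next point to an old point survives only where a link at that old
  point is already present, and such a point lies on a full chain. The fifth link joins the halves.
  It has to satisfy two prescriptions at once; they agree on their overlap because conjugates
  preserve labels along full chains, and outside the overlap they consist of \<open>R\<close>-labels
  only, so no forbidden triangle can arise. Passing to a freely acting commutator is what makes new
  orbits available inside every type: a value taken from a new orbit creates no link by accident.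
  The \<open>R\<close>-edge between \<open>y\<close> and \<open>w y\<close> is used in the same way,
  since the label of two consecutive values is determined by \<open>w\<close> and has to be
  compatible with every other label.\<close>

instance sym :: countable
  by countable_datatype

lemma conv_conv [simp]: "conv (conv X) = X"
  by (cases X) auto

lemma conv_eq_iff [simp]: "conv X = conv Y \<longleftrightarrow> X = Y"
  by (metis conv_conv)

fun opp :: "sym option \<Rightarrow> sym option" where
  "opp None = None" | "opp (Some X) = Some (conv X)"

lemma opp_opp [simp]: "opp (opp p) = p"
  by (cases p) auto

lemma opp_simps [simp]:
  "opp p = Some Gp \<longleftrightarrow> p = Some Gm" "opp p = Some Gm \<longleftrightarrow> p = Some Gp"
  "opp p = Some Rp \<longleftrightarrow> p = Some Rm" "opp p = Some Rm \<longleftrightarrow> p = Some Rp"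
  "opp p = None \<longleftrightarrow> p = None"
  by (cases p; cases "the p"; simp)+

definition is_R :: "sym option \<Rightarrow> bool" where
  "is_R p \<longleftrightarrow> p = Some Rp \<or> p = Some Rm"

lemma is_R_simps [simp]:
  "is_R (Some Rp)" "is_R (Some Rm)" "\<not> is_R (Some Gp)" "\<not> is_R (Some Gm)" "\<not> is_R None"
  "is_R (opp p) \<longleftrightarrow> is_R p"
  by (auto simp: is_R_def)

text \<open>Requirement number \<open>n\<close> of a fixed enumeration is met at stage
  \<open>n + 1\<close>. Persistence is not built in: whatever has to survive later stages must
  follow from \<open>ext\<close>.\<close>

lemma back_and_forth_chain:
  fixes req :: "'r::countable \<Rightarrow> 's \<Rightarrow> bool"
  assumes start: "inv_st s0"
    and step: "\<And>s r. inv_st s \<Longrightarrow> \<exists>s'. inv_st s' \<and> ext s s' \<and> req r s'"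
    and refl: "\<And>s. ext s s"
    and trans: "\<And>s s' s''. ext s s' \<Longrightarrow> ext s' s'' \<Longrightarrow> ext s s''"
  shows "\<exists>st :: nat \<Rightarrow> 's. st 0 = s0 \<and> (\<forall>n. inv_st (st n)) \<and>
    (\<forall>m n. m \<le> n \<longrightarrow> ext (st m) (st n)) \<and> (\<forall>r. \<exists>n. req r (st n))"
proof -
  have "\<exists>st. \<forall>n. (inv_st (st n) \<and> (n = 0 \<longrightarrow> st n = s0)) \<and>
    (ext (st n) (st (Suc n)) \<and> req (from_nat n) (st (Suc n)))"
    by (rule dependent_nat_choice) (use start step in auto)
  then obtain st where st: "\<And>n. inv_st (st n)" "st 0 = s0"
    "\<And>n. ext (st n) (st (Suc n))" "\<And>n. req (from_nat n) (st (Suc n))" by blast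
  have "ext (st m) (st n)" if "m \<le> n" for m n
    using that by (induction rule: dec_induct) (auto intro: refl trans st)
  moreover have "\<exists>n. req r (st n)" for r
    using st(4)[of "to_nat r"] by auto
  ultimately show ?thesis using st(1,2) by blast
qed

text \<open>Over a countable set of points the association lists form a countable type, so a type
  over a finite set can serve as the index of a requirement.\<close>

lemma function_as_list:
  fixes t :: "'u \<Rightarrow> 'v option"
  assumes "finite U" "\<And>u. u \<in> U \<Longrightarrow> t u \<noteq> None"
  obtains l where "fst ` set l = U" "\<And>u. u \<in> U \<Longrightarrow> map_of l u = t u"
proof -
  obtain us where us: "set us = U" using finite_list[OF assms(1)] by blast
  define l where "l = map (\<lambda>u. (u, the (t u))) us"
  have "fst ` set l = U" using us by (force simp: l_def)
  moreover have "map_of l u = t u" if "u \<in> U" for u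
  proof -
    have "map_of l u = Some (the (t u))"
      using that us by (simp add: l_def map_of_map_restrict restrict_map_def)
    then show ?thesis using assms(2)[OF that] by simp
  qed
  ultimately show ?thesis using that by blast
qed

text \<open>
  \<open>P\<close> is the set of labels permitted for the pair \<open>(x, z)\<close> when \<open>x \<rightarrow> y \<rightarrow> z\<close> is a path of
  \<open>G\<close>-edges. A label \<open>None\<close> stands for equality of the two points.
\<close>
locale path_rule =
  fixes P :: "sym set"
  assumes Rp_P: "Rp \<in> P" and Rm_P: "Rm \<notin> P" and G_P: "\<not> (Gp \<in> P \<and> Gm \<in> P)"
begin

definition perm :: "sym option \<Rightarrow> bool" where
  "perm p \<longleftrightarrow> p \<in> Some ` P"

text \<open>For labels \<open>p\<close>, \<open>q\<close>, \<open>r\<close> of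
  \<open>(x, y)\<close>, \<open>(x, z)\<close>, \<open>(y, z)\<close> the six conjuncts are the six
  directions in which a \<open>G\<close>-path can run through three points. As \<open>None\<close>
  is never permitted, a \<open>G\<close>-path of length two cannot return to its start.\<close>

definition tri :: "sym option \<Rightarrow> sym option \<Rightarrow> sym option \<Rightarrow> bool" where
  "tri p q r \<longleftrightarrow>
     (p = Some Gp \<and> r = Some Gp \<longrightarrow> perm q) \<and> (p = Some Gm \<and> r = Some Gm \<longrightarrow> perm (opp q)) \<and>
     (p = Some Gm \<and> q = Some Gp \<longrightarrow> perm r) \<and> (p = Some Gp \<and> q = Some Gm \<longrightarrow> perm (opp r)) \<and>
     (q = Some Gp \<and> r = Some Gm \<longrightarrow> perm p) \<and> (q = Some Gm \<and> r = Some Gp \<longrightarrow> perm (opp p))"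

lemma perm_Rp [simp]: "perm (Some Rp)" and perm_Rm [simp]: "\<not> perm (Some Rm)"
  and perm_None [simp]: "\<not> perm None"
  using Rp_P Rm_P by (auto simp: perm_def)

text \<open>Antisymmetry of the path rule. It turns a \<open>G\<close>-cycle of length four into a
  contradiction, in \<open>type_extension\<close> as well as in \<open>new_edge_R\<close>.\<close>

lemma perm_opp: "perm p \<Longrightarrow> \<not> perm (opp p)"
  using Rp_P Rm_P G_P by (cases "the p") (auto simp: perm_def)

lemma tri_swap: "tri p q r \<Longrightarrow> tri q p (opp r)"
  unfolding tri_def by simp

lemma tri_rotate: "tri p q r \<Longrightarrow> tri r (opp p) (opp q)"
  unfolding tri_def by simp

lemma tri_two_R:
  "is_R p \<Longrightarrow> is_R q \<Longrightarrow> tri p q r" "is_R p \<Longrightarrow> is_R r \<Longrightarrow> tri p q r"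
  "is_R q \<Longrightarrow> is_R r \<Longrightarrow> tri p q r"
  unfolding is_R_def tri_def by (elim disjE; simp)+

definition structure_on :: "'a set \<Rightarrow> ('a \<Rightarrow> 'a \<Rightarrow> sym option) \<Rightarrow> bool" where
  "structure_on V c \<longleftrightarrow> (\<forall>x\<in>V. \<forall>y\<in>V. (c x y = None \<longleftrightarrow> x = y) \<and> c y x = opp (c x y) \<and>
     (\<forall>z\<in>V. tri (c x y) (c x z) (c y z)))"

lemma structure_onD:
  assumes "structure_on V c" "x \<in> V" "y \<in> V"
  shows "c x y = None \<longleftrightarrow> x = y" "c y x = opp (c x y)"
    "z \<in> V \<Longrightarrow> tri (c x y) (c x z) (c y z)"
proof -
  note * = assms(1)[unfolded structure_on_def, THEN bspec, OF assms(2), THEN bspec, OF assms(3)]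
  show "c x y = None \<longleftrightarrow> x = y" by (rule conjunct1[OF *])
  show "c y x = opp (c x y)" by (rule conjunct1[OF conjunct2[OF *]])
  show "z \<in> V \<Longrightarrow> tri (c x y) (c x z) (c y z)"
    by (rule bspec[OF conjunct2[OF conjunct2[OF *]]])
qed

lemma structure_onI:
  assumes "\<And>x y. x \<in> V \<Longrightarrow> y \<in> V \<Longrightarrow> c x y = None \<longleftrightarrow> x = y"
    "\<And>x y. x \<in> V \<Longrightarrow> y \<in> V \<Longrightarrow> c y x = opp (c x y)"
    "\<And>x y z. x \<in> V \<Longrightarrow> y \<in> V \<Longrightarrow> z \<in> V \<Longrightarrow> tri (c x y) (c x z) (c y z)"
  shows "structure_on V c"
  unfolding structure_on_def by (intro ballI conjI assms)

lemma structure_on_mono: "structure_on V c \<Longrightarrow> U \<subseteq> V \<Longrightarrow> structure_on U c"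
  by (intro structure_onI) (meson structure_onD subsetD)+

lemma structure_on_cong:
  assumes c: "structure_on V c" and eq: "\<And>x y. x \<in> V \<Longrightarrow> y \<in> V \<Longrightarrow> c' x y = c x y"
  shows "structure_on V c'"
proof (rule structure_onI)
  show "c' x y = None \<longleftrightarrow> x = y" if "x \<in> V" "y \<in> V" for x y
    using structure_onD(1)[OF c that] eq[OF that] by simp
  show "c' y x = opp (c' x y)" if "x \<in> V" "y \<in> V" for x y
    using structure_onD(2)[OF c that] eq[OF that] eq[OF that(2,1)] by simp
  show "tri (c' x y) (c' x z) (c' y z)" if "x \<in> V" "y \<in> V" "z \<in> V" for x y z
    using structure_onD(3)[OF c that] eq that by simp
qed

text \<open>The quantifier-free type of a point \<open>x\<close> outside \<open>U\<close>, where
  \<open>t u\<close> is the label of \<open>(x, u)\<close>.\<close>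

definition type_over :: "('a \<Rightarrow> 'a \<Rightarrow> sym option) \<Rightarrow> 'a set \<Rightarrow> ('a \<Rightarrow> sym option) \<Rightarrow> bool" where
  "type_over c U t \<longleftrightarrow> (\<forall>u\<in>U. t u \<noteq> None \<and> (\<forall>v\<in>U. tri (t u) (t v) (c u v)))"

lemma type_overD:
  assumes "type_over c U t" "u \<in> U"
  shows "t u \<noteq> None" "v \<in> U \<Longrightarrow> tri (t u) (t v) (c u v)"
  using assms by (auto simp: type_over_def)

lemma type_over_mono: "type_over c U t \<Longrightarrow> V \<subseteq> U \<Longrightarrow> type_over c V t"
  unfolding type_over_def by blast

lemma type_over_empty [simp]: "type_over c {} t"
  by (simp add: type_over_def)

lemma type_over_cong: "(\<And>u. u \<in> U \<Longrightarrow> t u = t' u) \<Longrightarrow> type_over c U t \<longleftrightarrow> type_over c U t'"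
  unfolding type_over_def by simp

lemma type_over_all_R: "(\<And>u. u \<in> U \<Longrightarrow> is_R (t u)) \<Longrightarrow> type_over c U t"
  unfolding type_over_def by (metis is_R_simps(5) tri_two_R(1))

text \<open>
  The label of a new pair is forced to be an \<open>R\<close> of a given direction by a \<open>G\<close>-path through a
  point of \<open>U\<close>; opposite requirements would close a \<open>G\<close>-cycle of length four, whose diagonal then
  has a label that is permitted in both directions.
\<close>
lemma type_extension:
  assumes c: "structure_on V c" and UW: "U \<subseteq> V" "W \<subseteq> V" and t: "type_over c U t"
  obtains t' where "type_over c (U \<union> W) t'" "\<And>u. u \<in> U \<Longrightarrow> t' u = t u"
    "\<And>w. w \<in> W - U \<Longrightarrow> is_R (t' w)"
proof -
  \<comment> \<open>For a point \<open>x\<close> of type \<open>t\<close>, a \<open>G\<close>-path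
    \<open>w \<rightarrow> u \<rightarrow> x\<close> allows only the positive \<open>R\<close>-label
    on \<open>(w, x)\<close>, which is \<open>Rm\<close> on \<open>(x, w)\<close>. In all other
    cases \<open>Rp\<close> is the default.\<close>
  define t' where "t' w = (if w \<in> U then t w
    else if \<exists>u\<in>U. t u = Some Gm \<and> c w u = Some Gp then Some Rm else Some Rp)" for w
  have R: "is_R (t' w)" if "w \<notin> U" for w
    using that by (auto simp: t'_def)
  have sym: "c y x = opp (c x y)" if "x \<in> U \<union> W" "y \<in> U \<union> W" for x y
    using structure_onD(2)[OF c] UW that by blast
  have tr: "tri (c x y) (c x z) (c y z)" if "x \<in> U \<union> W" "y \<in> U \<union> W" "z \<in> U \<union> W" for x y z
    using structure_onD(3)[OF c] UW that by blast
  have mixed: "tri (t' u) (t' w) (c u w)" if u: "u \<in> U" and w: "w \<in> W" "w \<notin> U" for u w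
  proof (cases "t u = Some Gp \<and> c u w = Some Gp")
    case True
    have "t' w = Some Rp"
    proof (rule ccontr)
      assume "t' w \<noteq> Some Rp"
      then obtain u' where u': "u' \<in> U" "t u' = Some Gm" "c w u' = Some Gp"
        using w by (auto simp: t'_def split: if_splits)
      have "perm (opp (c u u'))"
        using type_overD(2)[OF t u u'(1)] True u' by (auto simp: tri_def)
      moreover have "perm (c u u')"
        using tr[of u w u'] True u' u w by (auto simp: tri_def)
      ultimately show False using perm_opp by blast
    qed
    then show ?thesis using True u w by (simp add: t'_def tri_def)
  next
    case False
    have "t' w = Some Rm" if "t u = Some Gm" "c u w = Some Gm"
      using that u w sym[of u w] by (auto simp: t'_def)
    moreover have "t' u = t u" using u by (simp add: t'_def)
    ultimately show ?thesis using False R[OF w(2)]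
      unfolding tri_def is_R_def by (elim disjE) auto
  qed
  have "type_over c (U \<union> W) t'"
    unfolding type_over_def
  proof (intro ballI conjI)
    fix u v assume uv: "u \<in> U \<union> W" "v \<in> U \<union> W"
    show "t' u \<noteq> None" using t uv by (auto simp: t'_def type_over_def)
    consider "u \<in> U" "v \<in> U" | "u \<in> U" "v \<notin> U" | "u \<notin> U" "v \<in> U" | "u \<notin> U" "v \<notin> U" by blast
    then show "tri (t' u) (t' v) (c u v)"
    proof cases
      case 1 then show ?thesis using t by (auto simp: t'_def type_over_def)
    next
      case 2 then show ?thesis using mixed uv by auto
    next
      case 3
      then have "tri (t' v) (t' u) (c v u)" using mixed uv by auto
      then show ?thesis by (metis tri_swap sym[OF uv(2) uv(1)])
    next
      case 4 then show ?thesis by (intro tri_two_R(1) R)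
    qed
  qed
  then show ?thesis using that R by (auto simp: t'_def)
qed

end

text \<open>The extension property is the form in which a Fraisse limit is used below. The points
  fill a whole countable type, so automorphisms are plain bijections.\<close>

locale generic_structure = path_rule +
  fixes c :: "'a::countable \<Rightarrow> 'a \<Rightarrow> sym option"
  assumes c_structure: "structure_on UNIV c"
    and realization: "finite U \<Longrightarrow> type_over c U t \<Longrightarrow> \<exists>x. \<forall>u\<in>U. c x u = t u"
begin

lemma c_None [simp]: "c x y = None \<longleftrightarrow> x = y"
  using structure_onD(1)[OF c_structure] by simp

lemma c_self [simp]: "c x x = None"
  by simp

lemma c_opp: "c y x = opp (c x y)"
  by (rule structure_onD(2)[OF c_structure UNIV_I UNIV_I])

lemma c_tri: "tri (c x y) (c x z) (c y z)"
  using structure_onD(3)[OF c_structure] by simp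

lemma type_over_point: "z \<notin> U \<Longrightarrow> type_over c U (c z)"
  by (auto simp: type_over_def c_tri)

text \<open>Such a \<open>Q\<close> may be demanded of the new point in every one-point extension.
  It is instantiated with being moved by an automorphism and with lying in a new orbit.\<close>

definition dense_pred :: "('a \<Rightarrow> bool) \<Rightarrow> bool" where
  "dense_pred Q \<longleftrightarrow>
     (\<forall>U t. finite U \<longrightarrow> type_over c U t \<longrightarrow> (\<exists>x. (\<forall>u\<in>U. c x u = t u) \<and> Q x))"

lemma dense_predD:
  "dense_pred Q \<Longrightarrow> finite U \<Longrightarrow> type_over c U t \<Longrightarrow> \<exists>x. (\<forall>u\<in>U. c x u = t u) \<and> Q x"
  by (simp add: dense_pred_def)

lemma dense_pred_True: "dense_pred (\<lambda>x. True)"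
  using realization by (simp add: dense_pred_def)

text \<open>Nothing is prescribed towards the points of \<open>W\<close> outside \<open>U\<close>,
  so \<open>type_extension\<close> joins the new point to them by \<open>R\<close>-edges. Since an
  \<open>R\<close>-label is not \<open>None\<close>, the new point differs from them.\<close>

lemma realization_R:
  assumes Q: "dense_pred Q" and fin: "finite U" "finite W" and t: "type_over c U t"
  obtains x where "\<And>u. u \<in> U \<Longrightarrow> c x u = t u" "\<And>w. w \<in> W - U \<Longrightarrow> is_R (c x w)"
    "x \<notin> U" "x \<notin> W" "Q x"
proof -
  obtain t' where t': "type_over c (U \<union> W) t'" "\<And>u. u \<in> U \<Longrightarrow> t' u = t u"
    "\<And>w. w \<in> W - U \<Longrightarrow> is_R (t' w)"
    using type_extension[OF c_structure _ _ t, of W] by auto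
  then obtain x where x: "\<forall>u\<in>U \<union> W. c x u = t' u" "Q x"
    using dense_predD[OF Q, of "U \<union> W" t'] fin by auto
  have "x \<notin> U \<union> W" using x t'(1) by (metis c_self type_overD(1))
  then show ?thesis using that[of x] x t' by auto
qed

text \<open>A set of pairs instead of a function: as \<open>None\<close> means equality,
  preservation of labels already makes the relation single-valued and injective, and the converse is
  of the same kind.\<close>

definition partial_iso :: "('a \<times> 'a) set \<Rightarrow> bool" where
  "partial_iso k \<longleftrightarrow> (\<forall>(x, y)\<in>k. \<forall>(x', y')\<in>k. c x x' = c y y')"

lemma partial_isoD: "partial_iso k \<Longrightarrow> (x, y) \<in> k \<Longrightarrow> (x', y') \<in> k \<Longrightarrow> c x x' = c y y'"
  by (auto simp: partial_iso_def)

lemma partial_isoI: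
  "(\<And>x y x' y'. (x, y) \<in> k \<Longrightarrow> (x', y') \<in> k \<Longrightarrow> c x x' = c y y') \<Longrightarrow> partial_iso k"
  by (auto simp: partial_iso_def)

lemma partial_iso_eq_iff: "partial_iso k \<Longrightarrow> (x, y) \<in> k \<Longrightarrow> (x', y') \<in> k \<Longrightarrow> x = x' \<longleftrightarrow> y = y'"
  using partial_isoD[of k x y x' y'] by (metis c_None)

lemma partial_iso_empty [simp]: "partial_iso {}"
  by (simp add: partial_iso_def)

lemma partial_iso_converse [simp]: "partial_iso (k\<inverse>) \<longleftrightarrow> partial_iso k"
  by (metis converse_converse converse_iff partial_isoD partial_isoI)

lemma partial_iso_subset: "partial_iso k \<Longrightarrow> k' \<subseteq> k \<Longrightarrow> partial_iso k'"
  unfolding partial_iso_def by blast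

lemma partial_iso_insert:
  assumes "partial_iso k" "\<And>a b. (a, b) \<in> k \<Longrightarrow> c x a = c y b"
  shows "partial_iso (insert (x, y) k)"
proof -
  have "c a x = c b y" if "(a, b) \<in> k" for a b
    using assms(2)[OF that] c_opp by metis
  then show ?thesis using assms unfolding partial_iso_def by auto
qed

lemma transport_function:
  assumes "partial_iso k"
  obtains t where "\<And>a b. (a, b) \<in> k \<Longrightarrow> t b = s a"
proof
  show "s (SOME a. (a, b) \<in> k) = s a" if "(a, b) \<in> k" for a b
    using someI[of "\<lambda>a. (a, b) \<in> k", OF that] partial_iso_eq_iff[OF assms that] by auto
qed

lemma transport_type:
  assumes k: "partial_iso k" and s: "type_over c U s"
    and t: "\<And>b. b \<in> V \<Longrightarrow> \<exists>a\<in>U. (a, b) \<in> k \<and> t b = s a"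
  shows "type_over c V t"
  unfolding type_over_def
proof (intro ballI conjI)
  fix b b' assume b: "b \<in> V" "b' \<in> V"
  obtain a where a: "a \<in> U" "(a, b) \<in> k" "t b = s a" using t b by blast
  obtain a' where a': "a' \<in> U" "(a', b') \<in> k" "t b' = s a'" using t b by blast
  show "t b \<noteq> None" using type_overD[OF s] a by simp
  show "tri (t b) (t b') (c b b')"
    using type_overD(2)[OF s a(1) a'(1)] partial_isoD[OF k a(2) a'(2)] a a' by simp
qed

text \<open>The labels of \<open>x\<close> to \<open>Range k\<close> are dictated by those of
  \<open>z\<close> to \<open>Domain k\<close>; towards the rest of \<open>W\<close> they are free
  and are made \<open>R\<close>.\<close>

lemma extend_domain:
  assumes Q: "dense_pred Q" and k: "partial_iso k" "finite k" and W: "finite W" and z: "z \<notin> Domain k"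
  obtains x where "partial_iso (insert (z, x) k)" "x \<notin> Range k" "x \<notin> W"
    "\<And>w. w \<in> W - Range k \<Longrightarrow> is_R (c x w)" "Q x"
proof -
  obtain t where t: "\<And>a b. (a, b) \<in> k \<Longrightarrow> t b = c z a"
    using transport_function[OF k(1)] by blast
  have type: "type_over c (Range k) t"
    by (rule transport_type[OF k(1) type_over_point[OF z]]) (use t in auto)
  obtain x where x: "\<And>u. u \<in> Range k \<Longrightarrow> c x u = t u" "x \<notin> Range k" "x \<notin> W"
    "\<And>w. w \<in> W - Range k \<Longrightarrow> is_R (c x w)" "Q x"
    by (rule realization_R[OF Q finite_Range[OF k(2)] W type]) blast
  then show ?thesis
    using that partial_iso_insert[OF k(1), of z x] t by (metis RangeI)
qed

lemma extend_range:
  assumes Q: "dense_pred Q" and k: "partial_iso k" "finite k" and W: "finite W" and y: "y \<notin> Range k"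
  obtains z where "partial_iso (insert (z, y) k)" "z \<notin> Domain k" "z \<notin> W"
    "\<And>w. w \<in> W - Domain k \<Longrightarrow> is_R (c z w)" "Q z"
proof -
  obtain z where z: "partial_iso (insert (y, z) (k\<inverse>))" "z \<notin> Range (k\<inverse>)" "z \<notin> W"
    "\<And>w. w \<in> W - Range (k\<inverse>) \<Longrightarrow> is_R (c z w)" "Q z"
    using extend_domain[OF Q, of "k\<inverse>" W y] k W y by (auto simp del: Range_converse)
  have "insert (y, z) (k\<inverse>) = (insert (z, y) k)\<inverse>" by auto
  then show ?thesis using that z by simp
qed

section \<open>Automorphisms and homogeneity\<close>

definition aut :: "('a \<Rightarrow> 'a) \<Rightarrow> bool" where
  "aut f \<longleftrightarrow> bij f \<and> (\<forall>x y. c (f x) (f y) = c x y)"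

abbreviation inverse_fun :: "('a \<Rightarrow> 'a) \<Rightarrow> 'a \<Rightarrow> 'a" where
  "inverse_fun \<equiv> inv_into UNIV"

lemma aut_iso [simp]: "aut f \<Longrightarrow> c (f x) (f y) = c x y"
  by (simp add: aut_def)

lemma aut_inv_f [simp]: "aut f \<Longrightarrow> inverse_fun f (f x) = x"
  by (simp add: aut_def bij_is_inj)

lemma aut_f_inv [simp]: "aut f \<Longrightarrow> f (inverse_fun f x) = x"
  by (simp add: aut_def bij_is_surj surj_f_inv_f)

lemma aut_inv [simp]: "aut f \<Longrightarrow> aut (inverse_fun f)"
  unfolding aut_def by (metis bij_imp_bij_inv bij_inv_eq_iff)

lemma aut_inv_inv [simp]: "aut f \<Longrightarrow> inverse_fun (inverse_fun f) = f"
  by (simp add: aut_def inv_inv_eq)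

lemma aut_comp: "aut f \<Longrightarrow> aut g \<Longrightarrow> aut (f \<circ> g)"
  unfolding aut_def by (simp add: bij_comp)

lemma aut_id [simp]: "aut id"
  by (simp add: aut_def)

lemma aut_inj [simp]: "aut f \<Longrightarrow> f x = f y \<longleftrightarrow> x = y"
  by (metis aut_inv_f)

lemma type_over_vimage:
  assumes "aut f" "type_over c U t"
  shows "type_over c (inverse_fun f ` U) (\<lambda>x. t (f x))"
proof (rule transport_type)
  show "partial_iso {(x, inverse_fun f x) |x. True}"
    using assms(1) by (auto simp: partial_iso_def)
qed (use assms in auto)

lemma total_partial_iso:
  assumes k: "partial_iso k" and "Domain k = UNIV" "Range k = UNIV"
  obtains f where "aut f" "\<And>x y. (x, y) \<in> k \<longleftrightarrow> f x = y"
proof -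
  have "\<forall>x. \<exists>y. (x, y) \<in> k" using assms(2) by (metis Domain_iff UNIV_I)
  then obtain f where f: "\<And>x. (x, f x) \<in> k" by metis
  have f': "(x, y) \<in> k \<longleftrightarrow> f x = y" for x y
    using f[of x] partial_iso_eq_iff[OF k f[of x], of x y] by auto
  have "inj f" using partial_iso_eq_iff[OF k f f] by (auto simp: inj_def)
  moreover have "surj f" using assms(3) f' by (metis RangeE UNIV_I surjI surj_def)
  moreover have "c (f x) (f y) = c x y" for x y using partial_isoD[OF k f f] by simp
  ultimately show ?thesis using that f' by (auto simp: aut_def bij_def)
qed

lemma partial_iso_Union:
  assumes "\<And>n. partial_iso (k n)" "\<And>m n. m \<le> n \<Longrightarrow> k m \<subseteq> k n"
  shows "partial_iso (\<Union>n::nat. k n)"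
  unfolding partial_iso_def
proof clarsimp
  fix x y x' y' m n assume "(x, y) \<in> k m" "(x', y') \<in> k n"
  then have "(x, y) \<in> k (max m n)" "(x', y') \<in> k (max m n)"
    using assms(2)[of m "max m n"] assms(2)[of n "max m n"] by auto
  then show "c x x' = c y y'" using partial_isoD[OF assms(1)] by blast
qed

lemma homogeneity:
  assumes "partial_iso k" "finite k"
  obtains f where "aut f" "\<And>x y. (x, y) \<in> k \<Longrightarrow> f x = y"
proof -
  let ?inv = "\<lambda>s. finite s \<and> partial_iso s" and ?req = "\<lambda>x s. x \<in> Domain s \<and> x \<in> Range s"
  have "\<exists>s'. ?inv s' \<and> s \<subseteq> s' \<and> ?req x s'" if s: "?inv s" for s x
  proof -
    have "\<exists>s'. (finite s' \<and> partial_iso s') \<and> s \<subseteq> s' \<and> x \<in> Domain s'"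
    proof (cases "x \<in> Domain s")
      case False
      then obtain y where "partial_iso (insert (x, y) s)"
        using extend_domain[OF dense_pred_True conjunct2[OF s] conjunct1[OF s] finite.emptyI False] by blast
      then show ?thesis using s by (intro exI[of _ "insert (x, y) s"]) auto
    qed (use s in auto)
    then obtain s1 where s1: "finite s1" "partial_iso s1" "s \<subseteq> s1" "x \<in> Domain s1" by blast
    have "\<exists>s'. (finite s' \<and> partial_iso s') \<and> s1 \<subseteq> s' \<and> x \<in> Range s'"
    proof (cases "x \<in> Range s1")
      case False
      then obtain y where "partial_iso (insert (y, x) s1)"
        using extend_range[OF dense_pred_True s1(2,1) finite.emptyI False] by blast
      then show ?thesis using s1 by (intro exI[of _ "insert (y, x) s1"]) auto
    qed (use s1 in auto)
    then show ?thesis using s1 by blast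
  qed
  then have "\<exists>st. st 0 = k \<and> (\<forall>n. ?inv (st n)) \<and> (\<forall>m n. m \<le> n \<longrightarrow> st m \<subseteq> st n) \<and>
    (\<forall>r. \<exists>n::nat. ?req r (st n))"
    using assms by (intro back_and_forth_chain) auto
  then obtain st :: "nat \<Rightarrow> ('a \<times> 'a) set" where st: "st 0 = k" "\<And>n. ?inv (st n)"
    "\<And>m n. m \<le> n \<Longrightarrow> st m \<subseteq> st n" "\<And>r. \<exists>n. ?req r (st n)" by blast
  have "partial_iso (\<Union>n. st n)" using partial_iso_Union st by blast
  moreover have "x \<in> Domain (\<Union>n. st n) \<and> x \<in> Range (\<Union>n. st n)" for x
  proof -
    obtain n where "x \<in> Domain (st n)" "x \<in> Range (st n)" using st(4)[of x] by blast
    then show ?thesis by blast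
  qed
  then have "Domain (\<Union>n. st n) = UNIV" "Range (\<Union>n. st n) = UNIV" by blast+
  ultimately obtain f where "aut f" "\<And>x y. (x, y) \<in> (\<Union>n. st n) \<longleftrightarrow> f x = y"
    by (rule total_partial_iso) blast
  then show ?thesis using that st(1) by blast
qed

text \<open>Suppose that all realizations of \<open>t\<close> are fixed by \<open>g\<close>. A point
  \<open>q\<close> joined to \<open>U\<close> by \<open>R\<close>-edges only, with
  \<open>g q\<close> outside \<open>U\<close>, can be told apart from \<open>g q\<close> by the
  labels of a realization if the two differ; as the realization is fixed, \<open>g q = q\<close>. A
  suitable \<open>q\<close> of this kind tells \<open>a\<close> from \<open>g a\<close>, so that
  \<open>g\<close> would fix every \<open>a\<close>.\<close>

lemma moved_dense:
  assumes g: "aut g" "g \<noteq> id"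
  shows "dense_pred (\<lambda>x. g x \<noteq> x)"
  unfolding dense_pred_def
proof (intro allI impI, rule ccontr)
  fix U t assume U: "finite U" and t: "type_over c U t"
    and none: "\<not> (\<exists>x. (\<forall>u\<in>U. c x u = t u) \<and> g x \<noteq> x)"
  have fixed: "g x = x" if "\<forall>u\<in>U. c x u = t u" for x
    using none that by blast
  have fixed_R: "g q = q" if q: "\<forall>u\<in>U. is_R (c q u)" "g q \<notin> U" for q
  proof (rule ccontr)
    assume ne: "g q \<noteq> q"
    have qU: "q \<notin> U" using q(1) by force
    obtain t' where t': "type_over c (U \<union> {g q}) t'" "\<And>u. u \<in> U \<Longrightarrow> t' u = t u"
      "is_R (t' (g q))"
      using type_extension[OF c_structure _ _ t, of "{g q}"] q by auto
    \<comment> \<open>An \<open>R\<close>-label for \<open>q\<close> that differs from the label for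
      \<open>g q\<close>. Every triangle containing the new point and \<open>q\<close> then has two
      \<open>R\<close>-edges.\<close>
    define X where "X = (if t' (g q) = Some Rp then Rm else Rp)"
    define t'' where "t'' = t'(q := Some X)"
    have X: "is_R (Some X)" "t' (g q) \<noteq> Some X" by (auto simp: X_def)
    have "type_over c (insert q (U \<union> {g q})) t''"
      unfolding type_over_def
    proof (intro ballI conjI)
      fix u v assume uv: "u \<in> insert q (U \<union> {g q})" "v \<in> insert q (U \<union> {g q})"
      show "t'' u \<noteq> None" using uv type_overD(1)[OF t'(1)] by (auto simp: t''_def)
      have one: "tri (Some X) (t'' v) (c q v)" if "v \<in> insert q (U \<union> {g q})" for v
        using that X(1) t'(3) q(1) qU by (auto simp: t''_def intro: tri_two_R)
      show "tri (t'' u) (t'' v) (c u v)"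
      proof (cases "u = q \<or> v = q")
        case True
        then show ?thesis
        proof
          assume "u = q" then show ?thesis using one[OF uv(2)] by (simp add: t''_def)
        next
          assume "v = q" then show ?thesis using tri_swap[OF one[OF uv(1)]]
            by (simp add: t''_def c_opp[of q u])
        qed
      next
        case False
        then show ?thesis using uv type_overD(2)[OF t'(1)] by (auto simp: t''_def)
      qed
    qed
    then obtain x where x: "\<forall>u\<in>insert q (U \<union> {g q}). c x u = t'' u"
      using realization[of "insert q (U \<union> {g q})" t''] U by auto
    have "g x = x" using x qU t'(2) by (intro fixed) (auto simp: t''_def)
    then have "c x (g q) = c x q" using g(1) by (metis aut_iso)
    then show False using x X(2) ne by (simp add: t''_def)
  qed
  obtain a where a: "g a \<noteq> a" using g(2) by (metis ext id_apply)
  \<comment> \<open>The preimage of \<open>U\<close> keeps \<open>g q\<close> outside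
    \<open>U\<close>; \<open>a\<close> and \<open>g a\<close> are the points that \<open>q\<close>
    has to tell apart.\<close>
  define W where "W = U \<union> inverse_fun g ` U \<union> {a, g a}"
  have W: "finite W" using U by (simp add: W_def)
  have "type_over c W (\<lambda>w. if w = a then Some Rp else Some Rm)"
    by (rule type_over_all_R) auto
  then obtain q where q: "\<forall>u\<in>W. c q u = (if u = a then Some Rp else Some Rm)"
    using realization[OF W] by blast
  have "g q \<notin> U"
  proof
    assume "g q \<in> U"
    then have "q \<in> W" using g by (auto simp: W_def intro: image_eqI[of _ _ "g q"])
    then show False using q by (metis c_self option.distinct(1))
  qed
  then have "g q = q" using q by (intro fixed_R) (auto simp: W_def)
  then have "c q (g a) = c q a" using g(1) by (metis aut_iso)
  then show False using q a by (auto simp: W_def)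
qed

end

section \<open>A commutator that acts freely\<close>

text \<open>No edge enters \<open>z\<close> and none leaves \<open>q\<close>, so a new edge is the
  first or the last one of its path. Paths between other points are therefore old.\<close>

lemma trancl_new_source_sink:
  assumes new: "\<And>a b. (a, b) \<in> E' \<Longrightarrow> (a, b) \<in> E \<or> a = z \<or> b = q"
    and z: "z \<notin> Range E'" and q: "q \<notin> Domain E'" and ab: "(a, b) \<in> E'\<^sup>+"
  shows "(a, b) \<in> E\<^sup>+ \<or> a = z \<or> b = q"
  using ab
proof (induction rule: trancl_induct)
  case (base b)
  then show ?case using new by blast
next
  case (step b b')
  have "b \<noteq> q" using q step(2) by blast
  moreover have "b \<noteq> z" using z step(1) by (metis Range.intros trancl_range)
  ultimately show ?case using step new[OF step(2)] by (metis trancl.trancl_into_trancl)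
qed

context generic_structure
begin

text \<open>The part of the graph of \<open>g\<inverse> f\<inverse> g f\<close> that is determined by a partial map \<open>f\<close>.\<close>
definition comm_graph :: "('a \<Rightarrow> 'a) \<Rightarrow> ('a \<times> 'a) set \<Rightarrow> ('a \<times> 'a) set" where
  "comm_graph g f = {(x, x'). \<exists>y. (x, y) \<in> f \<and> (g x', g y) \<in> f}"

lemma comm_graph_mono: "f \<subseteq> f' \<Longrightarrow> comm_graph g f \<subseteq> comm_graph g f'"
  unfolding comm_graph_def by blast

text \<open>\<open>Domain f\<close> and its preimage under \<open>g\<close> contain all vertices of
  \<open>comm_graph g f\<close>. Acyclicity is the finite form of the statement that no positive
  power of the commutator has a fixed point.\<close>

definition comm_state :: "('a \<Rightarrow> 'a) \<Rightarrow> ('a \<times> 'a) set \<times> 'a set \<Rightarrow> bool" where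
  "comm_state g s \<longleftrightarrow> finite (fst s) \<and> partial_iso (fst s) \<and> finite (snd s) \<and>
     Domain (fst s) \<subseteq> snd s \<and> inverse_fun g ` Domain (fst s) \<subseteq> snd s \<and> acyclic (comm_graph g (fst s))"

text \<open>
  The second component of a state is a finite set of points among which later extensions must not
  create new paths.
\<close>
definition comm_ext :: "('a \<Rightarrow> 'a) \<Rightarrow> ('a \<times> 'a) set \<times> 'a set \<Rightarrow> ('a \<times> 'a) set \<times> 'a set \<Rightarrow> bool" where
  "comm_ext g s s' \<longleftrightarrow> fst s \<subseteq> fst s' \<and> snd s \<subseteq> snd s' \<and>
     (\<forall>a\<in>snd s. \<forall>b\<in>snd s. (a, b) \<in> (comm_graph g (fst s'))\<^sup>+ \<longrightarrow> (a, b) \<in> (comm_graph g (fst s))\<^sup>+)"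

lemma comm_ext_refl: "comm_ext g s s"
  by (simp add: comm_ext_def)

lemma comm_ext_trans: "comm_ext g s s' \<Longrightarrow> comm_ext g s' s'' \<Longrightarrow> comm_ext g s s''"
  unfolding comm_ext_def by (meson subsetD subset_trans)

lemma comm_state_insert:
  assumes s: "comm_state g (f, T)" and "partial_iso (insert (x, y) f)"
    and "acyclic (comm_graph g (insert (x, y) f))"
  shows "comm_state g (insert (x, y) f, T \<union> {x, inverse_fun g x})"
proof -
  have "Domain f \<subseteq> T" "inverse_fun g ` Domain f \<subseteq> T"
    using s by (simp_all add: comm_state_def)
  then have "Domain (insert (x, y) f) \<subseteq> T \<union> {x, inverse_fun g x}"
    "inverse_fun g ` Domain (insert (x, y) f) \<subseteq> T \<union> {x, inverse_fun g x}" by auto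
  then show ?thesis using assms unfolding comm_state_def fst_conv snd_conv by simp
qed

text \<open>An edge of the graph arises from values \<open>b\<close> and \<open>g b\<close> of
  \<open>f\<close>. Neither the image nor the preimage of the new value \<open>y\<close> under
  \<open>g\<close> is a value, so the graph does not change.\<close>

lemma comm_add_domain:
  assumes g: "aut g" "g \<noteq> id" and s: "comm_state g (f, T)" and x: "x \<notin> Domain f"
  obtains y where "comm_state g (insert (x, y) f, T \<union> {x, inverse_fun g x})"
    "comm_graph g (insert (x, y) f) = comm_graph g f" "g y \<noteq> y" "g y \<notin> Range f"
proof -
  have f: "finite f" "partial_iso f" using s by (auto simp: comm_state_def)
  define W where "W = g ` Range f \<union> inverse_fun g ` Range f"
  have "finite W" using f by (simp add: W_def finite_Range)
  then obtain y where y: "partial_iso (insert (x, y) f)" "y \<notin> Range f" "y \<notin> W" "g y \<noteq> y"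
    using extend_domain[OF moved_dense[OF g] f(2,1) _ x] by blast
  have gy: "g y \<notin> Range f"
    using y(3) g(1) by (auto simp: W_def intro: image_eqI[of _ _ "g y"])
  have "g b \<noteq> y" if "b \<in> Range f" for b
    using y(3) that by (auto simp: W_def)
  then have graph: "comm_graph g (insert (x, y) f) = comm_graph g f"
    using gy y(4) by (auto simp: comm_graph_def)
  have "comm_state g (insert (x, y) f, T \<union> {x, inverse_fun g x})"
    using comm_state_insert[OF s y(1)] s graph by (simp add: comm_state_def)
  then show ?thesis using that graph y(4) gy by blast
qed

text \<open>Here the value \<open>y\<close> is given and new edges can occur, but only out of
  \<open>z\<close> or into \<open>inverse_fun g z\<close>. As \<open>z\<close> is a new point moved
  by \<open>g\<close>, the former is a source and the latter a sink, so neither a cycle nor a new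
  path between recorded points arises.\<close>

lemma comm_add_range:
  assumes g: "aut g" "g \<noteq> id" and s: "comm_state g (f, T)" and y: "y \<notin> Range f" and W: "finite W"
  obtains z where "comm_state g (insert (z, y) f, T \<union> {z, inverse_fun g z})"
    "comm_ext g (f, T) (insert (z, y) f, T \<union> {z, inverse_fun g z})"
    "\<And>w. w \<in> W - Domain f \<Longrightarrow> is_R (c z w)"
proof -
  have f: "finite f" "partial_iso f" "finite T" "Domain f \<subseteq> T" "inverse_fun g ` Domain f \<subseteq> T"
    using s by (auto simp: comm_state_def)
  have fin: "finite (T \<union> g ` T \<union> W)" using f W by simp
  obtain z where z: "partial_iso (insert (z, y) f)" "z \<notin> Domain f" "z \<notin> T \<union> g ` T \<union> W"
    "\<And>w. w \<in> T \<union> g ` T \<union> W - Domain f \<Longrightarrow> is_R (c z w)" "g z \<noteq> z"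
    by (rule extend_range[OF moved_dense[OF g] f(2,1) fin y]) blast
  define f' where "f' = insert (z, y) f"
  let ?q = "inverse_fun g z"
  have qz: "?q \<noteq> z" using z(5) g by (metis aut_f_inv)
  have qT: "?q \<notin> T"
  proof
    assume "?q \<in> T"
    then have "z \<in> g ` T" using g by (metis aut_f_inv imageI)
    then show False using z(3) by blast
  qed
  have src: "z \<notin> Range (comm_graph g f')"
  proof
    assume "z \<in> Range (comm_graph g f')"
    then have "g z \<in> Domain f'" by (auto simp: comm_graph_def)
    then have "g z \<in> Domain f" using z(5) by (auto simp: f'_def)
    then have "z \<in> T" using f(5) g by (metis aut_inv_f imageI subsetD)
    then show False using z(3) by blast
  qed
  have snk: "?q \<notin> Domain (comm_graph g f')"
  proof
    assume "?q \<in> Domain (comm_graph g f')"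
    then have "?q \<in> Domain f'" by (auto simp: comm_graph_def)
    then show False using qz qT f(4) by (auto simp: f'_def)
  qed
  have new: "(a, b) \<in> comm_graph g f \<or> a = z \<or> b = ?q" if "(a, b) \<in> comm_graph g f'" for a b
    using that g(1) by (auto simp: comm_graph_def f'_def)
  have paths: "(a, b) \<in> (comm_graph g f)\<^sup>+ \<or> a = z \<or> b = ?q" if "(a, b) \<in> (comm_graph g f')\<^sup>+" for a b
    by (rule trancl_new_source_sink[OF _ src snk that]) (rule new)
  have "acyclic (comm_graph g f')"
    unfolding acyclic_def
  proof (intro allI notI)
    fix a assume a: "(a, a) \<in> (comm_graph g f')\<^sup>+"
    have "a \<noteq> z" using src a by (metis Range.intros trancl_range)
    moreover have "a \<noteq> ?q" using snk a by (metis Domain.intros trancl_domain)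
    ultimately show False using paths[OF a] s by (auto simp: comm_state_def acyclic_def)
  qed
  then have "comm_state g (f', T \<union> {z, ?q})"
    using comm_state_insert[OF s z(1)] by (simp add: f'_def)
  moreover have "comm_ext g (f, T) (f', T \<union> {z, ?q})"
    unfolding comm_ext_def
  proof (intro conjI ballI impI)
    fix a b assume "a \<in> snd (f, T)" "b \<in> snd (f, T)" "(a, b) \<in> (comm_graph g (fst (f', T \<union> {z, ?q})))\<^sup>+"
    then show "(a, b) \<in> (comm_graph g (fst (f, T)))\<^sup>+"
      using paths[of a b] qT z(3) by auto
  qed (auto simp: f'_def)
  ultimately show ?thesis using that[of z] z(4) by (auto simp: f'_def)
qed

text \<open>A new realization \<open>a\<close> gets a fresh value \<open>b\<close>, and then
  \<open>g b\<close> gets a preimage \<open>z\<close>; this produces the edge from \<open>a\<close>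
  to \<open>inverse_fun g z\<close>. Its label is that of \<open>(g a, z)\<close>, and
  \<open>z\<close> is chosen with an \<open>R\<close>-edge to \<open>g a\<close>.\<close>

lemma comm_add_type:
  assumes g: "aut g" "g \<noteq> id" and s: "comm_state g (f, T)"
    and U: "finite U" and t: "type_over c U t"
  obtains f' T' y y' where "comm_state g (f', T')" "comm_ext g (f, T) (f', T')"
    "\<And>u. u \<in> U \<Longrightarrow> c y u = t u" "(y, y') \<in> comm_graph g f'" "is_R (c y y')" "U \<subseteq> T'" "y \<in> T'"
    "\<And>u. u \<in> U \<Longrightarrow> (y, u) \<notin> (comm_graph g f')\<^sup>+" "\<And>u. u \<in> U \<Longrightarrow> (u, y) \<notin> (comm_graph g f')\<^sup>+"
proof -
  have f: "finite f" "partial_iso f" "finite T" "Domain f \<subseteq> T" "inverse_fun g ` Domain f \<subseteq> T"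
    using s by (auto simp: comm_state_def)
  define T1 where "T1 = T \<union> U"
  have s1: "comm_state g (f, T1)"
    using s U by (auto simp: comm_state_def T1_def)
  have "finite T1" using f U by (simp add: T1_def)
  then obtain a where a: "\<And>u. u \<in> U \<Longrightarrow> c a u = t u" "a \<notin> T1" "g a \<noteq> a"
    using realization_R[OF moved_dense[OF g] U _ t] by blast
  have aD: "a \<notin> Domain f" using a(2) f(4) by (auto simp: T1_def)
  have gaD: "g a \<notin> Domain f"
  proof
    assume "g a \<in> Domain f"
    then have "a \<in> T" using f(5) g by (metis aut_inv_f imageI subsetD)
    then show False using a(2) by (simp add: T1_def)
  qed
  obtain b where b: "comm_state g (insert (a, b) f, T1 \<union> {a, inverse_fun g a})"
    "comm_graph g (insert (a, b) f) = comm_graph g f" "g b \<noteq> b" "g b \<notin> Range f"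
    by (rule comm_add_domain[OF g s1 aD]) blast
  define f1 T2 where "f1 = insert (a, b) f" and "T2 = T1 \<union> {a, inverse_fun g a}"
  have "g b \<notin> Range f1" using b(3,4) by (auto simp: f1_def)
  then obtain z where z: "comm_state g (insert (z, g b) f1, T2 \<union> {z, inverse_fun g z})"
    "comm_ext g (f1, T2) (insert (z, g b) f1, T2 \<union> {z, inverse_fun g z})"
    "\<And>w. w \<in> {g a} - Domain f1 \<Longrightarrow> is_R (c z w)"
    using comm_add_range[OF g, of f1 T2 "g b" "{g a}"] b(1) by (auto simp: f1_def T2_def)
  define f2 T3 where "f2 = insert (z, g b) f1" and "T3 = T2 \<union> {z, inverse_fun g z}"
  have "is_R (c z (g a))"
    using z(3)[of "g a"] gaD a(3) by (auto simp: f1_def)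
  moreover have "c z (g a) = c (inverse_fun g z) a"
    using aut_iso[OF g(1), of "inverse_fun g z" a] g(1) by simp
  ultimately have R: "is_R (c a (inverse_fun g z))"
    using c_opp[of "inverse_fun g z" a] by simp
  have edge: "(a, inverse_fun g z) \<in> comm_graph g f2"
    using g(1) by (auto simp: comm_graph_def f2_def f1_def)
  \<comment> \<open>Adding \<open>b\<close> does not change the graph, and adding \<open>z\<close>
    creates no path inside \<open>T2\<close>, which contains \<open>U\<close> and \<open>a\<close>.
    Since \<open>a\<close> is no vertex of the original graph, no path joins it to
    \<open>U\<close>.\<close>
  have old: "(v, v') \<in> (comm_graph g f)\<^sup>+"
    if "v \<in> T2" "v' \<in> T2" "(v, v') \<in> (comm_graph g f2)\<^sup>+" for v v'
    using z(2) that b(2) by (auto simp: comm_ext_def f2_def f1_def)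
  have "T \<subseteq> T2" "U \<subseteq> T2" "a \<in> T2" by (auto simp: T2_def T1_def)
  have "f \<subseteq> f2" "T \<subseteq> T3" using \<open>T \<subseteq> T2\<close> by (auto simp: f2_def f1_def T3_def)
  then have ext: "comm_ext g (f, T) (f2, T3)"
    using old \<open>T \<subseteq> T2\<close> unfolding comm_ext_def fst_conv snd_conv by blast
  have notD: "(a, v) \<notin> (comm_graph g f)\<^sup>+" for v
  proof
    assume "(a, v) \<in> (comm_graph g f)\<^sup>+"
    then have "a \<in> Domain (comm_graph g f)" by (metis Domain.intros trancl_domain)
    then show False using aD by (auto simp: comm_graph_def)
  qed
  have notR: "(v, a) \<notin> (comm_graph g f)\<^sup>+" for v
  proof
    assume "(v, a) \<in> (comm_graph g f)\<^sup>+"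
    then have "a \<in> Range (comm_graph g f)" by (metis Range.intros trancl_range)
    then show False using gaD by (auto simp: comm_graph_def)
  qed
  show ?thesis
  proof (rule that[OF _ ext a(1) edge R])
    show "comm_state g (f2, T3)" using z(1) by (simp add: f2_def T3_def)
    show "U \<subseteq> T3" "a \<in> T3" using \<open>U \<subseteq> T2\<close> \<open>a \<in> T2\<close> by (auto simp: T3_def)
    show "(a, u) \<notin> (comm_graph g f2)\<^sup>+" "(u, a) \<notin> (comm_graph g f2)\<^sup>+" if "u \<in> U" for u
      using old[of a u] old[of u a] notD[of u] notR[of u] that \<open>U \<subseteq> T2\<close> \<open>a \<in> T2\<close> by auto
  qed
qed

text \<open>Both \<open>(g ^^ m) y \<noteq> u\<close> and \<open>(g ^^ m) u \<noteq> y\<close> are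
  demanded in order to cover negative powers; \<open>m = 0\<close> keeps \<open>y\<close> out of
  \<open>U\<close>. The set \<open>U\<close> is chosen independently of the support of the type to
  be realized.\<close>

definition free_aut :: "('a \<Rightarrow> 'a) \<Rightarrow> bool" where
  "free_aut g \<longleftrightarrow> aut g \<and> (\<forall>m>0. \<forall>x. (g ^^ m) x \<noteq> x) \<and>
     (\<forall>U. finite U \<longrightarrow>
        dense_pred (\<lambda>y. is_R (c y (g y)) \<and> (\<forall>u\<in>U. \<forall>m. (g ^^ m) y \<noteq> u \<and> (g ^^ m) u \<noteq> y)))"

text \<open>The list encodes a type. Recording \<open>y\<close> and \<open>U\<close> in the second
  component makes the absence of paths permanent, because \<open>comm_ext\<close> admits no new path
  between recorded points.\<close>

definition comm_req :: "('a \<Rightarrow> 'a) \<Rightarrow> ('a \<times> sym) list \<Rightarrow> ('a \<times> 'a) set \<times> 'a set \<Rightarrow> bool" where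
  "comm_req g l s \<longleftrightarrow> (let U = fst ` set l; E = comm_graph g (fst s) in
     type_over c U (map_of l) \<longrightarrow>
     (\<exists>y y'. (\<forall>u\<in>U. c y u = map_of l u) \<and> (y, y') \<in> E \<and> is_R (c y y') \<and>
        U \<subseteq> snd s \<and> y \<in> snd s \<and> (\<forall>u\<in>U. (y, u) \<notin> E\<^sup>+ \<and> (u, y) \<notin> E\<^sup>+)))"

lemma comm_reqE:
  assumes "comm_req g l s" "fst ` set l = U" "type_over c U (map_of l)"
  obtains y y' where "\<And>u. u \<in> U \<Longrightarrow> c y u = map_of l u" "(y, y') \<in> comm_graph g (fst s)"
    "is_R (c y y')" "U \<subseteq> snd s" "y \<in> snd s"
    "\<And>u. u \<in> U \<Longrightarrow> (y, u) \<notin> (comm_graph g (fst s))\<^sup>+ \<and> (u, y) \<notin> (comm_graph g (fst s))\<^sup>+"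
  using assms unfolding comm_req_def Let_def by blast

lemma comm_add_req:
  assumes g: "aut g" "g \<noteq> id" and s: "comm_state g s"
  obtains s' where "comm_state g s'" "comm_ext g s s'" "comm_req g l s'"
proof (cases "type_over c (fst ` set l) (map_of l)")
  case True
  have s': "comm_state g (fst s, snd s)" and fin: "finite (fst ` set l)" using s by simp_all
  obtain f' T' y y' where *: "comm_state g (f', T')" "comm_ext g (fst s, snd s) (f', T')"
    "\<And>u. u \<in> fst ` set l \<Longrightarrow> c y u = map_of l u" "(y, y') \<in> comm_graph g f'" "is_R (c y y')"
    "fst ` set l \<subseteq> T'" "y \<in> T'" "\<And>u. u \<in> fst ` set l \<Longrightarrow> (y, u) \<notin> (comm_graph g f')\<^sup>+"
    "\<And>u. u \<in> fst ` set l \<Longrightarrow> (u, y) \<notin> (comm_graph g f')\<^sup>+"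
    by (rule comm_add_type[OF g s' fin True]) blast
  have "comm_req g l (f', T')"
    unfolding comm_req_def Let_def fst_conv snd_conv using *(3-9) by blast
  then show ?thesis using that *(1,2) by simp
next
  case False
  then have "comm_req g l s" by (simp add: comm_req_def Let_def)
  then show ?thesis using that s comm_ext_refl by blast
qed

lemma free_commutator:
  assumes g: "aut g" "g \<noteq> id"
  obtains f where "aut f" "free_aut (inverse_fun g \<circ> inverse_fun f \<circ> g \<circ> f)"
proof -
  let ?req = "\<lambda>(x, l) s. x \<in> Domain (fst s) \<and> x \<in> Range (fst s) \<and> comm_req g l s"
  have step: "\<exists>s'. comm_state g s' \<and> comm_ext g s s' \<and> ?req r s'" if s: "comm_state g s" for s r
  proof -
    obtain x l where r: "r = (x, l)" by force
    have "\<exists>s'. comm_state g s' \<and> comm_ext g s s' \<and> x \<in> Domain (fst s')"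
    proof (cases "x \<in> Domain (fst s)")
      case False
      obtain y where "comm_state g (insert (x, y) (fst s), snd s \<union> {x, inverse_fun g x})"
        "comm_graph g (insert (x, y) (fst s)) = comm_graph g (fst s)"
        by (rule comm_add_domain[OF g _ False, of "snd s"]) (use s in simp, blast)
      then show ?thesis
        by (intro exI[of _ "(insert (x, y) (fst s), snd s \<union> {x, inverse_fun g x})"])
          (auto simp: comm_ext_def)
    qed (use s comm_ext_refl in blast)
    then obtain s1 where s1: "comm_state g s1" "comm_ext g s s1" "x \<in> Domain (fst s1)" by blast
    have "\<exists>s'. comm_state g s' \<and> comm_ext g s1 s' \<and> x \<in> Range (fst s')"
    proof (cases "x \<in> Range (fst s1)")
      case False
      obtain y where "comm_state g (insert (y, x) (fst s1), snd s1 \<union> {y, inverse_fun g y})"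
        "comm_ext g (fst s1, snd s1) (insert (y, x) (fst s1), snd s1 \<union> {y, inverse_fun g y})"
        by (rule comm_add_range[OF g _ False finite.emptyI, of "snd s1"]) (use s1(1) in simp, blast)
      then show ?thesis
        by (intro exI[of _ "(insert (y, x) (fst s1), snd s1 \<union> {y, inverse_fun g y})"]) auto
    qed (use s1 comm_ext_refl in blast)
    then obtain s2 where s2: "comm_state g s2" "comm_ext g s1 s2" "x \<in> Range (fst s2)" by blast
    obtain s3 where s3: "comm_state g s3" "comm_ext g s2 s3" "comm_req g l s3"
      by (rule comm_add_req[OF g s2(1)])
    have "comm_ext g s s3" by (rule comm_ext_trans[OF comm_ext_trans[OF s1(2) s2(2)] s3(2)])
    moreover have "fst s1 \<subseteq> fst s2" "fst s2 \<subseteq> fst s3"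
      using s2(2) s3(2) by (simp_all add: comm_ext_def)
    then have "x \<in> Domain (fst s3)" "x \<in> Range (fst s3)" using s1(3) s2(3) by blast+
    ultimately show ?thesis using s3 r by (intro exI[of _ s3]) simp
  qed
  have "\<exists>st. st 0 = ({}, {}) \<and> (\<forall>n. comm_state g (st n)) \<and>
    (\<forall>m n. m \<le> n \<longrightarrow> comm_ext g (st m) (st n)) \<and> (\<forall>r. \<exists>n::nat. ?req r (st n))"
  proof (rule back_and_forth_chain[OF _ step comm_ext_refl comm_ext_trans])
    show "comm_state g ({}, {})" by (simp add: comm_state_def comm_graph_def acyclic_def)
  qed
  then obtain st :: "nat \<Rightarrow> ('a \<times> 'a) set \<times> 'a set" where st: "\<And>n. comm_state g (st n)"
    "\<And>m n. m \<le> n \<Longrightarrow> comm_ext g (st m) (st n)" "\<And>r. \<exists>n. ?req r (st n)" by blast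
  define F where "F n = fst (st n)" for n
  have F_mono: "F m \<subseteq> F n" if "m \<le> n" for m n
    using st(2)[OF that] by (simp add: comm_ext_def F_def)
  have "partial_iso (\<Union>n. F n)"
    by (rule partial_iso_Union) (use st(1) F_mono in \<open>auto simp: comm_state_def F_def\<close>)
  moreover have "x \<in> Domain (\<Union>n. F n) \<and> x \<in> Range (\<Union>n. F n)" for x
  proof -
    obtain n where "x \<in> Domain (F n)" "x \<in> Range (F n)" using st(3)[of "(x, [])"] by (auto simp: F_def)
    then show ?thesis by blast
  qed
  then have "Domain (\<Union>n. F n) = UNIV" "Range (\<Union>n. F n) = UNIV" by blast+
  ultimately obtain f where f: "aut f" "\<And>x y. (x, y) \<in> (\<Union>n. F n) \<longleftrightarrow> f x = y"
    by (rule total_partial_iso) blast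
  define w where "w = inverse_fun g \<circ> inverse_fun f \<circ> g \<circ> f"
  define E where "E n = comm_graph g (F n)" for n
  have w: "aut w" unfolding w_def by (intro aut_comp aut_inv f g)
  have E_mono: "E m \<subseteq> E n" if "m \<le> n" for m n
    unfolding E_def by (rule comm_graph_mono[OF F_mono[OF that]])
  have w_edge: "\<exists>n. (x, w x) \<in> E n" for x
  proof -
    have "f (g (w x)) = g (f x)" using f(1) g(1) by (simp add: w_def)
    then obtain m n where "(x, f x) \<in> F m" "(g (w x), g (f x)) \<in> F n" using f(2) by blast
    then have "(x, f x) \<in> F (max m n)" "(g (w x), g (f x)) \<in> F (max m n)"
      using F_mono[of m "max m n"] F_mono[of n "max m n"] by auto
    then show ?thesis by (auto simp: E_def comm_graph_def)
  qed
  have edge_w: "y = w x" if e: "(x, y) \<in> E n" for x y n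
  proof -
    obtain z where "(x, z) \<in> F n" "(g y, g z) \<in> F n"
      using e by (auto simp: E_def comm_graph_def)
    then have "f x = z" "f (g y) = g z" using f(2) by blast+
    then have "f (g y) = f (g (w x))" using f(1) g(1) by (simp add: w_def)
    then show ?thesis using f(1) g(1) by simp
  qed
  have w_path: "\<exists>n. (x, (w ^^ Suc m) x) \<in> (E n)\<^sup>+" for x m
  proof (induction m)
    case 0
    then show ?case using w_edge[of x] by auto
  next
    case (Suc m)
    then obtain n n' where n: "(x, (w ^^ Suc m) x) \<in> (E n)\<^sup>+"
      "((w ^^ Suc m) x, w ((w ^^ Suc m) x)) \<in> E n'" using w_edge by blast
    have "(x, (w ^^ Suc m) x) \<in> (E (max n n'))\<^sup>+" "((w ^^ Suc m) x, w ((w ^^ Suc m) x)) \<in> E (max n n')"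
      using n trancl_mono[OF n(1) E_mono[of n "max n n'"]] E_mono[of n' "max n n'"] by auto
    then show ?case by (metis funpow.simps(2) comp_apply trancl.trancl_into_trancl)
  qed
  have free: "(w ^^ m) x \<noteq> x" if m: "m > 0" for m x
  proof
    assume "(w ^^ m) x = x"
    then obtain n where "(x, x) \<in> (E n)\<^sup>+"
      using w_path[of x "m - 1"] m by auto
    then show False using st(1)[of n] by (auto simp: comm_state_def E_def F_def acyclic_def)
  qed
  have dense: "dense_pred (\<lambda>y. is_R (c y (w y)) \<and> (\<forall>u\<in>U. \<forall>m. (w ^^ m) y \<noteq> u \<and> (w ^^ m) u \<noteq> y))"
    if U: "finite U" for U
    unfolding dense_pred_def
  proof (intro allI impI)
    fix V t assume V: "finite V" and t: "type_over c V t"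
    \<comment> \<open>The set to be avoided joins the support of the type, so that a single
      requirement yields the labels over \<open>V\<close> together with the separation from
      \<open>U\<close>.\<close>
    obtain t' where t': "type_over c (V \<union> U) t'" "\<And>u. u \<in> V \<Longrightarrow> t' u = t u"
      by (rule type_extension[OF c_structure subset_UNIV subset_UNIV t]) blast
    have "finite (V \<union> U)" using U V by simp
    then obtain l where Ul: "fst ` set l = V \<union> U" and l: "\<And>u. u \<in> V \<union> U \<Longrightarrow> map_of l u = t' u"
      by (rule function_as_list[of _ t']) (use type_overD(1)[OF t'(1)] in blast)+
    have type: "type_over c (V \<union> U) (map_of l)"
      using t'(1) l type_over_cong[of "V \<union> U" "map_of l" t'] by simp
    obtain n where n0: "comm_req g l (st n)" using st(3)[of "(undefined, l)"] by auto
    obtain y y' where n: "\<And>u. u \<in> V \<union> U \<Longrightarrow> c y u = map_of l u" "(y, y') \<in> E n" "is_R (c y y')"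
      "V \<union> U \<subseteq> snd (st n)" "y \<in> snd (st n)"
      "\<And>u. u \<in> V \<union> U \<Longrightarrow> (y, u) \<notin> (E n)\<^sup>+ \<and> (u, y) \<notin> (E n)\<^sup>+"
      unfolding E_def F_def by (rule comm_reqE[OF n0 Ul type]) blast
    have ynU: "y \<notin> V \<union> U" using n(1) l type_overD(1)[OF t'(1)] by (metis c_self)
    \<comment> \<open>A positive power of \<open>w\<close> is a path of the graph at some stage;
      between points recorded at stage \<open>n\<close> such a path is present already at stage
      \<open>n\<close>.\<close>
    have apart: "(w ^^ m) a \<noteq> b" if ab: "a \<in> snd (st n)" "b \<in> snd (st n)" "(a, b) \<notin> (E n)\<^sup>+" "a \<noteq> b" for a b m
    proof
      assume eq: "(w ^^ m) a = b"
      then have "m > 0" using ab(4) by (cases m) auto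
      then obtain k where k: "(a, b) \<in> (E k)\<^sup>+" using w_path[of a "m - 1"] eq by auto
      have "(a, b) \<in> (E (max k n))\<^sup>+" using trancl_mono[OF k E_mono[of k "max k n"]] by simp
      then have "(a, b) \<in> (E n)\<^sup>+"
        using st(2)[of n "max k n"] ab(1,2) by (auto simp: comm_ext_def E_def F_def)
      then show False using ab(3) by blast
    qed
    have "c y u = t u" if "u \<in> V" for u using n(1)[of u] l[of u] t'(2) that by simp
    moreover have "is_R (c y (w y))" using n(3) edge_w[OF n(2)] by simp
    moreover have "(w ^^ m) y \<noteq> u \<and> (w ^^ m) u \<noteq> y" if "u \<in> U" for u m
    proof -
      have u: "u \<in> snd (st n)" "u \<noteq> y" "(y, u) \<notin> (E n)\<^sup>+" "(u, y) \<notin> (E n)\<^sup>+"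
        using n(4) n(6)[of u] ynU that by auto
      show ?thesis
        using apart[OF n(5) u(1,3) u(2)[symmetric]] apart[OF u(1) n(5) u(4,2)] by simp
    qed
    ultimately show "\<exists>y. (\<forall>u\<in>V. c y u = t u) \<and> is_R (c y (w y)) \<and>
      (\<forall>u\<in>U. \<forall>m. (w ^^ m) y \<noteq> u \<and> (w ^^ m) u \<noteq> y)" by blast
  qed
  show ?thesis
    by (rule that[OF f(1)]) (use w free dense in \<open>auto simp: free_aut_def w_def\<close>)
qed

end

section \<open>Products of conjugates\<close>

context generic_structure
begin

section \<open>Extending a partial conjugator by one link\<close>

lemma free_autD:
  assumes "free_aut g"
  shows "aut g" "m > 0 \<Longrightarrow> (g ^^ m) x \<noteq> x" "g x \<noteq> x"
  using assms by (auto simp: free_aut_def dest: spec[of _ 1])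

lemma free_aut_realization:
  assumes "free_aut g" "finite E" "finite U" "type_over c U t"
  obtains y where "\<And>u. u \<in> U \<Longrightarrow> c y u = t u" "is_R (c y (g y))"
    "\<And>e m. e \<in> E \<Longrightarrow> (g ^^ m) y \<noteq> e \<and> (g ^^ m) e \<noteq> y"
proof -
  have "dense_pred (\<lambda>y. is_R (c y (g y)) \<and> (\<forall>e\<in>E. \<forall>m. (g ^^ m) y \<noteq> e \<and> (g ^^ m) e \<noteq> y))"
    using assms(1,2) by (simp add: free_aut_def)
  from dense_predD[OF this assms(3,4)] show ?thesis using that by blast
qed

lemma funpow_inverse: "aut g \<Longrightarrow> (inverse_fun g ^^ m) x = y \<longleftrightarrow> (g ^^ m) y = x"
proof (induction m arbitrary: x y)
  case (Suc m)
  have "(inverse_fun g ^^ Suc m) x = y \<longleftrightarrow> (inverse_fun g ^^ m) x = g y"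
    using Suc.prems by (metis aut_f_inv aut_inv_f comp_apply funpow.simps(2))
  also have "\<dots> \<longleftrightarrow> (g ^^ m) (g y) = x" using Suc by blast
  finally show ?case by (simp add: funpow_swap1)
qed auto

lemma type_over_image:
  assumes g: "aut g" and t: "type_over c (inverse_fun g ` U) t"
  shows "type_over c U (\<lambda>x. t (inverse_fun g x))"
proof -
  have "inverse_fun (inverse_fun g) ` inverse_fun g ` U = U"
    using g by (simp add: image_image)
  then show ?thesis using type_over_vimage[OF aut_inv[OF g] t] by simp
qed

text \<open>If \<open>y\<close> is suitable for \<open>g\<close> over the sets moved back by
  \<open>g\<close>, then \<open>g y\<close> is suitable for the inverse. This permits building a
  chain backwards from its end.\<close>

lemma free_aut_inverse:
  assumes g: "free_aut g"
  shows "free_aut (inverse_fun g)"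
  unfolding free_aut_def
proof (intro conjI allI impI)
  note g' = free_autD(1)[OF g]
  show "aut (inverse_fun g)" using g' by simp
  show "(inverse_fun g ^^ m) x \<noteq> x" if "m > 0" for m x
    using free_autD(2)[OF g that] funpow_inverse[OF g'] by simp
  fix U :: "'a set" assume U: "finite U"
  show "dense_pred (\<lambda>y. is_R (c y (inverse_fun g y)) \<and>
    (\<forall>u\<in>U. \<forall>m. (inverse_fun g ^^ m) y \<noteq> u \<and> (inverse_fun g ^^ m) u \<noteq> y))"
    unfolding dense_pred_def
  proof (intro allI impI)
    fix V t assume V: "finite V" and t: "type_over c V t"
    have fin: "finite (inverse_fun g ` U)" "finite (inverse_fun g ` V)" using U V by simp_all
    obtain y where y: "\<And>u. u \<in> inverse_fun g ` V \<Longrightarrow> c y u = t (g u)" "is_R (c y (g y))"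
      "\<And>u m. u \<in> inverse_fun g ` U \<Longrightarrow> (g ^^ m) y \<noteq> u \<and> (g ^^ m) u \<noteq> y"
      by (rule free_aut_realization[OF g fin type_over_vimage[OF g' t]]) blast
    have "c (g y) u = t u" if "u \<in> V" for u
    proof -
      have "c (g y) (g (inverse_fun g u)) = t (g (inverse_fun g u))"
        using y(1)[of "inverse_fun g u"] that aut_iso[OF g'] by simp
      then show ?thesis using g' by simp
    qed
    moreover have "is_R (c (g y) (inverse_fun g (g y)))"
      using y(2) c_opp[of y "g y"] g' by simp
    moreover have "(inverse_fun g ^^ m) (g y) \<noteq> u \<and> (inverse_fun g ^^ m) u \<noteq> g y" if "u \<in> U" for u m
    proof -
      have "(g ^^ m) (inverse_fun g u) \<noteq> y" "(g ^^ m) y \<noteq> inverse_fun g u" using y(3)[of "inverse_fun g u" m] that by auto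
      moreover have "g ((g ^^ m) (inverse_fun g u)) = (g ^^ m) u"
        using g' by (simp add: funpow_swap1)
      moreover have "g ((g ^^ m) y) = (g ^^ m) (g y)" by (simp add: funpow_swap1)
      ultimately have "(g ^^ m) u \<noteq> g y" "(g ^^ m) (g y) \<noteq> u"
        using g' by (metis aut_inj, metis aut_inv_f)
      then show ?thesis using funpow_inverse[OF g'] by simp
    qed
    ultimately show "\<exists>x. (\<forall>u\<in>V. c x u = t u) \<and> is_R (c x (inverse_fun g x)) \<and>
        (\<forall>u\<in>U. \<forall>m. (inverse_fun g ^^ m) x \<noteq> u \<and> (inverse_fun g ^^ m) u \<noteq> x)" by blast
  qed
qed

text \<open>A pair with one point in each difference set carries two \<open>R\<close>-labels and is
  unconstrained. This glues two prescriptions for the same point.\<close>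

lemma type_over_Un_R:
  assumes "type_over c A t" "type_over c B t"
    "\<And>a. a \<in> A - B \<Longrightarrow> is_R (t a)" "\<And>b. b \<in> B - A \<Longrightarrow> is_R (t b)"
  shows "type_over c (A \<union> B) t"
  unfolding type_over_def
proof (intro ballI conjI)
  fix u v assume uv: "u \<in> A \<union> B" "v \<in> A \<union> B"
  show "t u \<noteq> None" using assms(1,2) uv by (auto simp: type_over_def)
  consider "u \<in> A" "v \<in> A" | "u \<in> B" "v \<in> B" | "u \<in> A - B" "v \<in> B - A" | "u \<in> B - A" "v \<in> A - B"
    using uv by blast
  then show "tri (t u) (t v) (c u v)"
    using assms(3,4) type_overD(2)[OF assms(1)] type_overD(2)[OF assms(2)] tri_two_R(1)
    by cases auto
qed

text \<open>
  \<open>x\<close> and a new point \<open>z\<close> are sent to \<open>y\<close> and \<open>g y\<close>, where \<open>z\<close> realizes the prescribed type \<open>s\<close>.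
  The label of \<open>(z, x)\<close> cannot be prescribed, but it is an \<open>R\<close>, hence compatible with the points
  outside \<open>Domain k\<close>.
\<close>
lemma extend_by_pair:
  assumes g: "free_aut g" and k: "partial_iso k" "finite k" and x: "x \<notin> Q"
    and Q: "finite Q" "Domain k \<subseteq> Q" and s: "type_over c Q s"
    and sR: "\<And>d. d \<in> Q - Domain k \<Longrightarrow> is_R (s d)"
    and \<tau>: "type_over c (Range k \<union> inverse_fun g ` Range k) \<tau>"
    and \<tau>x: "\<And>d e. (d, e) \<in> k \<Longrightarrow> \<tau> e = c x d"
    and \<tau>s: "\<And>d e. (d, e) \<in> k \<Longrightarrow> \<tau> (inverse_fun g e) = s d"
  obtains y z where "partial_iso (insert (x, y) (insert (z, g y) k))" "\<And>d. d \<in> Q \<Longrightarrow> c z d = s d"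
    "is_R (c z x)" "\<And>e m. e \<in> Range k \<Longrightarrow> (g ^^ m) y \<noteq> e \<and> (g ^^ m) e \<noteq> y"
proof -
  note g' = free_autD(1)[OF g]
  have fin: "finite (Range k)" "finite (Range k \<union> inverse_fun g ` Range k)"
    using k(2) by (simp_all add: finite_Range)
  obtain y where y: "\<And>u. u \<in> Range k \<union> inverse_fun g ` Range k \<Longrightarrow> c y u = \<tau> u"
    "is_R (c y (g y))" "\<And>e m. e \<in> Range k \<Longrightarrow> (g ^^ m) y \<noteq> e \<and> (g ^^ m) e \<noteq> y"
    by (rule free_aut_realization[OF g fin \<tau>]) blast
  have yx: "c y e = c x d" if "(d, e) \<in> k" for d e
    using y(1) \<tau>x[OF that] that by (metis Range.intros UnI1)
  have gys: "c (g y) e = s d" if "(d, e) \<in> k" for d e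
  proof -
    have "c y (inverse_fun g e) = s d"
      using y(1) \<tau>s[OF that] that by (metis Range.intros UnI2 imageI)
    then show ?thesis using aut_iso[OF g', of y "inverse_fun g e"] g' by simp
  qed
  define r where "r = c (g y) y"
  have r: "is_R r" using y(2) c_opp[of y "g y"] by (simp add: r_def)
  define s' where "s' = s(x := r)"
  \<comment> \<open>Over \<open>Domain k\<close> this triangle is a copy of the one on
    \<open>g y\<close>, \<open>y\<close> and \<open>e\<close>; elsewhere \<open>r\<close> and
    \<open>s v\<close> are both \<open>R\<close>.\<close>
  have tr: "tri r (s v) (c x v)" if "v \<in> Q" for v
  proof (cases "v \<in> Domain k")
    case True
    then obtain e where e: "(v, e) \<in> k" by blast
    have "tri (c (g y) y) (c (g y) e) (c y e)" by (rule c_tri)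
    then show ?thesis using gys[OF e] yx[OF e] by (simp add: r_def)
  next
    case False
    then show ?thesis using sR[of v] r that tri_two_R(1) by blast
  qed
  have "type_over c (insert x Q) s'"
    unfolding type_over_def
  proof (intro ballI conjI)
    fix u v assume uv: "u \<in> insert x Q" "v \<in> insert x Q"
    have "r \<noteq> None" using r by (metis is_R_simps(5))
    then show "s' u \<noteq> None" using uv type_overD(1)[OF s] by (auto simp: s'_def)
    consider "u = x" "v = x" | "u = x" "v \<in> Q" | "u \<in> Q" "v = x" | "u \<in> Q" "v \<in> Q" using uv by blast
    then show "tri (s' u) (s' v) (c u v)"
    proof cases
      case 1 then show ?thesis using r tri_two_R(1) by (simp add: s'_def)
    next
      case 2 then show ?thesis using tr[of v] x by (auto simp: s'_def)
    next
      case 3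
      then have "u \<noteq> x" using x by blast
      then show ?thesis using 3 tri_swap[OF tr[of u]] c_opp[of x u] by (simp add: s'_def)
    next
      case 4
      then have "u \<noteq> x" "v \<noteq> x" using x by blast+
      then show ?thesis using 4 type_overD(2)[OF s] by (simp add: s'_def)
    qed
  qed
  then obtain z where z: "\<forall>u\<in>insert x Q. c z u = s' u"
    using realization[of "insert x Q" s'] Q(1) by blast
  have zs: "c z d = s d" if "d \<in> Q" for d
  proof -
    have "d \<noteq> x" using that x by blast
    then show ?thesis using z that by (simp add: s'_def)
  qed
  have zx: "c z x = c (g y) y" using z by (simp add: s'_def r_def)
  have "partial_iso (insert (z, g y) k)"
    by (rule partial_iso_insert[OF k(1)]) (use zs gys Q(2) in \<open>metis Domain.intros subsetD\<close>)
  moreover have "c x a = c y b" if "(a, b) \<in> insert (z, g y) k" for a b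
  proof (cases "(a, b) \<in> k")
    case False
    then have "a = z" "b = g y" using that by auto
    then show ?thesis using zx by (metis c_opp)
  qed (use yx in simp)
  ultimately have "partial_iso (insert (x, y) (insert (z, g y) k))"
    by (rule partial_iso_insert)
  then show ?thesis using that zs zx r y(3) by (simp add: r_def)
qed

text \<open>For \<open>(d, e)\<close> in \<open>k\<close> the label of \<open>(z, d)\<close> must be
  that of \<open>(g y, e)\<close>, hence that of \<open>(y, inverse_fun g e)\<close>. The type of
  \<open>y\<close> is extended from \<open>Range k\<close> to its preimage under \<open>g\<close> by
  \<open>R\<close>-labels, so a \<open>G\<close>-edge from \<open>z\<close> to \<open>d\<close>
  requires that the \<open>g\<close>-predecessor of \<open>e\<close> is a value already.\<close>

lemma extend_forward:
  assumes g: "free_aut g" and k: "partial_iso k" "finite k" and x: "x \<notin> Domain k" and T: "finite T"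
  obtains y z where "partial_iso (insert (x, y) (insert (z, g y) k))"
    "z \<notin> T" "\<And>d. d \<in> T - Domain k \<Longrightarrow> is_R (c z d)" "is_R (c z x)"
    "\<And>d e. (d, e) \<in> k \<Longrightarrow> \<not> is_R (c z d) \<Longrightarrow> inverse_fun g e \<in> Range k"
    "\<And>e m. e \<in> Range k \<Longrightarrow> (g ^^ m) y \<noteq> e \<and> (g ^^ m) e \<noteq> y"
proof -
  note g' = free_autD(1)[OF g]
  obtain t where t: "\<And>a b. (a, b) \<in> k \<Longrightarrow> t b = c x a"
    using transport_function[OF k(1)] by blast
  have type: "type_over c (Range k) t"
    by (rule transport_type[OF k(1) type_over_point[OF x]]) (use t in auto)
  obtain \<tau> where \<tau>: "type_over c (Range k \<union> inverse_fun g ` Range k) \<tau>"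
    "\<And>e. e \<in> Range k \<Longrightarrow> \<tau> e = t e" "\<And>e. e \<in> inverse_fun g ` Range k - Range k \<Longrightarrow> is_R (\<tau> e)"
    by (rule type_extension[OF c_structure subset_UNIV subset_UNIV type]) blast
  have k': "partial_iso (k\<inverse>)" using k(1) by simp
  obtain s0 where s0: "\<And>b a. (b, a) \<in> k\<inverse> \<Longrightarrow> s0 a = \<tau> (inverse_fun g b)"
    by (rule transport_function[OF k', of "\<lambda>b. \<tau> (inverse_fun g b)"]) blast
  have "type_over c (Range k) (\<lambda>e. \<tau> (inverse_fun g e))"
    by (rule type_over_image[OF g' type_over_mono[OF \<tau>(1)]]) blast
  then have type0: "type_over c (Domain k) s0"
    by (rule transport_type[OF k']) (use s0 in auto)
  obtain s where s: "type_over c (Domain k \<union> (T - {x})) s" "\<And>d. d \<in> Domain k \<Longrightarrow> s d = s0 d"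
    "\<And>d. d \<in> T - {x} - Domain k \<Longrightarrow> is_R (s d)"
    by (rule type_extension[OF c_structure subset_UNIV subset_UNIV type0]) blast
  have fin: "finite (Domain k \<union> (T - {x}))" using k(2) T by (simp add: finite_Domain)
  obtain y z where yz: "partial_iso (insert (x, y) (insert (z, g y) k))"
    "\<And>d. d \<in> Domain k \<union> (T - {x}) \<Longrightarrow> c z d = s d" "is_R (c z x)"
    "\<And>e m. e \<in> Range k \<Longrightarrow> (g ^^ m) y \<noteq> e \<and> (g ^^ m) e \<noteq> y"
  proof (rule extend_by_pair[OF g k _ fin _ s(1) _ \<tau>(1)])
    show "x \<notin> Domain k \<union> (T - {x})" using x by blast
    show "is_R (s d)" if "d \<in> Domain k \<union> (T - {x}) - Domain k" for d
      using s(3)[of d] that by blast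
    show "\<tau> e = c x d" if "(d, e) \<in> k" for d e using \<tau>(2)[of e] t[OF that] that by auto
    show "\<tau> (inverse_fun g e) = s d" if "(d, e) \<in> k" for d e
      using s(2)[OF DomainI[OF that]] s0[of e d] that by simp
  qed blast+
  show ?thesis
  proof (rule that[OF yz(1) _ _ yz(3) _ yz(4)])
    show R: "is_R (c z d)" if "d \<in> T - Domain k" for d
      using yz(2,3) s(3)[of d] that by (cases "d = x") auto
    have "c z d \<noteq> None" if "d \<in> T" for d
      using yz(2)[of d] yz(3) type_overD(1)[OF s(1), of d] that by (cases "d = x") auto
    then show "z \<notin> T" by auto
    show "inverse_fun g e \<in> Range k" if "(d, e) \<in> k" "\<not> is_R (c z d)" for d e
    proof (rule ccontr)
      assume "inverse_fun g e \<notin> Range k"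
      then have "is_R (\<tau> (inverse_fun g e))" using that(1) by (intro \<tau>(3)) auto
      moreover have "c z d = \<tau> (inverse_fun g e)"
        using yz(2)[OF UnI1[OF DomainI[OF that(1)]]] s(2)[OF DomainI[OF that(1)]] s0[of e d] that(1)
        by simp
      ultimately show False using that(2) by simp
    qed
  qed
qed

text \<open>The point \<open>x\<close> fixes the labels of \<open>y\<close> over
  \<open>Range k\<close>, and the type of \<open>z\<close>, dictated by \<open>l\<close> and
  \<open>y'\<close>, fixes them over the preimage of \<open>Range k\<close> under \<open>g\<close>.
  By \<open>match\<close> both agree on the overlap; by \<open>Gx\<close> and \<open>Gl\<close> only
  \<open>R\<close>-labels occur outside it, so \<open>type_over_Un_R\<close> applies.\<close>

lemma extend_meeting:
  assumes g: "free_aut g" and k: "partial_iso k" "finite k" and l: "partial_iso l" "finite l"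
    and x: "x \<notin> Domain k" "x \<notin> Domain l" and y': "y' \<notin> Range l"
    and match: "\<And>d e d'. (d, e) \<in> k \<Longrightarrow> (d', g e) \<in> k \<Longrightarrow> \<exists>e'. (d', e') \<in> l \<and> c y' e' = c x d"
    and Gx: "\<And>d e. (d, e) \<in> k \<Longrightarrow> \<not> is_R (c x d) \<Longrightarrow> g e \<in> Range k"
    and Gl: "\<And>d e. (d, e) \<in> l \<Longrightarrow> \<not> is_R (c y' e) \<Longrightarrow> \<exists>e0\<in>Range k. (d, g e0) \<in> k"
  obtains y z where "partial_iso (insert (x, y) (insert (z, g y) k))" "partial_iso (insert (z, y') l)"
    "\<And>e m. e \<in> Range k \<Longrightarrow> (g ^^ m) y \<noteq> e \<and> (g ^^ m) e \<noteq> y"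
proof -
  note g' = free_autD(1)[OF g]
  have l': "partial_iso (l\<inverse>)" using l(1) by simp
  obtain s0 where s0: "\<And>b a. (b, a) \<in> l\<inverse> \<Longrightarrow> s0 a = c y' b"
    by (rule transport_function[OF l', of "c y'"]) blast
  have type0: "type_over c (Domain l) s0"
    by (rule transport_type[OF l' type_over_point[OF y']]) (use s0 in auto)
  obtain s where s: "type_over c (Domain l \<union> Domain k) s" "\<And>d. d \<in> Domain l \<Longrightarrow> s d = s0 d"
    "\<And>d. d \<in> Domain k - Domain l \<Longrightarrow> is_R (s d)"
    by (rule type_extension[OF c_structure subset_UNIV subset_UNIV type0]) blast
  have sl: "s d = c y' e" if "(d, e) \<in> l" for d e
    using s(2)[OF DomainI[OF that]] s0[of e d] that by simp
  obtain t1 where t1: "\<And>d e. (d, e) \<in> k \<Longrightarrow> t1 e = c x d"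
    by (rule transport_function[OF k(1), of "c x"]) blast
  obtain t2 where t2: "\<And>d e. (d, e) \<in> k \<Longrightarrow> t2 e = s d"
    by (rule transport_function[OF k(1), of s]) blast
  define \<tau> where "\<tau> e = (if e \<in> Range k then t1 e else t2 (g e))" for e
  have \<tau>x: "\<tau> e = c x d" if "(d, e) \<in> k" for d e using t1[OF that] that by (auto simp: \<tau>_def)
  have \<tau>s: "\<tau> (inverse_fun g e) = s d" if de: "(d, e) \<in> k" for d e
  proof (cases "inverse_fun g e \<in> Range k")
    case True
    then obtain d0 where d0: "(d0, inverse_fun g e) \<in> k" by blast
    have "(d, g (inverse_fun g e)) \<in> k" using de g' by simp
    then obtain e' where "(d, e') \<in> l" "c y' e' = c x d0" using match[OF d0] by blast
    then show ?thesis using sl \<tau>x[OF d0] by metis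
  next
    case False
    then show ?thesis using t2[OF de] g' by (simp add: \<tau>_def)
  qed
  have type1: "type_over c (Range k) \<tau>"
    by (rule transport_type[OF k(1) type_over_point[OF x(1)]]) (use \<tau>x in auto)
  have "type_over c (Range k) (\<lambda>e. \<tau> (inverse_fun g e))"
    by (rule transport_type[OF k(1) type_over_mono[OF s(1)], of "Domain k"]) (use \<tau>s in auto)
  then have "type_over c (inverse_fun g ` Range k) (\<lambda>e. \<tau> (inverse_fun g (g e)))"
    by (rule type_over_vimage[OF g'])
  then have type2: "type_over c (inverse_fun g ` Range k) \<tau>" using g' by simp
  have type: "type_over c (Range k \<union> inverse_fun g ` Range k) \<tau>"
  proof (rule type_over_Un_R[OF type1 type2])
    fix e assume e: "e \<in> Range k - inverse_fun g ` Range k"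
    then obtain d where d: "(d, e) \<in> k" by blast
    show "is_R (\<tau> e)"
    proof (rule ccontr)
      assume "\<not> is_R (\<tau> e)"
      then have "g e \<in> Range k" using Gx[OF d] \<tau>x[OF d] by simp
      then have "inverse_fun g (g e) \<in> inverse_fun g ` Range k" by blast
      then show False using e g' by simp
    qed
  next
    fix b assume b: "b \<in> inverse_fun g ` Range k - Range k"
    then obtain d e where de: "(d, e) \<in> k" "b = inverse_fun g e" by blast
    show "is_R (\<tau> b)"
    proof (rule ccontr)
      assume "\<not> is_R (\<tau> b)"
      then have sd: "\<not> is_R (s d)" using \<tau>s de by simp
      then have "d \<in> Domain l" using s(3)[of d] de(1) by blast
      then obtain e' where e': "(d, e') \<in> l" by blast
      then obtain e0 where e0: "e0 \<in> Range k" "(d, g e0) \<in> k" using Gl[OF e'] sl[OF e'] sd by auto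
      have "g e0 = e" using partial_iso_eq_iff[OF k(1) de(1) e0(2)] by simp
      then show False using e0(1) b de(2) g' by auto
    qed
  qed
  have fin: "finite (Domain l \<union> Domain k)" using k(2) l(2) by (simp add: finite_Domain)
  obtain y z where yz: "partial_iso (insert (x, y) (insert (z, g y) k))"
    "\<And>d. d \<in> Domain l \<union> Domain k \<Longrightarrow> c z d = s d" "is_R (c z x)"
    "\<And>e m. e \<in> Range k \<Longrightarrow> (g ^^ m) y \<noteq> e \<and> (g ^^ m) e \<noteq> y"
  proof (rule extend_by_pair[OF g k _ fin _ s(1) _ type \<tau>x \<tau>s])
    show "x \<notin> Domain l \<union> Domain k" using x by blast
    show "is_R (s d)" if d: "d \<in> Domain l \<union> Domain k - Domain k" for d
    proof (rule ccontr)
      assume n: "\<not> is_R (s d)"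
      obtain e where e: "(d, e) \<in> l" using d by blast
      show False using Gl[OF e] sl[OF e] n d by auto
    qed
  qed blast+
  have "partial_iso (insert (z, y') l)"
    by (rule partial_iso_insert[OF l(1)]) (use yz(2) sl in \<open>metis Domain.intros UnI1\<close>)
  then show ?thesis using that yz by blast
qed

end

section \<open>Five partial conjugates around a circle\<close>

datatype layer = L0 | L1 | L2 | L3 | L4

instance layer :: countable
  by countable_datatype

fun nxt :: "layer \<Rightarrow> layer" where
  "nxt L0 = L1" | "nxt L1 = L2" | "nxt L2 = L3" | "nxt L3 = L4" | "nxt L4 = L0"

lemma nxt_cycle: "nxt (nxt (nxt (nxt (nxt i)))) = i"
  by (cases i) auto

lemma layers_distinct: "distinct [i, nxt i, nxt (nxt i), nxt (nxt (nxt i)), nxt (nxt (nxt (nxt i)))]"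
  by (cases i) auto

lemma all_layers:
  "(\<forall>j. Q j) \<longleftrightarrow> Q i \<and> Q (nxt i) \<and> Q (nxt (nxt i)) \<and> Q (nxt (nxt (nxt i))) \<and> Q (nxt (nxt (nxt (nxt i))))"
proof -
  have "(\<forall>j. Q j) \<longleftrightarrow> Q L0 \<and> Q L1 \<and> Q L2 \<and> Q L3 \<and> Q L4"
    by (metis layer.exhaust)
  then show ?thesis by (cases i) auto
qed

text \<open>
  Five copies of the structure are arranged in a circle. The \<open>i\<close>-th conjugate of \<open>g\<close> leads from
  copy \<open>i\<close> to copy \<open>nxt i\<close>, and \<open>\<sigma> i\<close> is a change of coordinates on copy \<open>nxt i\<close>.
\<close>
locale conjugate_circle = generic_structure +
  fixes g :: "'a \<Rightarrow> 'a" and \<sigma> :: "layer \<Rightarrow> 'a \<Rightarrow> 'a"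
  assumes g: "free_aut g" and \<sigma>: "aut (\<sigma> i)"
begin

lemmas g_aut = free_autD(1)[OF g]

lemma g_no_fixed [simp]: "g x \<noteq> x" "g (g x) \<noteq> x" "x \<noteq> g x"
  using free_autD(2)[OF g, of 1 x] free_autD(2)[OF g, of 2 x] by (auto simp: numeral_2_eq_2)

text \<open>The part, determined by the partial map \<open>k\<close>, of the graph of the conjugate
  of \<open>g\<close> by \<open>k\<close> followed by the inverse of
  \<open>\<sigma> i\<close>.\<close>

definition link :: "layer \<Rightarrow> ('a \<times> 'a) set \<Rightarrow> ('a \<times> 'a) set" where
  "link i k = {(x, x'). \<exists>y. (x, y) \<in> k \<and> (\<sigma> i x', g y) \<in> k}"

lemma link_mono: "k \<subseteq> k' \<Longrightarrow> link i k \<subseteq> link i k'"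
  unfolding link_def by blast

definition closed_chain :: "(layer \<Rightarrow> ('a \<times> 'a) set) \<Rightarrow> (layer \<Rightarrow> 'a) \<Rightarrow> bool" where
  "closed_chain k q \<longleftrightarrow> (\<forall>i. (q i, q (nxt i)) \<in> link i (k i))"

lemma closed_chain_mono: "closed_chain k q \<Longrightarrow> (\<And>i. k i \<subseteq> k' i) \<Longrightarrow> closed_chain k' q"
  unfolding closed_chain_def using link_mono by blast

text \<open>\<open>E\<close> meets every \<open>g\<close>-orbit in a segment without gaps. Filling a
  gap with one value would create links on both sides of it.\<close>

definition orbit_convex :: "'a set \<Rightarrow> bool" where
  "orbit_convex E \<longleftrightarrow> (\<forall>y\<in>E. g y \<notin> E \<longrightarrow> (\<forall>m>0. (g ^^ m) y \<notin> E))"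

lemma orbit_convexD: "orbit_convex E \<Longrightarrow> y \<in> E \<Longrightarrow> g y \<notin> E \<Longrightarrow> m > 0 \<Longrightarrow> (g ^^ m) y \<notin> E"
  by (auto simp: orbit_convex_def)

lemma orbit_convex_successor:
  assumes E: "orbit_convex E" and v: "v \<in> E" "g v \<notin> E"
  shows "orbit_convex (insert (g v) E)"
  unfolding orbit_convex_def
proof (intro ballI impI allI notI)
  fix y m assume y: "y \<in> insert (g v) E" "g y \<notin> insert (g v) E" "0 < (m::nat)"
    and m: "(g ^^ m) y \<in> insert (g v) E"
  show False
  proof (cases "y \<in> E")
    case True
    then have "(g ^^ m) y = g v" using orbit_convexD[OF E True _ y(3)] y(2) m by blast
    moreover obtain m' where m': "m = Suc m'" using y(3) by (cases m) auto
    ultimately have "(g ^^ m') y = v" using g_aut by simp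
    then show False using orbit_convexD[OF E True, of m'] v y(2) by (cases m') auto
  next
    case False
    then have "y = g v" using y(1) by blast
    then have eq: "(g ^^ m) y = (g ^^ Suc m) v" by (simp add: funpow_swap1)
    have "(g ^^ m) y \<noteq> y" using free_autD(2)[OF g y(3)] .
    then show False using orbit_convexD[OF E v, of "Suc m"] m eq \<open>y = g v\<close> by auto
  qed
qed

lemma orbit_convex_predecessor:
  assumes E: "orbit_convex E" and w: "g w \<in> E"
  shows "orbit_convex (insert w E)"
  unfolding orbit_convex_def
proof (intro ballI impI allI notI)
  fix y m assume y: "y \<in> insert w E" "g y \<notin> insert w E" "0 < (m::nat)"
    and m: "(g ^^ m) y \<in> insert w E"
  have "y \<in> E" using y(1,2) w by auto
  then have "(g ^^ m) y = w" using orbit_convexD[OF E _ _ y(3)] y(2) m by blast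
  then have "(g ^^ Suc m) y \<in> E" using w by simp
  then show False using orbit_convexD[OF E \<open>y \<in> E\<close>, of "Suc m"] y(2) by blast
qed

definition orbit_avoids :: "'a \<Rightarrow> 'a set \<Rightarrow> bool" where
  "orbit_avoids y E \<longleftrightarrow> (\<forall>e\<in>E. \<forall>m. (g ^^ m) y \<noteq> e \<and> (g ^^ m) e \<noteq> y)"

lemma orbit_avoidsD:
  assumes "orbit_avoids y E"
  shows "y \<notin> E" "g y \<notin> E" "g (g y) \<notin> E" "e \<in> E \<Longrightarrow> g e \<noteq> y" "e \<in> E \<Longrightarrow> (g ^^ m) e \<noteq> y"
    "e \<in> E \<Longrightarrow> (g ^^ m) y \<noteq> e"
proof -
  have *: "(g ^^ m) y \<noteq> e \<and> (g ^^ m) e \<noteq> y" if "e \<in> E" for e m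
    using assms that by (simp add: orbit_avoids_def)
  show "y \<notin> E" using *[of y 0] by auto
  show "g y \<notin> E" using *[of "g y" 1] by auto
  show "g (g y) \<notin> E" using *[of "g (g y)" 2] by (auto simp: numeral_2_eq_2)
  show "g e \<noteq> y" if "e \<in> E" using *[OF that, of 1] by auto
  show "(g ^^ m) e \<noteq> y" "(g ^^ m) y \<noteq> e" if "e \<in> E" using *[OF that, of m] by auto
qed

lemma orbit_convex_fresh:
  assumes E: "orbit_convex E" and y: "orbit_avoids y E"
  shows "orbit_convex (insert y E)"
  unfolding orbit_convex_def
proof (intro ballI impI allI notI)
  fix v m assume v: "v \<in> insert y E" "g v \<notin> insert y E" "0 < (m::nat)"
    and m: "(g ^^ m) v \<in> insert y E"
  have "(g ^^ m) v \<noteq> v" using free_autD(2)[OF g v(3)] .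
  then show False using v m orbit_convexD[OF E _ _ v(3)] orbit_avoidsD(5,6)[OF y] by blast
qed

lemma orbit_convex_pair:
  assumes E: "orbit_convex E" and y: "orbit_avoids y E"
  shows "orbit_convex (insert y (insert (g y) E))"
proof -
  have "orbit_convex (insert (g y) (insert y E))"
    by (rule orbit_convex_successor[OF orbit_convex_fresh[OF E y]])
      (use orbit_avoidsD(2)[OF y] in auto)
  then show ?thesis by (simp add: insert_commute)
qed

text \<open>A link comes from a value \<open>b\<close> for which \<open>g b\<close> is a value too.
  In the new orbit only \<open>y\<close> and \<open>g y\<close> are values, and \<open>g\<close> has
  no orbit of length one or two, so only the link from \<open>x\<close> to \<open>x'\<close> can be
  new.\<close>

lemma link_pair:
  assumes k: "partial_iso (insert (x, y) (insert (\<sigma> i x', g y) k))" and y: "orbit_avoids y (Range k)"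
  shows "link i (insert (x, y) (insert (\<sigma> i x', g y) k)) \<subseteq> insert (x, x') (link i k)"
proof clarify
  fix a a' assume aa: "(a, a') \<in> link i (insert (x, y) (insert (\<sigma> i x', g y) k))" "(a, a') \<notin> link i k"
  define k' where "k' = insert (x, y) (insert (\<sigma> i x', g y) k)"
  obtain b where b: "(a, b) \<in> k'" "(\<sigma> i a', g b) \<in> k'" using aa(1) by (auto simp: link_def k'_def)
  note avoid = orbit_avoidsD[OF y]
  have inj: "p = p'" if "(p, e) \<in> k'" "(p', e) \<in> k'" for p p' e
    using partial_iso_eq_iff[OF k, folded k'_def, OF that] by simp
  consider "b = y" | "b = g y" | "(a, b) \<in> k" using b(1) by (auto simp: k'_def)
  then show "a = x \<and> a' = x'"
  proof cases
    case 1
    have "a = x" using inj[of a y x] b(1) 1 by (simp add: k'_def)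
    moreover have "\<sigma> i a' = \<sigma> i x'" using inj[of "\<sigma> i a'" "g y" "\<sigma> i x'"] b(2) 1 by (simp add: k'_def)
    ultimately show ?thesis using \<sigma> by simp
  next
    case 2
    then show ?thesis using b(2) avoid(3) by (auto simp: k'_def)
  next
    case 3
    then have bE: "b \<in> Range k" by blast
    have "g b \<noteq> y" "g b \<noteq> g y" using avoid(1) avoid(4)[OF bE] bE g_aut by auto
    then have "(\<sigma> i a', g b) \<in> k" using b(2) by (auto simp: k'_def)
    then show ?thesis using 3 aa(2) by (auto simp: link_def)
  qed
qed

lemma link_fresh:
  assumes y: "orbit_avoids y (Range k)"
  shows "link i (insert (x, y) k) = link i k"
proof
  note avoid = orbit_avoidsD[OF y]
  show "link i (insert (x, y) k) \<subseteq> link i k"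
    using avoid(2,4) by (auto simp: link_def)
  show "link i k \<subseteq> link i (insert (x, y) k)" by (rule link_mono) blast
qed

text \<open>The value \<open>g v\<close> could also start a link by way of \<open>g (g v)\<close>,
  but convexity keeps \<open>g (g v)\<close> out of the range.\<close>

lemma link_successor:
  assumes k: "partial_iso k" "orbit_convex (Range k)" and v: "(u, v) \<in> k" "g v \<notin> Range k"
  shows "link i (insert (\<sigma> i x', g v) k) \<subseteq> insert (u, x') (link i k)"
proof clarify
  fix a a' assume aa: "(a, a') \<in> link i (insert (\<sigma> i x', g v) k)" "(a, a') \<notin> link i k"
  then obtain b where b: "(a, b) \<in> insert (\<sigma> i x', g v) k" "(\<sigma> i a', g b) \<in> insert (\<sigma> i x', g v) k"
    by (auto simp: link_def)
  have "g (g v) \<notin> Range k"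
    using orbit_convexD[OF k(2) RangeI[OF v(1)] v(2), of 2] by (simp add: numeral_2_eq_2)
  then have ak: "(a, b) \<in> k" using b by auto
  then have "(\<sigma> i a', g b) \<notin> k" using aa(2) by (auto simp: link_def)
  then have "\<sigma> i a' = \<sigma> i x'" "g b = g v" using b(2) by auto
  then have "a' = x'" "b = v" using \<sigma> g_aut by simp_all
  then show "a = u \<and> a' = x'" using partial_iso_eq_iff[OF k(1) ak v(1)] by simp
qed

lemma link_predecessor:
  assumes k: "partial_iso k" "orbit_convex (Range k)" and v: "(\<sigma> i u, g w) \<in> k" "w \<notin> Range k"
  shows "link i (insert (x, w) k) \<subseteq> insert (x, u) (link i k)"
proof clarify
  fix a a' assume aa: "(a, a') \<in> link i (insert (x, w) k)" "(a, a') \<notin> link i k"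
  then obtain b where b: "(a, b) \<in> insert (x, w) k" "(\<sigma> i a', g b) \<in> insert (x, w) k"
    by (auto simp: link_def)
  show "a = x \<and> a' = u"
  proof (cases "(a, b) \<in> k")
    case True
    then have "g b = w" using b(2) aa(2) by (auto simp: link_def)
    then have "g b \<notin> Range k" "(g ^^ 2) b \<in> Range k" using v by (auto simp: numeral_2_eq_2)
    then show ?thesis using orbit_convexD[OF k(2) RangeI[OF True], of 2] by simp
  next
    case False
    then have "a = x" "b = w" using b(1) by auto
    then have "(\<sigma> i a', g w) \<in> k" using b(2) by auto
    then have "\<sigma> i a' = \<sigma> i u" using partial_iso_eq_iff[OF k(1) _ v(1)] by simp
    then show ?thesis using \<sigma> \<open>a = x\<close> by simp
  qed
qed

section \<open>Back and forth with closed chains only\<close>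

definition circle_state :: "(layer \<Rightarrow> ('a \<times> 'a) set) \<Rightarrow> bool" where
  "circle_state k \<longleftrightarrow>
     (\<forall>i. finite (k i) \<and> partial_iso (k i) \<and> orbit_convex (Range (k i))) \<and>
     (\<forall>i x x'. (x, x') \<in> link i (k i) \<longrightarrow> (\<exists>q. closed_chain k q \<and> q i = x \<and> q (nxt i) = x'))"

lemma circle_stateD:
  assumes "circle_state k"
  shows "finite (k i)" "partial_iso (k i)" "orbit_convex (Range (k i))"
    "(x, x') \<in> link i (k i) \<Longrightarrow> \<exists>q. closed_chain k q \<and> q i = x \<and> q (nxt i) = x'"
  using assms by (auto simp: circle_state_def)

lemma circle_state_extend:
  assumes k: "circle_state k" and ext: "\<And>i. k i \<subseteq> k' i"
    and k': "\<And>i. finite (k' i) \<and> partial_iso (k' i) \<and> orbit_convex (Range (k' i))"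
    and new: "\<And>i x x'. (x, x') \<in> link i (k' i) \<Longrightarrow>
      (x, x') \<in> link i (k i) \<or> (\<exists>q. closed_chain k' q \<and> q i = x \<and> q (nxt i) = x')"
  shows "circle_state k'"
  unfolding circle_state_def
proof (intro conjI allI impI)
  fix i x x' assume link: "(x, x') \<in> link i (k' i)"
  have "closed_chain k' q" if "closed_chain k q" for q
    using that ext by (rule closed_chain_mono)
  then show "\<exists>q. closed_chain k' q \<and> q i = x \<and> q (nxt i) = x'"
    using new[OF link] circle_stateD(4)[OF k, of x x' i] by blast
qed (use k' in blast)+

lemma circle_add_fresh:
  assumes k: "circle_state k" and "partial_iso (insert (x, y) (k i))" "orbit_avoids y (Range (k i))"
  shows "circle_state (k(i := insert (x, y) (k i)))"
proof (rule circle_state_extend[OF k])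
  show "k j \<subseteq> (k(i := insert (x, y) (k i))) j" for j by auto
  show "finite ((k(i := insert (x, y) (k i))) j) \<and> partial_iso ((k(i := insert (x, y) (k i))) j) \<and>
      orbit_convex (Range ((k(i := insert (x, y) (k i))) j))" for j
    using circle_stateD(1-3)[OF k] assms(2) orbit_convex_fresh[OF circle_stateD(3)[OF k] assms(3)]
    by simp
qed (use link_fresh[OF assms(3)] in \<open>auto split: if_splits\<close>)

text \<open>Each partial conjugate preserves labels, so the label between a moving point and a
  closed chain is the same in consecutive layers.\<close>

lemma closed_chain_label:
  assumes q: "closed_chain k q" and K: "partial_iso K" "k i \<subseteq> K"
    and a: "(a, b) \<in> K" "(\<sigma> i a', g b) \<in> K"
  shows "c a' (q (nxt i)) = c a (q i)"
proof -
  obtain e where e: "(q i, e) \<in> K" "(\<sigma> i (q (nxt i)), g e) \<in> K"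
    using q K(2) unfolding closed_chain_def link_def by blast
  have "c a' (q (nxt i)) = c (\<sigma> i a') (\<sigma> i (q (nxt i)))" using \<sigma> by simp
  also have "\<dots> = c (g b) (g e)" by (rule partial_isoD[OF K(1) a(2) e(2)])
  also have "\<dots> = c a (q i)" using g_aut partial_isoD[OF K(1) a(1) e(1)] by simp
  finally show ?thesis .
qed

lemma partial_iso_image:
  assumes s: "aut s"
  shows "partial_iso ((\<lambda>(d, e). (s d, e)) ` K) \<longleftrightarrow> partial_iso K"
proof
  assume "partial_iso ((\<lambda>(d, e). (s d, e)) ` K)"
  then have "c (s x) (s x') = c y y'" if "(x, y) \<in> K" "(x', y') \<in> K" for x y x' y'
    by (rule partial_isoD) (use that in force)+
  then show "partial_iso K" using s by (intro partial_isoI) simp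
next
  assume "partial_iso K"
  then show "partial_iso ((\<lambda>(d, e). (s d, e)) ` K)"
    using s by (intro partial_isoI) (auto dest: partial_isoD)
qed

text \<open>The links \<open>j0\<close> and \<open>j4\<close> at \<open>u\<close> are completed from
  the given values \<open>v\<close> and \<open>v'\<close>; \<open>extend_forward\<close> supplies
  \<open>j1\<close>, and \<open>j3\<close> when applied to the inverse of \<open>g\<close>;
  \<open>extend_meeting\<close> supplies \<open>j2\<close>. No layer gains a link other than that of
  the new chain.\<close>

lemma close_open_chain:
  assumes k: "circle_state k" and ext_j: "nxt j0 = j1" "nxt j1 = j2" "nxt j2 = j3" "nxt j3 = j4" "nxt j4 = j0"
    and u: "(u, v) \<in> k j0" "(\<sigma> j4 u, v') \<in> k j4"
    and open_ends: "g v \<notin> Range (k j0)" "inverse_fun g v' \<notin> Range (k j4)"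
  shows "\<exists>k' q. circle_state k' \<and> (\<forall>i. k i \<subseteq> k' i) \<and> closed_chain k' q \<and> q j0 = u"
proof -
  note fin = circle_stateD(1)[OF k] and iso = circle_stateD(2)[OF k] and conv = circle_stateD(3)[OF k]
  have dist: "distinct [j0, j1, j2, j3, j4]"
    using layers_distinct[of j0] ext_j by simp
  have all: "(\<forall>i. Q i) \<longleftrightarrow> Q j0 \<and> Q j1 \<and> Q j2 \<and> Q j3 \<and> Q j4" for Q
    using all_layers[of Q j0] ext_j by simp
  have chain: "\<exists>q. closed_chain k q \<and> q i = x \<and> q (nxt i) = x'"
    if "(x, y) \<in> k i" "(\<sigma> i x', g y) \<in> k i" for i x x' y
    using circle_stateD(4)[OF k, of x x' i] that by (auto simp: link_def)
  have dom: "finite (Domain (k i))" for i using fin by (simp add: finite_Domain)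

  \<comment> \<open>The type of \<open>z1\<close> over \<open>Domain (k j0)\<close> is dictated by
    \<open>g v\<close>. What can be arranged is that \<open>x1\<close> has no value yet in layer
    \<open>j1\<close>.\<close>
  obtain z1 where z1: "partial_iso (insert (z1, g v) (k j0))" "z1 \<notin> \<sigma> j0 ` Domain (k j1)"
    by (rule extend_range[OF dense_pred_True iso fin finite_imageI[OF dom] open_ends(1)]) blast
  define x1 where "x1 = inverse_fun (\<sigma> j0) z1"
  have x1: "\<sigma> j0 x1 = z1" using \<sigma> by (simp add: x1_def)
  have x1D: "x1 \<notin> Domain (k j1)" using z1(2) x1 by blast

  define w where "w = inverse_fun g v'"
  have gw: "g w = v'" using g_aut by (simp add: w_def)
  obtain x4 where x4: "partial_iso (insert (x4, w) (k j4))"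
    "x4 \<notin> inverse_fun (\<sigma> j3) ` Domain (k j3)"
    unfolding w_def
    by (rule extend_range[OF dense_pred_True iso fin finite_imageI[OF dom] open_ends(2)]) blast
  have x4D: "\<sigma> j3 x4 \<notin> Domain (k j3)"
  proof
    assume "\<sigma> j3 x4 \<in> Domain (k j3)"
    then have "inverse_fun (\<sigma> j3) (\<sigma> j3 x4) \<in> inverse_fun (\<sigma> j3) ` Domain (k j3)" by blast
    then show False using x4(2) \<sigma> by simp
  qed

  \<comment> \<open>For the inverse of \<open>g\<close> the link is built from its end:
    \<open>y'\<close> is the value of \<open>\<sigma> j3 x4\<close>, and its
    \<open>g\<close>-predecessor \<open>y3\<close> will be the value of \<open>x3\<close>. The point
    \<open>zd\<close> is auxiliary and is dropped; it shows which labels at \<open>y3\<close> can be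
    \<open>G\<close>.\<close>
  obtain y' zd where left: "partial_iso (insert (\<sigma> j3 x4, y') (insert (zd, inverse_fun g y') (k j3)))"
    "is_R (c zd (\<sigma> j3 x4))"
    "\<And>d e. (d, e) \<in> k j3 \<Longrightarrow> \<not> is_R (c zd d) \<Longrightarrow> inverse_fun (inverse_fun g) e \<in> Range (k j3)"
    "\<And>e m. e \<in> Range (k j3) \<Longrightarrow> (inverse_fun g ^^ m) y' \<noteq> e \<and> (inverse_fun g ^^ m) e \<noteq> y'"
    by (rule extend_forward[OF free_aut_inverse[OF g] iso fin x4D finite.emptyI]) blast
  define y3 where "y3 = inverse_fun g y'"
  have y': "y' = g y3" using g_aut by (simp add: y3_def)
  have y3_avoids: "orbit_avoids y3 (Range (k j3))"
    unfolding orbit_avoids_def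
  proof (intro ballI allI conjI)
    fix e m assume e: "e \<in> Range (k j3)"
    show "(g ^^ m) y3 \<noteq> e"
    proof (cases m)
      case 0
      then show ?thesis using left(4)[OF e, of 1] by (simp add: y3_def)
    next
      case (Suc m')
      have "(g ^^ m) y3 = (g ^^ m') y'" using Suc y' by (simp add: funpow_swap1)
      then show ?thesis using left(4)[OF e, of m'] funpow_inverse[OF g_aut, of m' e y'] by simp
    qed
    have "(g ^^ Suc m) e \<noteq> y'"
      using left(4)[OF e, of "Suc m"] funpow_inverse[OF g_aut, of "Suc m" y' e] by blast
    then show "(g ^^ m) e \<noteq> y3" using y' by auto
  qed
  define K3 where "K3 = insert (\<sigma> j3 x4, y') (k j3)"
  have K3: "partial_iso K3" "finite K3" "k j3 \<subseteq> K3"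
    using partial_iso_subset[OF left(1), of K3] fin by (auto simp: K3_def)
  have zd: "c zd d = c y3 e" if "(d, e) \<in> K3" for d e
    by (rule partial_isoD[OF left(1)]) (use that in \<open>auto simp: K3_def y3_def\<close>)
  \<comment> \<open>\<open>K3\<close> rewritten in the coordinates in which \<open>k j2\<close> sees
    its targets, where \<open>x3\<close> will appear as \<open>z3 = \<sigma> j2 x3\<close>.\<close>
  define l where "l = (\<lambda>(d, e). (\<sigma> j2 d, e)) ` K3"
  have l: "partial_iso l" "finite l"
    using K3 partial_iso_image[OF \<sigma>] by (simp_all add: l_def)
  have "y3 \<notin> Range l"
    using orbit_avoidsD(1)[OF y3_avoids] y' by (auto simp: l_def K3_def)

  have "finite (\<sigma> j1 ` (Domain (k j2) \<union> Domain l))"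
    using dom l(2) by (simp add: finite_Domain)
  \<comment> \<open>The finite set makes \<open>x2\<close> new both as a source and as a target of
    layer \<open>j2\<close>, and restricts its \<open>G\<close>-edges there to points whose image
    under \<open>\<sigma> j1\<close> lies in \<open>Domain (k j1)\<close>.\<close>
  then obtain y1 z2 where right: "partial_iso (insert (x1, y1) (insert (z2, g y1) (k j1)))"
    "z2 \<notin> \<sigma> j1 ` (Domain (k j2) \<union> Domain l)"
    "\<And>d. d \<in> \<sigma> j1 ` (Domain (k j2) \<union> Domain l) - Domain (k j1) \<Longrightarrow> is_R (c z2 d)"
    "\<And>d e. (d, e) \<in> k j1 \<Longrightarrow> \<not> is_R (c z2 d) \<Longrightarrow> inverse_fun g e \<in> Range (k j1)"
    "\<And>e m. e \<in> Range (k j1) \<Longrightarrow> (g ^^ m) y1 \<noteq> e \<and> (g ^^ m) e \<noteq> y1"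
    by (rule extend_forward[OF g iso fin x1D]) blast
  define x2 where "x2 = inverse_fun (\<sigma> j1) z2"
  have x2: "\<sigma> j1 x2 = z2" using \<sigma> by (simp add: x2_def)
  have x2D: "x2 \<notin> Domain (k j2)" "x2 \<notin> Domain l" using right(2) x2 by blast+

  \<comment> \<open>Forward and backward from \<open>u\<close>, both halves have the label
    \<open>c u (q j0)\<close> to a closed chain \<open>q\<close>. This is the compatibility required
    at the meeting link.\<close>
  have x2_label: "c x2 (q j2) = c u (q j0)" if q: "closed_chain k q" for q
  proof -
    have "c x1 (q (nxt j0)) = c u (q j0)"
      by (rule closed_chain_label[OF q z1(1)]) (use u x1 in auto)
    moreover have "c x2 (q (nxt j1)) = c x1 (q j1)"
      by (rule closed_chain_label[OF q right(1)]) (use x2 in auto)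
    ultimately show ?thesis using ext_j by simp
  qed
  have y3_label: "c y3 e = c u (q j0)"
    if q: "closed_chain k q" and e: "(q j3, e) \<in> k j3" for q e
  proof -
    obtain e' where e': "(q j3, e') \<in> k j3" "(\<sigma> j3 (q j4), g e') \<in> k j3"
      using q ext_j unfolding closed_chain_def link_def by blast
    have "e' = e" using partial_iso_eq_iff[OF iso e'(1) e] by simp
    then have "c (\<sigma> j3 x4) (\<sigma> j3 (q j4)) = c y' (g e)"
      using e'(2) K3(3) by (intro partial_isoD[OF K3(1)]) (auto simp: K3_def)
    then have "c y3 e = c x4 (q j4)" using y' g_aut \<sigma> by simp
    also have "c u (q (nxt j4)) = c x4 (q j4)"
      by (rule closed_chain_label[OF q x4(1)]) (use u gw in auto)
    ultimately show ?thesis using ext_j by simp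
  qed

  obtain y2 z3 where middle: "partial_iso (insert (x2, y2) (insert (z3, g y2) (k j2)))"
    "partial_iso (insert (z3, y3) l)"
    "\<And>e m. e \<in> Range (k j2) \<Longrightarrow> (g ^^ m) y2 \<noteq> e \<and> (g ^^ m) e \<noteq> y2"
  proof (rule extend_meeting[OF g iso fin l x2D \<open>y3 \<notin> Range l\<close>])
    \<comment> \<open>Hypothesis \<open>match\<close>: the two pairs form a link of layer
      \<open>j2\<close>, which the invariant places on a closed chain.\<close>
    fix d e d' assume de: "(d, e) \<in> k j2" "(d', g e) \<in> k j2"
    have "(\<sigma> j2 (inverse_fun (\<sigma> j2) d'), g e) \<in> k j2" using de(2) \<sigma> by simp
    then obtain q where q: "closed_chain k q" "q j2 = d" "q j3 = inverse_fun (\<sigma> j2) d'"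
      using chain[OF de(1)] ext_j by auto
    then obtain e' where e': "(q j3, e') \<in> k j3"
      unfolding closed_chain_def link_def by blast
    have "(\<sigma> j2 (q j3), e') \<in> l" using e' K3(3) by (force simp: l_def)
    moreover have "\<sigma> j2 (q j3) = d'" using q(3) \<sigma> by simp
    ultimately show "\<exists>e'. (d', e') \<in> l \<and> c y3 e' = c x2 d"
      using y3_label[OF q(1) e'] x2_label[OF q(1)] q(2) by auto
  next
    \<comment> \<open>Hypothesis \<open>Gx\<close>: a \<open>G\<close>-edge between
      \<open>x2\<close> and \<open>d\<close> implies that a link of layer \<open>j1\<close> ends in
      \<open>d\<close>, and the closed chain through it leaves \<open>d\<close> by a link of layer
      \<open>j2\<close>.\<close>
    fix d e assume de: "(d, e) \<in> k j2" "\<not> is_R (c x2 d)"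
    have "c z2 (\<sigma> j1 d) = c x2 d" using x2 \<sigma> by (metis aut_iso)
    then have "\<sigma> j1 d \<in> Domain (k j1)" using right(3)[of "\<sigma> j1 d"] de by auto
    then obtain e1 where e1: "(\<sigma> j1 d, e1) \<in> k j1" by blast
    then have "inverse_fun g e1 \<in> Range (k j1)"
      using right(4)[OF e1] \<open>c z2 (\<sigma> j1 d) = c x2 d\<close> de(2) by simp
    then obtain d1 where d1: "(d1, inverse_fun g e1) \<in> k j1" by blast
    have "(\<sigma> j1 d, g (inverse_fun g e1)) \<in> k j1" using e1 g_aut by simp
    then obtain q where q: "closed_chain k q" "q j2 = d" using chain[OF d1] ext_j by auto
    then obtain e2 where e2: "(d, e2) \<in> k j2" "g e2 \<in> Range (k j2)"
      unfolding closed_chain_def link_def by blast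
    have "e2 = e" using partial_iso_eq_iff[OF iso e2(1) de(1)] by simp
    then show "g e \<in> Range (k j2)" using e2(2) by simp
  next
    \<comment> \<open>Hypothesis \<open>Gl\<close>, the mirror image: a link of layer
      \<open>j3\<close> leaves \<open>d0\<close>, and its closed chain enters \<open>d0\<close>
      through layer \<open>j2\<close>. The new pair of \<open>K3\<close> is excluded because
      \<open>zd\<close> has an \<open>R\<close>-edge to \<open>\<sigma> j3 x4\<close>.\<close>
    fix d e assume de: "(d, e) \<in> l" "\<not> is_R (c y3 e)"
    then obtain d0 where d0: "(d0, e) \<in> K3" "d = \<sigma> j2 d0" by (auto simp: l_def)
    have n: "\<not> is_R (c zd d0)" using zd[OF d0(1)] de(2) by simp
    then have "(d0, e) \<in> k j3" using d0(1) left(2) by (auto simp: K3_def)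
    then have "g e \<in> Range (k j3)" using left(3) n g_aut by simp
    then obtain d1 where "(d1, g e) \<in> k j3" by blast
    then have "(\<sigma> j3 (inverse_fun (\<sigma> j3) d1), g e) \<in> k j3" using \<sigma> by simp
    then obtain q where q: "closed_chain k q" "q j3 = d0" using chain[OF \<open>(d0, e) \<in> k j3\<close>] by blast
    then obtain e0 where "(q j2, e0) \<in> k j2" "(\<sigma> j2 d0, g e0) \<in> k j2"
      using ext_j unfolding closed_chain_def link_def by blast
    then show "\<exists>e0\<in>Range (k j2). (d, g e0) \<in> k j2" using d0(2) by blast
  qed blast
  define x3 where "x3 = inverse_fun (\<sigma> j2) z3"
  have x3: "\<sigma> j2 x3 = z3" using \<sigma> by (simp add: x3_def)

  have avoids: "orbit_avoids y1 (Range (k j1))" "orbit_avoids y2 (Range (k j2))"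
    using right(5) middle(3) by (auto simp: orbit_avoids_def)
  define k' where "k' = k(j0 := insert (z1, g v) (k j0), j1 := insert (x1, y1) (insert (z2, g y1) (k j1)),
    j2 := insert (x2, y2) (insert (z3, g y2) (k j2)), j3 := insert (x3, y3) (insert (\<sigma> j3 x4, g y3) (k j3)),
    j4 := insert (x4, w) (k j4))"
  have k': "k' j0 = insert (z1, g v) (k j0)" "k' j1 = insert (x1, y1) (insert (z2, g y1) (k j1))"
    "k' j2 = insert (x2, y2) (insert (z3, g y2) (k j2))"
    "k' j3 = insert (x3, y3) (insert (\<sigma> j3 x4, g y3) (k j3))" "k' j4 = insert (x4, w) (k j4)"
    using dist by (auto simp: k'_def)
  define q where "q = (\<lambda>i. u)(j1 := x1, j2 := x2, j3 := x3, j4 := x4)"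
  have q: "q j0 = u" "q j1 = x1" "q j2 = x2" "q j3 = x3" "q j4 = x4"
    using dist by (auto simp: q_def)
  have "(\<lambda>(d, e). (\<sigma> j2 d, e)) ` insert (x3, y3) K3 = insert (z3, y3) l"
    using x3 by (simp add: l_def)
  then have "partial_iso (insert (x3, y3) K3)"
    using middle(2) partial_iso_image[OF \<sigma>, of j2 "insert (x3, y3) K3"] by argo
  then have iso3: "partial_iso (insert (x3, y3) (insert (\<sigma> j3 x4, g y3) (k j3)))"
    by (simp add: K3_def y')
  have ext: "\<forall>i. k i \<subseteq> k' i" unfolding all using k' by auto
  have iso': "\<forall>i. partial_iso (k' i)"
    unfolding all k' using z1(1) right(1) middle(1) iso3 x4(1) by blast
  have v_in: "v \<in> Range (k j0)" "g w \<in> Range (k j4)" using u gw by auto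
  have conv': "\<forall>i. orbit_convex (Range (k' i))"
    unfolding all k' Range_insert
    using orbit_convex_successor[OF conv v_in(1) open_ends(1)] orbit_convex_pair[OF conv avoids(1)]
      orbit_convex_pair[OF conv avoids(2)] orbit_convex_pair[OF conv y3_avoids]
      orbit_convex_predecessor[OF conv v_in(2)] by blast
  have fin': "\<forall>i. finite (k' i)" unfolding all k' using fin by simp
  have w_new: "w \<notin> Range (k j4)" using open_ends(2) by (simp add: w_def)
  have links: "\<forall>i. link i (k' i) \<subseteq> insert (q i, q (nxt i)) (link i (k i))"
    unfolding all k' ext_j q
    using link_successor[OF iso conv u(1) open_ends(1), where i = j0 and x' = x1, unfolded x1]
      link_pair[where x = x1 and y = y1 and i = j1 and x' = x2 and k = "k j1", unfolded x2, OF right(1) avoids(1)]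
      link_pair[where x = x2 and y = y2 and i = j2 and x' = x3 and k = "k j2", unfolded x3, OF middle(1) avoids(2)]
      link_pair[OF iso3 y3_avoids]
      link_predecessor[where k = "k j4" and i = j4 and u = u and w = w and x = x4, unfolded gw,
        OF iso conv u(2) w_new]
    by blast
  have closed: "closed_chain k' q"
    unfolding closed_chain_def all link_def k' ext_j q
    using u x1 x2 x3 gw by blast
  have "circle_state k'"
  proof (rule circle_state_extend[OF k])
    show "k i \<subseteq> k' i" for i using ext by blast
    show "finite (k' i) \<and> partial_iso (k' i) \<and> orbit_convex (Range (k' i))" for i
      using fin' iso' conv' by blast
    show "(x, x') \<in> link i (k i) \<or> (\<exists>q. closed_chain k' q \<and> q i = x \<and> q (nxt i) = x')"
      if "(x, x') \<in> link i (k' i)" for i x x'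
      using links closed that by blast
  qed
  then show ?thesis using ext closed q(1) by blast
qed

definition extends :: "(layer \<Rightarrow> ('a \<times> 'a) set) \<Rightarrow> (layer \<Rightarrow> ('a \<times> 'a) set) \<Rightarrow> bool" where
  "extends k k' \<longleftrightarrow> (\<forall>i. k i \<subseteq> k' i)"

lemma extends_refl: "extends k k"
  by (simp add: extends_def)

lemma extends_trans: "extends k k' \<Longrightarrow> extends k' k'' \<Longrightarrow> extends k k''"
  unfolding extends_def by blast

lemma extendsD: "extends k k' \<Longrightarrow> (x, y) \<in> k i \<Longrightarrow> (x, y) \<in> k' i"
  unfolding extends_def by blast

text \<open>If \<open>u\<close> has a link on either side, the invariant already provides the chain;
  otherwise both ends are open, as \<open>close_open_chain\<close> requires.\<close>

lemma complete_chain: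
  assumes k: "circle_state k" and j: "nxt p = j" and u: "(u, v) \<in> k j" "(\<sigma> p u, v') \<in> k p"
  obtains k' q where "circle_state k'" "extends k k'" "closed_chain k' q" "q j = u"
proof (cases "g v \<in> Range (k j) \<or> inverse_fun g v' \<in> Range (k p)")
  case True
  then have "\<exists>q. closed_chain k q \<and> q j = u"
  proof
    assume "g v \<in> Range (k j)"
    then obtain d where "(d, g v) \<in> k j" by blast
    then have "(u, inverse_fun (\<sigma> j) d) \<in> link j (k j)" using u(1) \<sigma> by (auto simp: link_def)
    then show ?thesis using circle_stateD(4)[OF k] by blast
  next
    assume "inverse_fun g v' \<in> Range (k p)"
    then obtain d where "(d, inverse_fun g v') \<in> k p" by blast
    then have "(d, u) \<in> link p (k p)" using u(2) g_aut by (auto simp: link_def)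
    then show ?thesis using circle_stateD(4)[OF k] j by blast
  qed
  then show ?thesis using that k extends_refl by blast
next
  case False
  have p: "nxt (nxt (nxt (nxt j))) = p" using nxt_cycle[of p] j by simp
  have "\<exists>k' q. circle_state k' \<and> (\<forall>i. k i \<subseteq> k' i) \<and> closed_chain k' q \<and> q j = u"
    by (rule close_open_chain[OF k refl refl refl p j u]) (use False in auto)
  then show ?thesis using that unfolding extends_def by blast
qed

lemma add_domain:
  assumes k: "circle_state k"
  obtains k' where "circle_state k'" "extends k k'" "x \<in> Domain (k' i)"
proof (cases "x \<in> Domain (k i)")
  case False
  have fin: "finite (Range (k i))" using circle_stateD(1)[OF k] by (simp add: finite_Range)
  have dense: "dense_pred (\<lambda>y. is_R (c y (g y)) \<and> orbit_avoids y (Range (k i)))"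
    using g fin by (simp add: free_aut_def orbit_avoids_def)
  obtain y where y: "partial_iso (insert (x, y) (k i))"
    "is_R (c y (g y)) \<and> orbit_avoids y (Range (k i))"
    by (rule extend_domain[OF dense circle_stateD(2,1)[OF k] finite.emptyI False]) blast
  have "circle_state (k(i := insert (x, y) (k i)))"
    using circle_add_fresh[OF k y(1)] y(2) by blast
  then show ?thesis by (rule that) (auto simp: extends_def)
qed (use that k extends_refl in blast)

text \<open>Adding \<open>g v\<close> alone could create a link off every closed chain. Instead
  \<open>u\<close> obtains a value in the preceding layer as well, and the whole chain through
  \<open>u\<close> is closed.\<close>

lemma add_successor:
  assumes k: "circle_state k" and v: "v \<in> Range (k i)"
  obtains k' where "circle_state k'" "extends k k'" "g v \<in> Range (k' i)"
proof -
  obtain u where u: "(u, v) \<in> k i" using v by blast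
  obtain p where p: "nxt p = i" using nxt_cycle by blast
  obtain k1 where k1: "circle_state k1" "extends k k1" "\<sigma> p u \<in> Domain (k1 p)"
    by (rule add_domain[OF k])
  obtain v' where v': "(\<sigma> p u, v') \<in> k1 p" using k1(3) by blast
  obtain k2 q where k2: "circle_state k2" "extends k1 k2" "closed_chain k2 q" "q i = u"
    by (rule complete_chain[OF k1(1) p extendsD[OF k1(2) u] v'])
  obtain e where e: "(u, e) \<in> k2 i" "g e \<in> Range (k2 i)"
    using k2(3,4) unfolding closed_chain_def link_def by blast
  have "(u, v) \<in> k2 i" using extendsD[OF k2(2)] extendsD[OF k1(2) u] .
  then have "e = v" using partial_iso_eq_iff[OF circle_stateD(2)[OF k2(1)] e(1)] by blast
  then show ?thesis using that k2(1) extends_trans[OF k1(2) k2(2)] e(2) by blast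
qed

lemma add_predecessor:
  assumes k: "circle_state k" and v: "g v \<in> Range (k i)"
  obtains k' where "circle_state k'" "extends k k'" "v \<in> Range (k' i)"
proof -
  obtain a where a: "(a, g v) \<in> k i" using v by blast
  define u where "u = inverse_fun (\<sigma> i) a"
  have u: "\<sigma> i u = a" using \<sigma> by (simp add: u_def)
  obtain k1 where k1: "circle_state k1" "extends k k1" "u \<in> Domain (k1 (nxt i))"
    by (rule add_domain[OF k])
  obtain v' where v': "(u, v') \<in> k1 (nxt i)" using k1(3) by blast
  have a1: "(\<sigma> i u, g v) \<in> k1 i" using extendsD[OF k1(2) a] u by simp
  obtain k2 q where k2: "circle_state k2" "extends k1 k2" "closed_chain k2 q" "q (nxt i) = u"
    by (rule complete_chain[OF k1(1) refl v' a1])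
  obtain e where e: "e \<in> Range (k2 i)" "(\<sigma> i u, g e) \<in> k2 i"
    using k2(3,4) unfolding closed_chain_def link_def by blast
  have "g e = g v"
    using partial_iso_eq_iff[OF circle_stateD(2)[OF k2(1)] e(2) extendsD[OF k2(2) a1]] by blast
  then show ?thesis using that k2(1) extends_trans[OF k1(2) k2(2)] e(1) g_aut by simp
qed

text \<open>A value in a new orbit creates no link. If the orbit of \<open>w\<close> meets the
  range, then \<open>w\<close> is reached from an old value in finitely many steps along the
  orbit.\<close>

lemma add_range:
  assumes k: "circle_state k"
  obtains k' where "circle_state k'" "extends k k'" "w \<in> Range (k' i)"
proof (cases "orbit_avoids w (Range (k i))")
  case True
  obtain z where "partial_iso (insert (z, w) (k i))"
    by (rule extend_range[OF dense_pred_True circle_stateD(2,1)[OF k] finite.emptyI orbit_avoidsD(1)[OF True]])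
  then have "circle_state (k(i := insert (z, w) (k i)))"
    using circle_add_fresh[OF k _ True] by blast
  then show ?thesis by (rule that) (auto simp: extends_def)
next
  case False
  have forward: "\<exists>k'. circle_state k' \<and> extends k k' \<and> (g ^^ m) e \<in> Range (k' i)"
    if "e \<in> Range (k i)" for e m
  proof (induction m)
    case 0
    then show ?case using k that extends_refl by auto
  next
    case (Suc m)
    then obtain k1 where k1: "circle_state k1" "extends k k1" "(g ^^ m) e \<in> Range (k1 i)" by blast
    obtain k2 where "circle_state k2" "extends k1 k2" "g ((g ^^ m) e) \<in> Range (k2 i)"
      by (rule add_successor[OF k1(1,3)])
    then show ?case using extends_trans[OF k1(2)] by auto
  qed
  have backward: "\<exists>k'. circle_state k' \<and> extends k k' \<and> w \<in> Range (k' i)"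
    if "(g ^^ m) w \<in> Range (k i)" for w m
    using that
  proof (induction m arbitrary: w)
    case 0
    then show ?case using k extends_refl by auto
  next
    case (Suc m)
    then have "(g ^^ m) (g w) \<in> Range (k i)" by (simp add: funpow_swap1)
    then obtain k1 where k1: "circle_state k1" "extends k k1" "g w \<in> Range (k1 i)"
      using Suc.IH by blast
    obtain k2 where "circle_state k2" "extends k1 k2" "w \<in> Range (k2 i)"
      by (rule add_predecessor[OF k1(1,3)])
    then show ?case using extends_trans[OF k1(2)] by auto
  qed
  obtain e m where "e \<in> Range (k i)" "(g ^^ m) w = e \<or> (g ^^ m) e = w"
    using False by (auto simp: orbit_avoids_def)
  then show ?thesis using that forward[of e m] backward[of m w] by blast
qed

lemma closed_circle:
  obtains K where "\<And>i. aut (K i)"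
    "\<And>x. \<exists>q. q L0 = x \<and> (\<forall>i. K i (\<sigma> i (q (nxt i))) = g (K i (q i)))"
proof -
  let ?req = "\<lambda>(i, x) k. x \<in> Domain (k i) \<and> x \<in> Range (k i)"
  have step: "\<exists>k'. circle_state k' \<and> extends k k' \<and> ?req r k'" if k: "circle_state k" for k r
  proof -
    obtain i x where r: "r = (i, x)" by force
    obtain k1 where k1: "circle_state k1" "extends k k1" "x \<in> Domain (k1 i)"
      by (rule add_domain[OF k])
    obtain k2 where k2: "circle_state k2" "extends k1 k2" "x \<in> Range (k2 i)"
      by (rule add_range[OF k1(1)])
    have "x \<in> Domain (k2 i)" using k1(3) extendsD[OF k2(2)] by blast
    then show ?thesis using k2 extends_trans[OF k1(2) k2(2)] r by auto
  qed
  have "\<exists>st. st 0 = (\<lambda>i. {}) \<and> (\<forall>n. circle_state (st n)) \<and>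
    (\<forall>m n. m \<le> n \<longrightarrow> extends (st m) (st n)) \<and> (\<forall>r. \<exists>n::nat. ?req r (st n))"
  proof (rule back_and_forth_chain[OF _ step extends_refl extends_trans])
    show "circle_state (\<lambda>i. {})" by (simp add: circle_state_def link_def orbit_convex_def)
  qed
  then obtain st :: "nat \<Rightarrow> layer \<Rightarrow> ('a \<times> 'a) set" where st: "\<And>n. circle_state (st n)"
    "\<And>m n. m \<le> n \<Longrightarrow> extends (st m) (st n)" "\<And>r. \<exists>n. ?req r (st n)" by blast
  have "\<exists>f. aut f \<and> (\<forall>x y. (x, y) \<in> (\<Union>n. st n i) \<longleftrightarrow> f x = y)" for i
  proof -
    have "partial_iso (\<Union>n. st n i)"
      by (rule partial_iso_Union) (use circle_stateD(2)[OF st(1)] st(2) in \<open>auto simp: extends_def\<close>)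
    moreover have "x \<in> Domain (\<Union>n. st n i) \<and> x \<in> Range (\<Union>n. st n i)" for x
    proof -
      obtain n where "x \<in> Domain (st n i)" "x \<in> Range (st n i)" using st(3)[of "(i, x)"] by auto
      then show ?thesis by blast
    qed
    then have "Domain (\<Union>n. st n i) = UNIV" "Range (\<Union>n. st n i) = UNIV" by blast+
    ultimately obtain f where "aut f" "\<And>x y. (x, y) \<in> (\<Union>n. st n i) \<longleftrightarrow> f x = y"
      by (rule total_partial_iso) blast
    then show ?thesis by blast
  qed
  then obtain K where K: "\<And>i. aut (K i)" "\<And>i x y. (x, y) \<in> (\<Union>n. st n i) \<longleftrightarrow> K i x = y"
    by metis
  have "\<exists>q. q L0 = x \<and> (\<forall>i. K i (\<sigma> i (q (nxt i))) = g (K i (q i)))" for x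
  proof -
    \<comment> \<open>The point that follows \<open>x\<close> in the limit. Two pairs witness this
      link, so it is present at a finite stage, where the invariant provides the rest of the
      chain.\<close>
    define x' where "x' = inverse_fun (\<sigma> L0) (inverse_fun (K L0) (g (K L0 x)))"
    have "K L0 (\<sigma> L0 x') = g (K L0 x)" using K(1) \<sigma> by (simp add: x'_def)
    then obtain m n where "(x, K L0 x) \<in> st m L0" "(\<sigma> L0 x', g (K L0 x)) \<in> st n L0" using K(2) by blast
    then have "(x, K L0 x) \<in> st (max m n) L0" "(\<sigma> L0 x', g (K L0 x)) \<in> st (max m n) L0"
      using extendsD[OF st(2)] by (meson max.cobounded1, meson max.cobounded2)
    then have "(x, x') \<in> link L0 (st (max m n) L0)" by (auto simp: link_def)
    then obtain q where q: "closed_chain (st (max m n)) q" "q L0 = x"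
      using circle_stateD(4)[OF st(1)] by blast
    have "K i (\<sigma> i (q (nxt i))) = g (K i (q i))" for i
    proof -
      obtain e where "(q i, e) \<in> st (max m n) i" "(\<sigma> i (q (nxt i)), g e) \<in> st (max m n) i"
        using q(1) unfolding closed_chain_def link_def by blast
      then have "K i (q i) = e" "K i (\<sigma> i (q (nxt i))) = g e" using K(2) by blast+
      then show ?thesis by simp
    qed
    then show ?thesis using q(2) by blast
  qed
  then show ?thesis using that K(1) by blast
qed

end

section \<open>Generation by conjugates\<close>

context generic_structure
begin

text \<open>With \<open>\<sigma>\<close> equal to \<open>h\<close> at the last layer and trivial
  elsewhere, closing the circle at \<open>x\<close> says that five conjugates applied in turn lead
  from \<open>x\<close> to \<open>h x\<close>.\<close>

lemma product_of_conjugates: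
  assumes g: "free_aut g" and h: "aut h"
  obtains K where "\<And>i. aut (K i)"
    "h = (inverse_fun (K L4) \<circ> g \<circ> K L4) \<circ> (inverse_fun (K L3) \<circ> g \<circ> K L3) \<circ>
      (inverse_fun (K L2) \<circ> g \<circ> K L2) \<circ> (inverse_fun (K L1) \<circ> g \<circ> K L1) \<circ>
      (inverse_fun (K L0) \<circ> g \<circ> K L0)"
proof -
  define \<sigma> where "\<sigma> i = (if i = L4 then h else id)" for i
  interpret conjugate_circle P c g \<sigma>
    by unfold_locales (use g h in \<open>auto simp: \<sigma>_def\<close>)
  obtain K where K: "\<And>i. aut (K i)"
    "\<And>x. \<exists>q. q L0 = x \<and> (\<forall>i. K i (\<sigma> i (q (nxt i))) = g (K i (q i)))"
    by (rule closed_circle) blast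
  have "h x = ((inverse_fun (K L4) \<circ> g \<circ> K L4) \<circ> (inverse_fun (K L3) \<circ> g \<circ> K L3) \<circ>
      (inverse_fun (K L2) \<circ> g \<circ> K L2) \<circ> (inverse_fun (K L1) \<circ> g \<circ> K L1) \<circ>
      (inverse_fun (K L0) \<circ> g \<circ> K L0)) x" for x
  proof -
    obtain q where q: "q L0 = x" "\<And>i. K i (\<sigma> i (q (nxt i))) = g (K i (q i))" using K(2) by blast
    have "\<sigma> i (q (nxt i)) = inverse_fun (K i) (g (K i (q i)))" for i
      using q(2)[of i] K(1) by (metis aut_inv_f)
    from this[of L0] this[of L1] this[of L2] this[of L3] this[of L4] q(1)
    show ?thesis by (simp add: \<sigma>_def)
  qed
  then show ?thesis using that K(1) by blast
qed

text \<open>The commutator lies in \<open>N\<close> as the product of the inverse of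
  \<open>g\<close> and a conjugate of \<open>g\<close>; the five conjugates of it then give
  \<open>h\<close>.\<close>

lemma normal_generation:
  assumes g: "aut g" "g \<noteq> id" "g \<in> N"
    and comp: "\<And>a b. a \<in> N \<Longrightarrow> b \<in> N \<Longrightarrow> a \<circ> b \<in> N"
    and inv: "\<And>a. a \<in> N \<Longrightarrow> inverse_fun a \<in> N"
    and conj: "\<And>a k. a \<in> N \<Longrightarrow> aut k \<Longrightarrow> inverse_fun k \<circ> a \<circ> k \<in> N"
    and h: "aut h"
  shows "h \<in> N"
proof -
  obtain f where f: "aut f" "free_aut (inverse_fun g \<circ> inverse_fun f \<circ> g \<circ> f)"
    by (rule free_commutator[OF g(1,2)])
  define w where "w = inverse_fun g \<circ> inverse_fun f \<circ> g \<circ> f"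
  have "inverse_fun g \<circ> (inverse_fun f \<circ> g \<circ> f) \<in> N"
    by (intro comp inv conj g f)
  then have w: "w \<in> N" by (simp add: w_def comp_assoc)
  obtain K where K: "\<And>i. aut (K i)" and hK: "h = (inverse_fun (K L4) \<circ> w \<circ> K L4) \<circ>
      (inverse_fun (K L3) \<circ> w \<circ> K L3) \<circ> (inverse_fun (K L2) \<circ> w \<circ> K L2) \<circ>
      (inverse_fun (K L1) \<circ> w \<circ> K L1) \<circ> (inverse_fun (K L0) \<circ> w \<circ> K L0)"
    by (rule product_of_conjugates[OF f(2)[folded w_def] h]) blast
  show ?thesis unfolding hK by (intro comp conj w K)
qed

end

section \<open>Forbidden triangles and amalgamation\<close>

definition lab :: "'x lstruct \<Rightarrow> 'x \<Rightarrow> 'x \<Rightarrow> sym option" where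
  "lab A x y = (if x = y then None else Some (edge A x y))"

lemma lab_self [simp]: "lab A x x = None"
  by (simp add: lab_def)

lemma lab_None: "lab A x y = None \<longleftrightarrow> x = y"
  by (simp add: lab_def)

lemma lab_eq_Some_iff:
  assumes A: "complete_struct A" and xy: "x \<in> carrier A" "y \<in> carrier A"
  shows "lab A x y = Some X \<longleftrightarrow> rel A X x y"
proof (cases "x = y")
  case True
  then show ?thesis using A xy by (auto simp: complete_struct_def lstructure_def)
next
  case False
  then have ex: "\<exists>!X. rel A X x y" using A xy by (simp add: complete_struct_def)
  then have "rel A (edge A x y) x y" unfolding edge_def by (rule theI')
  then show ?thesis using False ex by (auto simp: lab_def)
qed

lemma lab_opp:
  assumes A: "complete_struct A" and xy: "x \<in> carrier A" "y \<in> carrier A"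
  shows "lab A y x = opp (lab A x y)"
proof (cases "lab A x y")
  case None
  then show ?thesis by (auto simp: lab_def split: if_splits)
next
  case (Some X)
  then have "rel A X x y" using lab_eq_Some_iff[OF A xy] by simp
  then have "rel A (conv X) y x"
    using A xy by (metis complete_struct_def lstructure_def)
  then show ?thesis using Some lab_eq_Some_iff[OF A xy(2,1)] by simp
qed

lemma conv_neq [simp]: "conv X \<noteq> X" "X \<noteq> conv X"
  by (cases X; simp)+

lemma complete_struct_from_labels:
  assumes rel: "\<And>X x y. x \<in> carrier A \<Longrightarrow> y \<in> carrier A \<Longrightarrow> rel A X x y \<longleftrightarrow> L x y = Some X"
    and L: "\<And>x y. x \<in> carrier A \<Longrightarrow> y \<in> carrier A \<Longrightarrow> L x y = None \<longleftrightarrow> x = y"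
    "\<And>x y. x \<in> carrier A \<Longrightarrow> y \<in> carrier A \<Longrightarrow> L y x = opp (L x y)"
  shows "complete_struct A" "\<And>x y. x \<in> carrier A \<Longrightarrow> y \<in> carrier A \<Longrightarrow> lab A x y = L x y"
proof -
  have "lstructure A"
    unfolding lstructure_def
  proof (intro conjI ballI allI impI)
    show "\<not> rel A X a a" if "a \<in> carrier A" for a X
      using rel[OF that that] L(1)[OF that that] by simp
    show "\<not> rel A X b a" if "a \<in> carrier A" "b \<in> carrier A" "rel A X a b" for a b X
      using that rel[of a b X] rel[of b a X] L(2)[of a b] by simp
    show "rel A X a b \<longleftrightarrow> rel A (conv X) b a" if "a \<in> carrier A" "b \<in> carrier A" for a b X
      using that rel[of a b X] rel[of b a "conv X"] L(2)[of a b] by (cases "L a b") auto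
  qed
  moreover have "\<exists>!X. rel A X a b" if "a \<in> carrier A" "b \<in> carrier A" "a \<noteq> b" for a b
    using that rel[of a b] L(1)[of a b] by (cases "L a b") auto
  ultimately show A: "complete_struct A" by (simp add: complete_struct_def)
  show "lab A x y = L x y" if "x \<in> carrier A" "y \<in> carrier A" for x y
  proof (cases "L x y")
    case None
    then show ?thesis using L(1)[OF that] by simp
  next
    case (Some X)
    then show ?thesis using rel[OF that] lab_eq_Some_iff[OF A that] by simp
  qed
qed

lemma rel_triangle: "rel (triangle X Y Z) W i j \<longleftrightarrow>
    i = 0 \<and> j = 1 \<and> W = X \<or> i = 1 \<and> j = 0 \<and> W = conv X \<or> i = 0 \<and> j = 2 \<and> W = Y \<or>
    i = 2 \<and> j = 0 \<and> W = conv Y \<or> i = 1 \<and> j = 2 \<and> W = Z \<or> i = 2 \<and> j = 1 \<and> W = conv Z"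
  by (auto simp: triangle_def)

lemma carrier_triangle [simp]: "carrier (triangle X Y Z) = {0, 1, 2}"
  by (simp add: triangle_def)

lemma triangle_labels:
  shows complete_triangle: "complete_struct (triangle X Y Z)"
    and "lab (triangle X Y Z) 0 1 = Some X" "lab (triangle X Y Z) 0 2 = Some Y"
    "lab (triangle X Y Z) 1 2 = Some Z"
proof -
  define L where "L i j = (if i = j then None else if i = 0 \<and> j = (1::nat) then Some X
    else if i = 1 \<and> j = (0::nat) then Some (conv X) else if i = 0 \<and> j = 2 then Some Y
    else if i = 2 \<and> j = 0 then Some (conv Y) else if i = 1 \<and> j = 2 then Some Z
    else Some (conv Z))" for i j
  have L: "rel (triangle X Y Z) W i j \<longleftrightarrow> L i j = Some W"
    "L i j = None \<longleftrightarrow> i = j" "L j i = opp (L i j)"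
    if "i \<in> carrier (triangle X Y Z)" "j \<in> carrier (triangle X Y Z)" for W i j
    using that by (auto simp: rel_triangle L_def)
  show "complete_struct (triangle X Y Z)" by (rule complete_struct_from_labels(1)) (fact L)+
  have "lab (triangle X Y Z) i j = L i j" if "i \<in> {0, 1, 2}" "j \<in> {0, 1, 2}" for i j
    by (rule complete_struct_from_labels(2)[OF L]) (use that in auto)
  then show "lab (triangle X Y Z) 0 1 = Some X" "lab (triangle X Y Z) 0 2 = Some Y"
    "lab (triangle X Y Z) 1 2 = Some Z" by (simp_all add: L_def)
qed

lemma embeds_triangle_iff:
  assumes A: "complete_struct A"
  shows "embeds (triangle X Y Z) A \<longleftrightarrow> (\<exists>x\<in>carrier A. \<exists>y\<in>carrier A. \<exists>z\<in>carrier A.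
    lab A x y = Some X \<and> lab A x z = Some Y \<and> lab A y z = Some Z)"
proof
  assume "embeds (triangle X Y Z) A"
  then obtain f where f: "embedding f (triangle X Y Z) A" by (auto simp: embeds_def)
  then have mem: "f 0 \<in> carrier A" "f 1 \<in> carrier A" "f 2 \<in> carrier A"
    by (auto simp: embedding_def)
  have "rel A X (f 0) (f 1)" "rel A Y (f 0) (f 2)" "rel A Z (f 1) (f 2)"
    using f by (auto simp: embedding_def rel_triangle)
  then show "\<exists>x\<in>carrier A. \<exists>y\<in>carrier A. \<exists>z\<in>carrier A.
    lab A x y = Some X \<and> lab A x z = Some Y \<and> lab A y z = Some Z"
    using mem
    by (rule_tac bexI[of _ "f 0"], rule_tac bexI[of _ "f 1"], rule_tac bexI[of _ "f 2"])
      (simp_all add: lab_eq_Some_iff[OF A])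
next
  assume "\<exists>x\<in>carrier A. \<exists>y\<in>carrier A. \<exists>z\<in>carrier A.
    lab A x y = Some X \<and> lab A x z = Some Y \<and> lab A y z = Some Z"
  then obtain x y z where xyz: "x \<in> carrier A" "y \<in> carrier A" "z \<in> carrier A"
    and l: "lab A x y = Some X" "lab A x z = Some Y" "lab A y z = Some Z" by blast
  define f where "f i = (if i = 0 then x else if i = (1::nat) then y else z)" for i
  have dist: "x \<noteq> y" "x \<noteq> z" "y \<noteq> z" using l by auto
  have l': "lab A y x = Some (conv X)" "lab A z x = Some (conv Y)" "lab A z y = Some (conv Z)"
    using l lab_opp[OF A xyz(1,2)] lab_opp[OF A xyz(1,3)] lab_opp[OF A xyz(2,3)] by simp_all
  have "embedding f (triangle X Y Z) A"
    unfolding embedding_def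
  proof (intro conjI allI ballI)
    show "inj_on f (carrier (triangle X Y Z))" using dist by (auto simp: f_def inj_on_def)
    show "f ` carrier (triangle X Y Z) \<subseteq> carrier A" using xyz by (auto simp: f_def)
    fix W i j assume "i \<in> carrier (triangle X Y Z)" "j \<in> carrier (triangle X Y Z)"
    then show "rel (triangle X Y Z) W i j \<longleftrightarrow> rel A W (f i) (f j)"
      using l l' xyz by (auto simp: rel_triangle f_def lab_eq_Some_iff[OF A, symmetric])
  qed
  then show "embeds (triangle X Y Z) A" by (auto simp: embeds_def)
qed

text \<open>An embedding between three-point structures is onto, and its inverse is an embedding in
  the other direction. In this form a triangle can be treated as a structure that avoids other
  triangles.\<close>

lemma isomorphic_triangle_iff:
  "isomorphic (triangle X Y Z) (triangle X' Y' Z') \<longleftrightarrow> embeds (triangle X' Y' Z') (triangle X Y Z)"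
proof
  let ?T = "triangle X Y Z" and ?T' = "triangle X' Y' Z'"
  {
    assume "isomorphic ?T ?T'"
    then obtain f where f: "embedding f ?T ?T'" "f ` carrier ?T = carrier ?T'"
      by (auto simp: isomorphic_def isomorphism_def)
    define h where "h = inv_into (carrier ?T) f"
    have h: "h i \<in> carrier ?T" "f (h i) = i" if "i \<in> carrier ?T'" for i
      using that f(2) unfolding h_def by (metis inv_into_into, metis f_inv_into_f)
    have "embedding h ?T' ?T"
      unfolding embedding_def
    proof (intro conjI allI ballI)
      show "inj_on h (carrier ?T')" by (metis h(2) inj_onI)
      show "h ` carrier ?T' \<subseteq> carrier ?T" using h(1) by blast
      show "rel ?T' W i j \<longleftrightarrow> rel ?T W (h i) (h j)" if "i \<in> carrier ?T'" "j \<in> carrier ?T'" for W i j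
        using f(1) h[OF that(1)] h[OF that(2)] unfolding embedding_def by metis
    qed
    then show "embeds ?T' ?T" by (auto simp: embeds_def)
  next
    assume "embeds ?T' ?T"
    then obtain f where f: "embedding f ?T' ?T" by (auto simp: embeds_def)
    have onto: "f ` carrier ?T' = carrier ?T"
    proof -
      have "f ` {0, 1, 2} \<subseteq> {0, 1, 2}" "inj_on f {0, 1, 2}"
        using f by (simp_all add: embedding_def)
      then show ?thesis using endo_inj_surj[of "{0, 1, 2}" f] by simp
    qed
    define h where "h = inv_into (carrier ?T') f"
    have h: "h i \<in> carrier ?T'" "f (h i) = i" if "i \<in> carrier ?T" for i
      using that onto unfolding h_def by (metis inv_into_into, metis f_inv_into_f)
    have "embedding h ?T ?T'"
      unfolding embedding_def
    proof (intro conjI allI ballI)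
      show "inj_on h (carrier ?T)" by (metis h(2) inj_onI)
      show "h ` carrier ?T \<subseteq> carrier ?T'" using h(1) by blast
      show "rel ?T W i j \<longleftrightarrow> rel ?T' W (h i) (h j)" if "i \<in> carrier ?T" "j \<in> carrier ?T" for W i j
        using f h[OF that(1)] h[OF that(2)] unfolding embedding_def by metis
    qed
    moreover have "h ` carrier ?T = carrier ?T'"
    proof -
      have "h (f i) = i" if "i \<in> carrier ?T'" for i
        using f that unfolding h_def embedding_def by (meson inv_into_f_f)
      then have "carrier ?T' \<subseteq> h ` carrier ?T" using onto by (metis imageI subsetI)
      moreover have "h ` carrier ?T \<subseteq> carrier ?T'" using h(1) by blast
      ultimately show ?thesis by blast
    qed
    ultimately show "isomorphic ?T ?T'" by (auto simp: isomorphic_def isomorphism_def)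
  }
qed

section \<open>The path rule as a set of forbidden triangles\<close>

context path_rule
begin

text \<open>One triangle \<open>Gp V Gp\<close> for each label \<open>V\<close> outside
  \<open>P\<close>. For \<open>V = Rm\<close> it is the directed cycle with one
  \<open>R\<close>-edge, listed as \<open>Rp Gm Gp\<close> after renaming its points.\<close>

definition forbidden :: "nat lstruct set" where
  "forbidden = {triangle Rp Gm Gp} \<union> (if Gm \<in> P then {} else {triangle Gp Gm Gp}) \<union>
     (if Gp \<in> P then {} else {triangle Gp Gp Gp})"

text \<open>The six conjuncts of \<open>tri\<close> are a single rule for the six orderings of three
  points; quantified over all points, the first one gives the others.\<close>

lemma structure_on_lab_iff:
  assumes A: "complete_struct A"
  shows "structure_on (carrier A) (lab A) \<longleftrightarrow> (\<forall>x\<in>carrier A. \<forall>y\<in>carrier A. \<forall>z\<in>carrier A.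
    lab A x y = Some Gp \<and> lab A y z = Some Gp \<longrightarrow> perm (lab A x z))" (is "_ \<longleftrightarrow> ?path")
proof
  assume s: "structure_on (carrier A) (lab A)"
  show ?path
    using structure_onD(3)[OF s] unfolding tri_def by blast
next
  assume path: ?path
  have path': "perm (lab A x z)"
    if "x \<in> carrier A" "y \<in> carrier A" "z \<in> carrier A" "lab A x y = Some Gp" "lab A y z = Some Gp" for x y z
    using path that by blast
  show "structure_on (carrier A) (lab A)"
    unfolding structure_on_def
  proof (intro ballI conjI)
    fix x y assume xy: "x \<in> carrier A" "y \<in> carrier A"
    show "lab A x y = None \<longleftrightarrow> x = y" by (simp add: lab_def)
    show "lab A y x = opp (lab A x y)" by (rule lab_opp[OF A xy])
    fix z assume z: "z \<in> carrier A"
    have o: "opp (lab A x y) = lab A y x" "opp (lab A x z) = lab A z x" "opp (lab A y z) = lab A z y"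
      using lab_opp[OF A xy] lab_opp[OF A xy(1) z] lab_opp[OF A xy(2) z] by metis+
    have G: "lab A u v = Some Gm \<longleftrightarrow> lab A v u = Some Gp" if "u \<in> {x, y, z}" "v \<in> {x, y, z}" for u v
    proof -
      have "u \<in> carrier A" "v \<in> carrier A" using that xy z by auto
      then show ?thesis using lab_opp[OF A, of u v] by simp
    qed
    show "tri (lab A x y) (lab A x z) (lab A y z)"
      unfolding tri_def o using path' xy z G by simp
  qed
qed

lemma avoids_forbidden_iff:
  assumes A: "complete_struct A"
  shows "(\<forall>T\<in>forbidden. \<not> embeds T A) \<longleftrightarrow> structure_on (carrier A) (lab A)"
proof -
  let ?path = "\<lambda>V. \<exists>x\<in>carrier A. \<exists>y\<in>carrier A. \<exists>z\<in>carrier A.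
    lab A x y = Some Gp \<and> lab A y z = Some Gp \<and> lab A x z = Some V"
  have G: "embeds (triangle Gp V Gp) A \<longleftrightarrow> ?path V" for V
    unfolding embeds_triangle_iff[OF A] by blast
  have o: "lab A y x = opp (lab A x y)" if "x \<in> carrier A" "y \<in> carrier A" for x y
    by (rule lab_opp[OF A that])
  have R: "embeds (triangle Rp Gm Gp) A \<longleftrightarrow> ?path Rm"
    unfolding embeds_triangle_iff[OF A]
  proof
    assume "\<exists>x\<in>carrier A. \<exists>y\<in>carrier A. \<exists>z\<in>carrier A.
      lab A x y = Some Rp \<and> lab A x z = Some Gm \<and> lab A y z = Some Gp"
    then obtain x y z where *: "x \<in> carrier A" "y \<in> carrier A" "z \<in> carrier A"
      "lab A x y = Some Rp" "lab A x z = Some Gm" "lab A y z = Some Gp" by blast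
    then have "lab A y x = Some Rm" "lab A z x = Some Gp" using o[OF *(1,2)] o[OF *(1,3)] by simp_all
    then show "?path Rm" using * by blast
  next
    assume "?path Rm"
    then obtain x y z where *: "x \<in> carrier A" "y \<in> carrier A" "z \<in> carrier A"
      "lab A x y = Some Gp" "lab A y z = Some Gp" "lab A x z = Some Rm" by blast
    then have "lab A z x = Some Rp" "lab A z y = Some Gm" using o[OF *(1,3)] o[OF *(2,3)] by simp_all
    then show "\<exists>x\<in>carrier A. \<exists>y\<in>carrier A. \<exists>z\<in>carrier A.
      lab A x y = Some Rp \<and> lab A x z = Some Gm \<and> lab A y z = Some Gp" using * by blast
  qed
  have "(\<forall>T\<in>forbidden. \<not> embeds T A) \<longleftrightarrow> (\<forall>V. V \<notin> P \<longrightarrow> \<not> ?path V)"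
  proof -
    have all: "(\<forall>V. B V) \<longleftrightarrow> B Rp \<and> B Rm \<and> B Gp \<and> B Gm" for B
      by (metis sym.exhaust)
    have "(\<forall>V. V \<notin> P \<longrightarrow> \<not> ?path V) \<longleftrightarrow>
        \<not> ?path Rm \<and> (Gp \<notin> P \<longrightarrow> \<not> ?path Gp) \<and> (Gm \<notin> P \<longrightarrow> \<not> ?path Gm)"
      unfolding all using Rp_P Rm_P by blast
    also have "\<dots> \<longleftrightarrow> (\<forall>T\<in>forbidden. \<not> embeds T A)"
      unfolding R[symmetric] G[symmetric] forbidden_def by auto
    finally show ?thesis by blast
  qed
  also have "\<dots> \<longleftrightarrow> (\<forall>x\<in>carrier A. \<forall>y\<in>carrier A. \<forall>z\<in>carrier A.
    lab A x y = Some Gp \<and> lab A y z = Some Gp \<longrightarrow> perm (lab A x z))" (is "?l \<longleftrightarrow> ?r")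
  proof
    assume l: ?l
    show ?r
    proof (intro ballI impI)
      fix x y z assume *: "x \<in> carrier A" "y \<in> carrier A" "z \<in> carrier A"
        "lab A x y = Some Gp \<and> lab A y z = Some Gp"
      have "x \<noteq> z" using * o[of x y] by auto
      then obtain V where V: "lab A x z = Some V" by (auto simp: lab_def)
      then have "V \<in> P" using l * by blast
      then show "perm (lab A x z)" using V by (simp add: perm_def)
    qed
  next
    assume ?r
    then show ?l by (auto simp: perm_def) force
  qed
  also have "\<dots> \<longleftrightarrow> structure_on (carrier A) (lab A)" using structure_on_lab_iff[OF A] by blast
  finally show ?thesis .
qed

lemma Forb_c_iff:
  "A \<in> Forb_c forbidden \<longleftrightarrow>
     finite (carrier A) \<and> complete_struct A \<and> structure_on (carrier A) (lab A)"
  unfolding Forb_c_def using avoids_forbidden_iff by blast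

text \<open>The test that \<open>new_edge\<close> applies to a colour, turned into a condition on
  labels.\<close>

lemma isomorphic_forbidden_iff:
  "(\<forall>T\<in>forbidden. \<not> isomorphic (triangle X Y Z) T) \<longleftrightarrow> tri (Some X) (Some Y) (Some Z)"
proof -
  let ?T = "triangle X Y Z"
  have "(\<forall>T\<in>forbidden. \<not> isomorphic ?T T) \<longleftrightarrow> (\<forall>T\<in>forbidden. \<not> embeds T ?T)"
    by (simp add: forbidden_def isomorphic_triangle_iff)
  also have "\<dots> \<longleftrightarrow> structure_on {0, 1, 2} (lab ?T)"
    using avoids_forbidden_iff[OF complete_triangle] by simp
  also have "\<dots> \<longleftrightarrow> tri (Some X) (Some Y) (Some Z)"
  proof
    assume s: "structure_on {0, 1, 2} (lab ?T)"
    show "tri (Some X) (Some Y) (Some Z)"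
      using structure_onD(3)[OF s, of 0 1 2] unfolding triangle_labels(2-4) by simp
  next
    assume tri: "tri (Some X) (Some Y) (Some Z)"
    have lab: "lab ?T 1 0 = Some (conv X)" "lab ?T 2 0 = Some (conv Y)" "lab ?T 2 1 = Some (conv Z)"
      using lab_opp[OF complete_triangle, of 0 X Y Z 1] lab_opp[OF complete_triangle, of 0 X Y Z 2]
        lab_opp[OF complete_triangle, of 1 X Y Z 2]
      unfolding triangle_labels(2-4) by simp_all
    note o = lab[folded opp.simps(2), folded triangle_labels(2-4)[of X Y Z]]
    have t1: "tri (lab ?T 0 1) (lab ?T 0 2) (lab ?T 1 2)"
      unfolding triangle_labels(2-4) by (rule tri)
    have t2: "tri (lab ?T 0 2) (lab ?T 0 1) (lab ?T 2 1)" unfolding o by (rule tri_swap[OF t1])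
    have t3: "tri (lab ?T 1 2) (lab ?T 1 0) (lab ?T 2 0)" unfolding o by (rule tri_rotate[OF t1])
    have t4: "tri (lab ?T 2 1) (lab ?T 2 0) (lab ?T 1 0)" unfolding o by (rule tri_rotate[OF t2, unfolded o])
    have t5: "tri (lab ?T 1 0) (lab ?T 1 2) (lab ?T 0 2)"
      using tri_swap[OF t3] unfolding o opp_opp .
    have t6: "tri (lab ?T 2 0) (lab ?T 2 1) (lab ?T 0 1)"
      using tri_swap[OF t4] unfolding o opp_opp .
    have t: "tri (lab ?T x y) (lab ?T x z) (lab ?T y z)"
      if "x \<in> {0, 1, 2}" "y \<in> {0, 1, 2}" "z \<in> {0, 1, 2}" "x \<noteq> y" "x \<noteq> z" "y \<noteq> z" for x y z
    proof -
      have "(x, y, z) \<in> {(0, 1, 2), (0, 2, 1), (1, 2, 0), (2, 1, 0), (1, 0, 2), (2, 0, 1)}"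
        using that by auto
      then show ?thesis using t1 t2 t3 t4 t5 t6 by auto
    qed
    have "perm (lab ?T x z)" if xyz: "x \<in> {0, 1, 2}" "y \<in> {0, 1, 2}" "z \<in> {0, 1, 2}"
      and G: "lab ?T x y = Some Gp" "lab ?T y z = Some Gp" for x y z
    proof -
      have "x \<noteq> y" "y \<noteq> z" using G by auto
      moreover have "x \<noteq> z"
        using G lab_opp[OF complete_triangle, of x X Y Z y] xyz by auto
      ultimately show ?thesis using t[OF xyz] G unfolding tri_def by blast
    qed
    then show "structure_on {0, 1, 2} (lab ?T)"
      using structure_on_lab_iff[OF complete_triangle, of X Y Z] by auto
  qed
  finally show ?thesis .
qed

section \<open>Prioritised amalgamation\<close>

lemma substruct_lab:
  assumes "complete_struct A" "complete_struct B" "substruct B A" "x \<in> carrier B" "y \<in> carrier B"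
  shows "lab A x y = lab B x y"
proof -
  have "x \<in> carrier A" "y \<in> carrier A" using assms(3-5) by (auto simp: substruct_def)
  then have "lab A x y = Some X \<longleftrightarrow> lab B x y = Some X" for X
    using assms lab_eq_Some_iff[OF assms(1)] lab_eq_Some_iff[OF assms(2,4,5)]
    by (simp add: substruct_def)
  then show ?thesis by (metis option.exhaust)
qed

text \<open>\<open>Rp\<close> fails only because of a \<open>G\<close>-path
  \<open>d \<rightarrow> b \<rightarrow> a\<close>, and \<open>Rm\<close> only because of
  \<open>a \<rightarrow> b' \<rightarrow> d\<close>. Together they form a \<open>G\<close>-cycle
  whose diagonal lies in \<open>B\<close>: the path through \<open>a\<close> permits its label in
  one direction, the path through \<open>d\<close> in the other, against
  \<open>perm_opp\<close>.\<close>

lemma new_edge_R: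
  assumes A: "complete_struct A" "structure_on (carrier A) (lab A)"
    and C: "complete_struct C" "structure_on (carrier C) (lab C)"
    and B: "complete_struct B" "substruct B A" "substruct B C"
    and a: "a \<in> carrier A - carrier B" and d: "d \<in> carrier C - carrier B"
  shows "is_R (new_edge forbidden [Rp, Rm] B A C a d)"
    and "b \<in> carrier B \<Longrightarrow> tri (lab A a b) (new_edge forbidden [Rp, Rm] B A C a d) (lab C b d)"
proof -
  let ?Q = "\<lambda>X. \<forall>b\<in>carrier B. tri (lab A a b) (Some X) (lab C b d)"
  have BA: "b \<in> carrier A" and BC: "b \<in> carrier C" if "b \<in> carrier B" for b
    using B that by (auto simp: substruct_def)
  have lab_edge: "lab A a b = Some (edge A a b)" "lab C b d = Some (edge C b d)" if "b \<in> carrier B" for b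
    using a d that by (auto simp: lab_def)
  have Q: "(\<forall>b\<in>carrier B. \<forall>T\<in>forbidden. \<not> isomorphic (triangle (edge A a b) X (edge C b d)) T) \<longleftrightarrow> ?Q X" for X
    unfolding isomorphic_forbidden_iff using lab_edge by simp
  have "?Q Rp \<or> ?Q Rm"
  proof (rule ccontr)
    assume "\<not> (?Q Rp \<or> ?Q Rm)"
    then obtain b b' where b: "b \<in> carrier B" "\<not> tri (lab A a b) (Some Rp) (lab C b d)"
      and b': "b' \<in> carrier B" "\<not> tri (lab A a b') (Some Rm) (lab C b' d)" by blast
    have G: "lab A a b = Some Gm" "lab C b d = Some Gm" "lab A a b' = Some Gp" "lab C b' d = Some Gp"
      using b(2) b'(2) by (auto simp: tri_def)
    have "perm (lab A b b')"
      using structure_onD(3)[OF A(2) _ BA[OF b(1)] BA[OF b'(1)], of a] a G(1,3) by (simp add: tri_def)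
    moreover have "perm (lab C b' b)"
    proof -
      have "d \<in> carrier C" using d by blast
      then have "lab C d b = Some Gp" using lab_opp[OF C(1) BC[OF b(1)], of d] G(2) by simp
      then show ?thesis
        using structure_onD(3)[OF C(2) BC[OF b'(1)] \<open>d \<in> carrier C\<close> BC[OF b(1)]] G(4) by (simp add: tri_def)
    qed
    moreover have "lab C b' b = opp (lab A b b')"
      using substruct_lab[OF C(1) B(1,3) b'(1) b(1)] substruct_lab[OF A(1) B(1,2) b(1) b'(1)]
        lab_opp[OF B(1) b(1) b'(1)] by simp
    ultimately show False using perm_opp by simp
  qed
  moreover have "new_edge forbidden [Rp, Rm] B A C a d =
      (if ?Q Rp then Some Rp else if ?Q Rm then Some Rm else None)"
    unfolding new_edge_def by (simp add: Q)
  ultimately have n: "new_edge forbidden [Rp, Rm] B A C a d = Some Rp \<and> ?Q Rp \<or>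
      new_edge forbidden [Rp, Rm] B A C a d = Some Rm \<and> ?Q Rm" by argo
  then show "is_R (new_edge forbidden [Rp, Rm] B A C a d)" by (auto simp: is_R_def)
  show "tri (lab A a b) (new_edge forbidden [Rp, Rm] B A C a d) (lab C b d)" if "b \<in> carrier B"
    using n that by auto
qed

text \<open>All new labels are \<open>R\<close>, so a triangle with points on both sides is harmless
  unless its third point lies in \<open>B\<close>, and those triangles are the ones that
  \<open>new_edge\<close> checks.\<close>

lemma amalgam_in_Forb_c:
  assumes A: "A \<in> Forb_c forbidden" and B: "B \<in> Forb_c forbidden" and C: "C \<in> Forb_c forbidden"
    and sub: "substruct B A" "substruct B C"
  shows "amalgam forbidden [Rp, Rm] B A C \<in> Forb_c forbidden"
proof -
  note A' = A[unfolded Forb_c_iff] and B' = B[unfolded Forb_c_iff] and C' = C[unfolded Forb_c_iff]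
  have cA: "complete_struct A" "structure_on (carrier A) (lab A)"
    and cC: "complete_struct C" "structure_on (carrier C) (lab C)" and cB: "complete_struct B"
    using A' B' C' by blast+
  let ?D = "amalgam forbidden [Rp, Rm] B A C"
  define N where "N a d = new_edge forbidden [Rp, Rm] B A C a d" for a d
  have N: "is_R (N a d)" "b \<in> carrier B \<Longrightarrow> tri (lab A a b) (N a d) (lab C b d)"
    if "a \<in> carrier A - carrier B" "d \<in> carrier C - carrier B" for a b d
    using new_edge_R[OF cA cC cB sub that] by (simp_all add: N_def)
  have BA: "b \<in> carrier A" and BC: "b \<in> carrier C" if "b \<in> carrier B" for b
    using sub that by (auto simp: substruct_def)
  have AC: "lab A b b' = lab C b b'" if "b \<in> carrier B" "b' \<in> carrier B" for b b'
    using substruct_lab[OF cA(1) cB sub(1) that] substruct_lab[OF cC(1) cB sub(2) that] by simp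
  define L where "L p q = (case p of
      Inl a \<Rightarrow> (case q of Inl a' \<Rightarrow> lab A a a' | Inr d \<Rightarrow> if a \<in> carrier B then lab C a d else N a d)
    | Inr d \<Rightarrow> (case q of Inr d' \<Rightarrow> lab C d d' | Inl a \<Rightarrow> if a \<in> carrier B then lab C d a else opp (N a d)))" for p q
  have L_simps [simp]: "L (Inl a) (Inl a') = lab A a a'" "L (Inr d) (Inr d') = lab C d d'"
    "L (Inl a) (Inr d) = (if a \<in> carrier B then lab C a d else N a d)"
    "L (Inr d) (Inl a) = (if a \<in> carrier B then lab C d a else opp (N a d))" for a a' d d'
    by (simp_all add: L_def)
  have carrier: "p \<in> carrier ?D \<longleftrightarrow> (\<exists>a\<in>carrier A. p = Inl a) \<or> (\<exists>d\<in>carrier C - carrier B. p = Inr d)" for p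
    by (auto simp: amalgam_def)
  have opp_Some: "opp n = Some X \<longleftrightarrow> n = Some (conv X)" for n X by (cases n) auto
  have rel: "rel ?D X p q \<longleftrightarrow> L p q = Some X" if "p \<in> carrier ?D" "q \<in> carrier ?D" for X p q
    using that unfolding carrier
    by (auto simp: amalgam_def N_def[symmetric] lab_eq_Some_iff[OF cA(1)] lab_eq_Some_iff[OF cC(1)] BC opp_Some)
  have None: "L p q = None \<longleftrightarrow> p = q" if "p \<in> carrier ?D" "q \<in> carrier ?D" for p q
  proof -
    have nn: "N a d \<noteq> None" if "a \<in> carrier A" "a \<notin> carrier B" "d \<in> carrier C - carrier B" for a d
      using N(1)[of a d] that by (metis DiffI is_R_simps(5))
    have mixed: "L (Inl a) (Inr d) \<noteq> None" "L (Inr d) (Inl a) \<noteq> None"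
      if "a \<in> carrier A" "d \<in> carrier C - carrier B" for a d
      using nn[of a d] that by (auto simp: lab_None simp del: not_None_eq)
    from that show ?thesis
      unfolding carrier by (elim disjE bexE) (use mixed in \<open>simp_all add: lab_None del: L_simps(3,4)\<close>)
  qed
  have opp: "L q p = opp (L p q)" if "p \<in> carrier ?D" "q \<in> carrier ?D" for p q
    using that unfolding carrier
  proof (elim disjE bexE)
    show "L q p = opp (L p q)" if "a \<in> carrier A" "p = Inl a" "a' \<in> carrier A" "q = Inl a'" for a a'
      using that lab_opp[OF cA(1) that(1,3)] by simp
    show "L q p = opp (L p q)" if "a \<in> carrier A" "p = Inl a" "d \<in> carrier C - carrier B" "q = Inr d" for a d
      using that lab_opp[OF cC(1) BC[of a], of d] by simp
    show "L q p = opp (L p q)" if "d \<in> carrier C - carrier B" "p = Inr d" "a \<in> carrier A" "q = Inl a" for a d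
      using that lab_opp[OF cC(1) _ BC[of a], of d] by simp
    show "L q p = opp (L p q)" if "d \<in> carrier C - carrier B" "p = Inr d" "d' \<in> carrier C - carrier B" "q = Inr d'" for d d'
      using that lab_opp[OF cC(1), of d d'] by simp
  qed
  have D: "complete_struct ?D" "\<And>p q. p \<in> carrier ?D \<Longrightarrow> q \<in> carrier ?D \<Longrightarrow> lab ?D p q = L p q"
    by (rule complete_struct_from_labels[OF rel None opp]; assumption)+
  have pathA: "perm (lab A x z)" if "x \<in> carrier A" "y \<in> carrier A" "z \<in> carrier A"
    "lab A x y = Some Gp" "lab A y z = Some Gp" for x y z
    using structure_onD(3)[OF cA(2) that(1-3)] that(4,5) by (simp add: tri_def)
  have pathC: "perm (lab C x z)" if "x \<in> carrier C" "y \<in> carrier C" "z \<in> carrier C"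
    "lab C x y = Some Gp" "lab C y z = Some Gp" for x y z
    using structure_onD(3)[OF cC(2) that(1-3)] that(4,5) by (simp add: tri_def)
  have N_not_G: "N a d \<noteq> Some Gp" "N a d \<noteq> Some Gm"
    if "a \<in> carrier A" "a \<notin> carrier B" "d \<in> carrier C" "d \<notin> carrier B" for a d
    using N(1)[of a d] that by auto
  have "perm (L p r)" if pqr: "p \<in> carrier ?D" "q \<in> carrier ?D" "r \<in> carrier ?D"
    and G: "L p q = Some Gp" "L q r = Some Gp" for p q r
  proof -
    let ?in_C = "\<lambda>p x. (p = Inl x \<and> x \<in> carrier B) \<or> (p = Inr x \<and> x \<in> carrier C - carrier B)"
    have L_C: "L p q = lab C x y" if "?in_C p x" "?in_C q y" for p q x y
      using that AC by auto
    have cases: "(\<exists>x. ?in_C p x) \<or> (\<exists>a\<in>carrier A - carrier B. p = Inl a)" if "p \<in> carrier ?D" for p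
      using that unfolding carrier by auto
    have in_C: "x \<in> carrier C" if "?in_C p x" for p x using that BC by auto
    \<comment> \<open>In \<open>p\<close> and \<open>r\<close> the ends of the path lie on different
      sides, and \<open>new_edge\<close> decides if the middle is in \<open>B\<close>. In
      \<open>q\<close> and \<open>q'\<close> a step of the path itself crosses between the sides,
      which its \<open>R\<close>-label excludes.\<close>
    consider (C) x y z where "?in_C p x" "?in_C q y" "?in_C r z"
      | (A) x y z where "p = Inl x" "q = Inl y" "r = Inl z" "x \<in> carrier A" "y \<in> carrier A" "z \<in> carrier A"
      | (p) a d where "p = Inl a" "a \<in> carrier A - carrier B" "r = Inr d" "d \<in> carrier C - carrier B"
      | (r) a d where "r = Inl a" "a \<in> carrier A - carrier B" "p = Inr d" "d \<in> carrier C - carrier B"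
      | (q) a d where "q = Inl a" "a \<in> carrier A - carrier B"
          "p = Inr d \<or> r = Inr d" "d \<in> carrier C - carrier B"
      | (q') a d where "q = Inr d" "d \<in> carrier C - carrier B"
          "p = Inl a \<or> r = Inl a" "a \<in> carrier A - carrier B"
      using cases[OF pqr(1)] cases[OF pqr(2)] cases[OF pqr(3)] BA by blast
    then show ?thesis
    proof cases
      case C
      then have "lab C x y = Some Gp" "lab C y z = Some Gp"
        using L_C[OF C(1,2)] L_C[OF C(2,3)] G by simp_all
      then show ?thesis using pathC[OF in_C[OF C(1)] in_C[OF C(2)] in_C[OF C(3)]] L_C[OF C(1,3)] by simp
    next
      case A
      then show ?thesis using pathA[OF A(4-6)] G by simp
    next
      case p
      from cases[OF pqr(2)] show ?thesis
      proof (elim disjE exE bexE)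
        fix b assume "q = Inl b \<and> b \<in> carrier B"
        then show ?thesis using N(2)[OF p(2,4), of b] G p by (simp add: tri_def)
      next
        fix d' assume "q = Inr d' \<and> d' \<in> carrier C - carrier B"
        then show ?thesis using N_not_G[of a d'] G(1) p by simp
      next
        fix a' assume "a' \<in> carrier A - carrier B" "q = Inl a'"
        then show ?thesis using N_not_G[of a' d] G(2) p by simp
      qed
    next
      case r
      from cases[OF pqr(2)] show ?thesis
      proof (elim disjE exE bexE)
        fix b assume b: "q = Inl b \<and> b \<in> carrier B"
        have "lab A a b = Some Gm" using lab_opp[OF cA(1), of b a] BA[of b] b r G(2) by simp
        moreover have "lab C b d = Some Gm" using lab_opp[OF cC(1), of d b] BC[of b] b r G(1) by simp
        ultimately show ?thesis using N(2)[OF r(2,4), of b] b r by (simp add: tri_def)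
      next
        fix d' assume "q = Inr d' \<and> d' \<in> carrier C - carrier B"
        then show ?thesis using N_not_G[of a d'] G(2) r by simp
      next
        fix a' assume "a' \<in> carrier A - carrier B" "q = Inl a'"
        then show ?thesis using N_not_G[of a' d] G(1) r by simp
      qed
    next
      case q
      then show ?thesis using N_not_G[of a d] G by auto
    next
      case q'
      then show ?thesis using N_not_G[of a d] G by auto
    qed
  qed
  then have "structure_on (carrier ?D) (lab ?D)"
    unfolding structure_on_lab_iff[OF D(1)] using D(2) by simp
  moreover have "finite (carrier ?D)" using A' C' by (simp add: amalgam_def)
  ultimately show ?thesis using D(1) unfolding Forb_c_iff by blast
qed

lemma prioritised_semifree_forbidden: "prioritised_semifree TYPE('x) forbidden [Rp, Rm]"
  unfolding prioritised_semifree_def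
proof (intro conjI allI impI)
  have "Gp \<notin> set [Rp, Rm]" by simp
  then show "set [Rp, Rm] \<subset> UNIV" by blast
qed (use amalgam_in_Forb_c in simp_all)

end

section \<open>Existence of the limit\<close>

context path_rule
begin

lemma tri_degenerate: "tri None q q" "tri p None (opp p)" "tri p p None"
  by (simp_all add: tri_def)

definition add_point :: "('x \<Rightarrow> 'x \<Rightarrow> sym option) \<Rightarrow> 'x \<Rightarrow> ('x \<Rightarrow> sym option) \<Rightarrow> 'x \<Rightarrow> 'x \<Rightarrow> sym option" where
  "add_point e p t i j = (if i = j then None else if i = p then t j else if j = p then opp (t i) else e i j)"

lemma structure_on_add_point:
  assumes e: "structure_on V e" and p: "p \<notin> V" and t: "type_over e V t"
  shows "structure_on (insert p V) (add_point e p t)"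
    and "\<And>i j. i \<in> V \<Longrightarrow> j \<in> V \<Longrightarrow> add_point e p t i j = e i j"
    and "\<And>j. j \<in> V \<Longrightarrow> add_point e p t p j = t j"
proof -
  let ?e = "add_point e p t"
  show old: "?e i j = e i j" if "i \<in> V" "j \<in> V" for i j
    using that p structure_onD(1)[OF e that] by (auto simp: add_point_def)
  show new: "?e p j = t j" if "j \<in> V" for j
    using that p by (auto simp: add_point_def)
  have new': "?e j p = opp (t j)" if "j \<in> V" for j
    using that p by (auto simp: add_point_def)
  have self: "?e i i = None" for i by (simp add: add_point_def)
  have None: "?e x y = None \<longleftrightarrow> x = y" if "x \<in> insert p V" "y \<in> insert p V" for x y
    using that structure_onD(1)[OF e, of x y] type_overD(1)[OF t, of x] type_overD(1)[OF t, of y]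
    by (auto simp: add_point_def)
  have opp: "?e y x = opp (?e x y)" if "x \<in> insert p V" "y \<in> insert p V" for x y
  proof (cases "x = p \<or> y = p")
    case True
    then show ?thesis by (auto simp: add_point_def)
  next
    case False
    then have "x \<in> V" "y \<in> V" using that by auto
    then show ?thesis using old structure_onD(2)[OF e, of x y] by simp
  qed
  have triangles: "tri (?e x y) (?e x z) (?e y z)" if xyz: "x \<in> insert p V" "y \<in> insert p V" "z \<in> insert p V" for x y z
  proof (cases "x = y \<or> x = z \<or> y = z")
    case True
    then show ?thesis
    proof (elim disjE)
      assume "x = y" then show ?thesis by (simp add: self tri_degenerate)
    next
      assume "x = z" then show ?thesis using opp[OF xyz(1,2)] by (simp add: self tri_degenerate)
    next
      assume "y = z" then show ?thesis by (simp add: self tri_degenerate)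
    qed
  next
    case False
    then consider "x \<in> V" "y \<in> V" "z \<in> V" | "x = p" "y \<in> V" "z \<in> V" | "x \<in> V" "y = p" "z \<in> V"
      | "x \<in> V" "y \<in> V" "z = p" using xyz by blast
    then show ?thesis
    proof cases
      case 1 then show ?thesis using old structure_onD(3)[OF e] by simp
    next
      case 2 then show ?thesis using old new type_overD(2)[OF t] by simp
    next
      case 3
      have "tri (opp (t x)) (e x z) (opp (opp (t z)))"
        by (rule tri_swap[OF tri_rotate[OF type_overD(2)[OF t 3(1,3)]]])
      then show ?thesis using old new new' 3 by simp
    next
      case 4
      have "tri (e x y) (opp (t x)) (opp (t y))" by (rule tri_rotate[OF type_overD(2)[OF t 4(1,2)]])
      then show ?thesis using old new' 4 by simp
    qed
  qed
  show "structure_on (insert p V) ?e"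
    by (rule structure_onI[OF None opp triangles])
qed

text \<open>A state consists of a number \<open>n\<close> and labels on the points below
  \<open>n\<close>. A type over some of these points is extended to all of them and realized by the
  point \<open>n\<close>.\<close>

lemma generic_structure_exists: "\<exists>c :: nat \<Rightarrow> nat \<Rightarrow> sym option. generic_structure P c"
proof -
  define inv_st where "inv_st s \<longleftrightarrow> structure_on {..<fst s} (snd s)" for s :: "nat \<times> (nat \<Rightarrow> nat \<Rightarrow> sym option)"
  define ext where "ext s s' \<longleftrightarrow> fst s \<le> fst s' \<and> (\<forall>i<fst s. \<forall>j<fst s. snd s' i j = snd s i j)"
    for s s' :: "nat \<times> (nat \<Rightarrow> nat \<Rightarrow> sym option)"
  \<comment> \<open>The support must lie in the current stage even if the list encodes no type; this
    forces the stages to exhaust the natural numbers.\<close>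
  define req where "req l s \<longleftrightarrow> fst ` set l \<subseteq> {..<fst s} \<and>
      (type_over (snd s) (fst ` set l) (map_of l) \<longrightarrow> (\<exists>x<fst s. \<forall>u\<in>fst ` set l. snd s x u = map_of l u))"
    for l :: "(nat \<times> sym) list" and s :: "nat \<times> (nat \<Rightarrow> nat \<Rightarrow> sym option)"
  have refl: "ext s s" for s by (simp add: ext_def)
  have trans: "ext s s''" if "ext s s'" "ext s' s''" for s s' s''
    using that by (auto simp: ext_def)
  have one: "\<exists>s'. inv_st s' \<and> ext s s' \<and> fst s' = Suc (fst s) \<and> (\<forall>u\<in>U. snd s' (fst s) u = t u)"
    if s: "inv_st s" and U: "U \<subseteq> {..<fst s}" and t: "type_over (snd s) U t" for s U t
  proof -
    have st: "structure_on {..<fst s} (snd s)" using s by (simp add: inv_st_def)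
    obtain t' where t': "type_over (snd s) (U \<union> {..<fst s}) t'" "\<And>u. u \<in> U \<Longrightarrow> t' u = t u"
      by (rule type_extension[OF st U subset_refl t]) blast
    have t'': "type_over (snd s) {..<fst s} t'" using type_over_mono[OF t'(1)] by blast
    note new = structure_on_add_point[OF st _ t'', of "fst s"]
    have "insert (fst s) {..<fst s} = {..<Suc (fst s)}" by auto
    then have "inv_st (Suc (fst s), add_point (snd s) (fst s) t')"
      using new(1) by (simp add: inv_st_def)
    moreover have "ext s (Suc (fst s), add_point (snd s) (fst s) t')"
      using new(2) by (simp add: ext_def)
    moreover have "\<forall>u\<in>U. add_point (snd s) (fst s) t' (fst s) u = t u"
      using new(3) t'(2) U by auto
    ultimately show ?thesis by force
  qed
  have enlarge: "\<exists>s'. inv_st s' \<and> ext s s' \<and> m \<le> fst s'" if s: "inv_st s" for s m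
  proof (induction m)
    case 0
    then show ?case using s refl by blast
  next
    case (Suc m)
    then obtain s1 where s1: "inv_st s1" "ext s s1" "m \<le> fst s1" by blast
    obtain s2 where "inv_st s2" "ext s1 s2" "fst s2 = Suc (fst s1)"
      using one[OF s1(1) empty_subsetI type_over_empty] by blast
    then show ?case using trans[OF s1(2)] s1(3) by (metis Suc_le_mono)
  qed
  have step: "\<exists>s'. inv_st s' \<and> ext s s' \<and> req l s'" if s: "inv_st s" for s l
  proof -
    have "finite (fst ` set l)" by simp
    then obtain m where m: "fst ` set l \<subseteq> {..<m}" using finite_nat_iff_bounded by blast
    obtain s1 where s1: "inv_st s1" "ext s s1" "m \<le> fst s1" using enlarge[OF s] by blast
    have U: "fst ` set l \<subseteq> {..<fst s1}" using m s1(3) by force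
    show ?thesis
    proof (cases "type_over (snd s1) (fst ` set l) (map_of l)")
      case False
      then show ?thesis using s1 U by (intro exI[of _ s1]) (simp add: req_def)
    next
      case True
      obtain s2 where s2: "inv_st s2" "ext s1 s2" "fst s2 = Suc (fst s1)"
        "\<forall>u\<in>fst ` set l. snd s2 (fst s1) u = map_of l u"
        using one[OF s1(1) U True] by blast
      have "req l s2"
        unfolding req_def
      proof (intro conjI impI exI[of _ "fst s1"])
        show "fst ` set l \<subseteq> {..<fst s2}" using U s2(3) by auto
      qed (use s2(3,4) in auto)
      then show ?thesis using s2(1) trans[OF s1(2) s2(2)] by blast
    qed
  qed
  have "\<exists>st. st 0 = (0, \<lambda>i j. None) \<and> (\<forall>n. inv_st (st n)) \<and>
    (\<forall>m n. m \<le> n \<longrightarrow> ext (st m) (st n)) \<and> (\<forall>r. \<exists>n::nat. req r (st n))"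
    by (rule back_and_forth_chain[OF _ step refl trans]) (simp add: inv_st_def structure_on_def)
  then obtain st where st: "\<And>n. inv_st (st n)" "\<And>m n. m \<le> n \<Longrightarrow> ext (st m) (st n)"
    "\<And>r. \<exists>n::nat. req r (st n)" by blast
  have large: "\<exists>n. i < fst (st n)" for i
    using st(3)[of "[(i, Rp)]"] by (auto simp: req_def)
  \<comment> \<open>Assigned labels never change, so every stage that contains both points gives the
    same value.\<close>
  define c where "c i j = snd (st (SOME n. max i j < fst (st n))) i j" for i j
  have c: "c i j = snd (st n) i j" if "i < fst (st n)" "j < fst (st n)" for i j n
  proof -
    define m where "m = (SOME n. max i j < fst (st n))"
    have "max i j < fst (st m)" unfolding m_def by (rule someI_ex) (rule large)
    then have m: "i < fst (st m)" "j < fst (st m)" by simp_all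
    have "snd (st m) i j = snd (st (max m n)) i j" "snd (st n) i j = snd (st (max m n)) i j"
      using st(2)[OF max.cobounded1[of m n]] st(2)[OF max.cobounded2[of n m]] m that
      unfolding ext_def by metis+
    then show ?thesis by (simp add: c_def m_def)
  qed
  have "generic_structure P c"
  proof
    show "structure_on UNIV c"
      unfolding structure_on_def
    proof (intro ballI conjI)
      fix x y :: nat
      have *: "\<exists>n. x < fst (st n) \<and> y < fst (st n) \<and> z < fst (st n)" for z
        using large[of "max x (max y z)"] by simp
      obtain n where n: "x < fst (st n)" "y < fst (st n)" using *[of 0] by blast
      have "structure_on {..<fst (st n)} (snd (st n))" using st(1)[of n] by (simp add: inv_st_def)
      note D = structure_onD[OF this, of x y]
      show "c x y = None \<longleftrightarrow> x = y" using D(1) n by (simp add: c[OF n])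
      show "c y x = opp (c x y)" using D(2) n by (simp add: c[OF n] c[OF n(2,1)])
      fix z
      obtain n where n: "x < fst (st n)" "y < fst (st n)" "z < fst (st n)" using *[of z] by blast
      have "structure_on {..<fst (st n)} (snd (st n))" using st(1)[of n] by (simp add: inv_st_def)
      then show "tri (c x y) (c x z) (c y z)"
        using structure_onD(3)[of "{..<fst (st n)}" "snd (st n)" x y z] n
        by (simp add: c[OF n(1,2)] c[OF n(1,3)] c[OF n(2,3)])
    qed
    fix U t assume U: "finite U" and t: "type_over c U t"
    obtain l where l: "fst ` set l = U" "\<And>u. u \<in> U \<Longrightarrow> map_of l u = t u"
      by (rule function_as_list[OF U, of t]) (use type_overD(1)[OF t] in blast)+
    obtain n where "req l (st n)" using st(3) by blast
    then have n: "U \<subseteq> {..<fst (st n)}"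
      "type_over (snd (st n)) U (map_of l) \<longrightarrow> (\<exists>x<fst (st n). \<forall>u\<in>U. snd (st n) x u = map_of l u)"
      using l(1) by (simp_all add: req_def)
    have "type_over (snd (st n)) U (map_of l)"
      unfolding type_over_def
    proof (intro ballI conjI)
      fix u v assume uv: "u \<in> U" "v \<in> U"
      then have "c u v = snd (st n) u v" using n(1) by (intro c) auto
      then show "tri (map_of l u) (map_of l v) (snd (st n) u v)"
        using type_overD(2)[OF t uv] l(2) uv by simp
      show "map_of l u \<noteq> None" using type_overD(1)[OF t uv(1)] l(2)[OF uv(1)] by simp
    qed
    then obtain x where x: "x < fst (st n)" "\<forall>u\<in>U. snd (st n) x u = map_of l u" using n(2) by blast
    have "c x u = t u" if "u \<in> U" for u
      using c[OF x(1), of u] n(1) x(2) l(2)[OF that] that by auto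
    then show "\<exists>x. \<forall>u\<in>U. c x u = t u" by blast
  qed
  then show ?thesis by blast
qed

end

section \<open>The generic structure as a Fraisse limit\<close>

context generic_structure
begin

definition model :: "'a lstruct" where
  "model = \<lparr>carrier = UNIV, rel = (\<lambda>X x y. c x y = Some X)\<rparr>"

lemma model_simps [simp]: "carrier model = UNIV" "rel model X x y \<longleftrightarrow> c x y = Some X"
  by (simp_all add: model_def)

lemma complete_model: "complete_struct model"
  by (rule complete_struct_from_labels(1)[of _ c]) (auto intro: c_opp)

lemma embedding_model_iff:
  "embedding f A model \<longleftrightarrow> inj_on f (carrier A) \<and>
     (\<forall>X. \<forall>a\<in>carrier A. \<forall>b\<in>carrier A. rel A X a b \<longleftrightarrow> c (f a) (f b) = Some X)"
  by (simp add: embedding_def)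

lemma embed_labels:
  assumes "finite V" "structure_on V e"
  shows "\<exists>f. \<forall>x\<in>V. \<forall>y\<in>V. c (f x) (f y) = e x y"
  using assms
proof (induction V)
  case (insert a V)
  have sub: "structure_on V e" by (rule structure_on_mono[OF insert.prems]) blast
  then obtain f where f: "\<And>x y. x \<in> V \<Longrightarrow> y \<in> V \<Longrightarrow> c (f x) (f y) = e x y"
    using insert.IH by blast
  have "x = y" if "x \<in> V" "y \<in> V" "f x = f y" for x y
    using f[OF that(1,2)] structure_onD(1)[OF sub that(1,2)] that(3) by simp
  then have inj: "inj_on f V" by (auto simp: inj_on_def)
  define t where "t u = e a (inv_into V f u)" for u
  have t: "t (f v) = e a v" if "v \<in> V" for v using inj that by (simp add: t_def)
  have "type_over c (f ` V) t"
    unfolding type_over_def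
  proof (intro ballI conjI)
    fix u v assume "u \<in> f ` V" "v \<in> f ` V"
    then obtain u' v' where uv: "u = f u'" "v = f v'" "u' \<in> V" "v' \<in> V" by blast
    have "e a u' \<noteq> None" using structure_onD(1)[OF insert.prems, of a u'] uv insert.hyps by auto
    then show "t u \<noteq> None" using t uv by simp
    show "tri (t u) (t v) (c u v)"
      using structure_onD(3)[OF insert.prems, of a u' v'] uv t f by simp
  qed
  then obtain x where x: "\<forall>u\<in>f ` V. c x u = t u" using realization insert.hyps(1) by blast
  have xv: "c x (f v) = e a v" if "v \<in> V" for v using x t that by simp
  define f' where "f' = f(a := x)"
  have f': "f' a = x" "\<And>v. v \<in> V \<Longrightarrow> f' v = f v" using insert.hyps(2) by (auto simp: f'_def)
  have "c (f' v) (f' w) = e v w" if vw: "v \<in> insert a V" "w \<in> insert a V" for v w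
  proof -
    consider "v = a" "w = a" | "v = a" "w \<in> V" | "v \<in> V" "w = a" | "v \<in> V" "w \<in> V" using vw by blast
    then show ?thesis
    proof cases
      case 1 then show ?thesis using structure_onD(1)[OF insert.prems, of a a] f' by simp
    next
      case 2 then show ?thesis using f' xv by simp
    next
      case 3
      have "c (f v) x = opp (e a v)" using xv[OF 3(1)] c_opp[of "f v" x] by simp
      then show ?thesis using f' 3 structure_onD(2)[OF insert.prems, of a v] by simp
    next
      case 4 then show ?thesis using f' f by simp
    qed
  qed
  then show ?case by blast
qed simp

lemma embeds_model_iff:
  fixes A :: "'x lstruct"
  assumes "finite (carrier A)"
  shows "embeds A model \<longleftrightarrow> complete_struct A \<and> structure_on (carrier A) (lab A)"
proof
  assume "embeds A model"
  then obtain f where f: "inj_on f (carrier A)"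
    "\<And>X a b. a \<in> carrier A \<Longrightarrow> b \<in> carrier A \<Longrightarrow> rel A X a b \<longleftrightarrow> c (f a) (f b) = Some X"
    unfolding embeds_def embedding_model_iff by blast
  have N: "c (f a) (f b) = None \<longleftrightarrow> a = b" if "a \<in> carrier A" "b \<in> carrier A" for a b
    using f(1) that by (auto dest: inj_onD)
  note * = complete_struct_from_labels[of A "\<lambda>a b. c (f a) (f b)", OF f(2) N c_opp]
  have "structure_on (carrier A) (lab A)"
  proof (rule structure_onI)
    show "lab A y x = opp (lab A x y)" if "x \<in> carrier A" "y \<in> carrier A" for x y
      by (rule lab_opp[OF *(1) that])
  qed (rule lab_None, simp add: *(2) c_tri)
  then show "complete_struct A \<and> structure_on (carrier A) (lab A)" using *(1) by blast
next
  assume A: "complete_struct A \<and> structure_on (carrier A) (lab A)"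
  then obtain f where f: "\<And>x y. x \<in> carrier A \<Longrightarrow> y \<in> carrier A \<Longrightarrow> c (f x) (f y) = lab A x y"
    using embed_labels[OF assms] by blast
  have "inj_on f (carrier A)"
  proof (rule inj_onI)
    fix x y assume xy: "x \<in> carrier A" "y \<in> carrier A" "f x = f y"
    then have "lab A x y = None" using f[OF xy(1,2)] by simp
    then show "x = y" by (simp add: lab_None)
  qed
  moreover have "rel A X a b \<longleftrightarrow> c (f a) (f b) = Some X" if "a \<in> carrier A" "b \<in> carrier A" for X a b
    using f[OF that] lab_eq_Some_iff[OF _ that] A by simp
  ultimately show "embeds A model" unfolding embeds_def embedding_model_iff by blast
qed

lemma age_model: "age model = Forb_c forbidden"
proof -
  have "A \<in> age model \<longleftrightarrow> A \<in> Forb_c forbidden" for A :: "nat lstruct"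
  proof -
    have "complete_struct A \<Longrightarrow> lstructure A" by (simp add: complete_struct_def)
    then show ?thesis
      using embeds_model_iff[of A] unfolding age_def Forb_c_iff mem_Collect_eq by blast
  qed
  then show ?thesis by blast
qed

lemma homogeneous_model: "homogeneous model"
  unfolding homogeneous_def
proof (intro allI impI)
  fix U V f
  assume *: "finite U \<and> U \<subseteq> carrier model \<and> V \<subseteq> carrier model \<and>
    isomorphism f (model\<lparr>carrier := U\<rparr>) (model\<lparr>carrier := V\<rparr>)"
  have "c x y = Some X \<longleftrightarrow> c (f x) (f y) = Some X" if "x \<in> U" "y \<in> U" for x y X
    using * that by (auto simp: isomorphism_def embedding_def model_def)
  then have "c x y = c (f x) (f y)" if "x \<in> U" "y \<in> U" for x y
    using that by (metis option.exhaust)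
  then have "partial_iso ((\<lambda>x. (x, f x)) ` U)" by (intro partial_isoI) auto
  moreover have "finite ((\<lambda>x. (x, f x)) ` U)" using * by simp
  ultimately obtain h where h: "aut h" "\<And>x y. (x, y) \<in> (\<lambda>x. (x, f x)) ` U \<Longrightarrow> h x = y"
    by (rule homogeneity) blast
  have "bij h" using h(1) by (simp add: aut_def)
  then have "h \<in> carrier (Aut model)"
    using h(1) by (auto simp: Aut_def Bij_def isomorphism_def embedding_def bij_betw_def)
  then show "\<exists>g\<in>carrier (Aut model). \<forall>x\<in>U. g x = f x" using h(2) by blast
qed

lemma fraisse_limit_model: "fraisse_limit (Forb_c forbidden) model"
  using complete_model age_model homogeneous_model
  by (simp add: fraisse_limit_def complete_struct_def)

end

section \<open>Automorphism groups of the limits\<close>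

text \<open>Enumerating the carrier replaces a limit over an arbitrary type by a label function on
  \<open>nat\<close>, to which the results on \<open>generic_structure\<close> apply.\<close>

locale coordinatized = generic_structure P c for P and c :: "nat \<Rightarrow> nat \<Rightarrow> sym option" +
  fixes M :: "'m lstruct" and \<beta> :: "nat \<Rightarrow> 'm"
  assumes M: "complete_struct M" and \<beta>: "bij_betw \<beta> UNIV (carrier M)"
    and c_lab: "c i j = lab M (\<beta> i) (\<beta> j)"
begin

definition \<gamma> :: "'m \<Rightarrow> nat" where
  "\<gamma> = inv_into UNIV \<beta>"

lemma \<beta>_carrier [simp]: "\<beta> i \<in> carrier M"
  using \<beta> by (auto simp: bij_betw_def)

lemma \<gamma>_\<beta> [simp]: "\<gamma> (\<beta> i) = i"
  using \<beta> by (simp add: \<gamma>_def bij_betw_def)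

lemma \<beta>_\<gamma> [simp]: "x \<in> carrier M \<Longrightarrow> \<beta> (\<gamma> x) = x"
  using \<beta> unfolding \<gamma>_def by (simp add: bij_betw_inv_into_right)

lemma rel_c: "rel M X (\<beta> i) (\<beta> j) \<longleftrightarrow> c i j = Some X"
  by (simp add: c_lab lab_eq_Some_iff[OF M])

text \<open>Elements of \<open>Aut M\<close> are extensional, hence the restriction.
  \<open>lift\<close> carries the automorphisms of \<open>c\<close> isomorphically onto the group
  \<open>Aut M\<close>.\<close>

definition lift :: "(nat \<Rightarrow> nat) \<Rightarrow> 'm \<Rightarrow> 'm" where
  "lift h = restrict (\<lambda>x. \<beta> (h (\<gamma> x))) (carrier M)"

lemma lift_\<beta> [simp]: "lift h (\<beta> i) = \<beta> (h i)"
  by (simp add: lift_def)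

lemma carrier_Aut: "carrier (Aut M) = {f \<in> Bij (carrier M). isomorphism f M M}"
  by (simp add: Aut_def)

lemma one_Aut: "\<one>\<^bsub>Aut M\<^esub> = lift id"
  by (auto simp: Aut_def BijGroup_def lift_def fun_eq_iff)

lemma lift_in_Aut:
  assumes h: "aut h"
  shows "lift h \<in> carrier (Aut M)"
proof -
  have "bij_betw (lift h) (carrier M) (carrier M)"
  proof (rule bij_betw_byWitness[where f' = "lift (inverse_fun h)"])
    show "\<forall>x\<in>carrier M. lift (inverse_fun h) (lift h x) = x"
      "\<forall>x\<in>carrier M. lift h (lift (inverse_fun h) x) = x"
      using h by (simp_all add: lift_def)
  qed (auto simp: lift_def)
  then have bij: "lift h \<in> Bij (carrier M)" by (auto simp: Bij_def lift_def)
  have "rel M X x y \<longleftrightarrow> rel M X (lift h x) (lift h y)" if "x \<in> carrier M" "y \<in> carrier M" for X x y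
  proof -
    have "rel M X (\<beta> (\<gamma> x)) (\<beta> (\<gamma> y)) \<longleftrightarrow> rel M X (lift h (\<beta> (\<gamma> x))) (lift h (\<beta> (\<gamma> y)))"
      unfolding lift_\<beta> rel_c using h by simp
    then show ?thesis using that by simp
  qed
  then have "isomorphism (lift h) M M"
    using \<open>bij_betw (lift h) (carrier M) (carrier M)\<close>
    by (simp add: isomorphism_def embedding_def bij_betw_def)
  then show ?thesis using bij by (simp add: carrier_Aut)
qed

lemma Aut_is_lift:
  assumes f: "f \<in> carrier (Aut M)"
  obtains h where "aut h" "lift h = f"
proof -
  have ext: "f \<in> extensional (carrier M)" and bij: "bij_betw f (carrier M) (carrier M)"
    and iso: "\<And>X x y. x \<in> carrier M \<Longrightarrow> y \<in> carrier M \<Longrightarrow> rel M X x y \<longleftrightarrow> rel M X (f x) (f y)"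
    using f by (auto simp: carrier_Aut Bij_def isomorphism_def embedding_def)
  have f_carrier: "f (\<beta> i) \<in> carrier M" for i using bij by (auto simp: bij_betw_def)
  define h where "h i = \<gamma> (f (\<beta> i))" for i
  have \<beta>h: "\<beta> (h i) = f (\<beta> i)" for i using f_carrier by (simp add: h_def)
  have "bij (\<gamma> \<circ> f \<circ> \<beta>)"
    by (rule bij_betw_trans[OF \<beta> bij_betw_trans[OF bij, of \<gamma> UNIV], unfolded comp_assoc[symmetric]])
      (auto simp: \<gamma>_def intro: bij_betw_inv_into[OF \<beta>])
  then have "bij h" by (simp add: h_def[abs_def] comp_def)
  moreover have "c (h i) (h j) = c i j" for i j
  proof -
    have "c (h i) (h j) = Some X \<longleftrightarrow> c i j = Some X" for X
      using iso[of "\<beta> i" "\<beta> j" X] by (simp add: rel_c[symmetric] \<beta>h)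
    then show ?thesis by (metis option.exhaust)
  qed
  ultimately have "aut h" by (simp add: aut_def)
  moreover have "lift h = f"
  proof
    fix x show "lift h x = f x"
      using \<beta>h[of "\<gamma> x"] ext by (cases "x \<in> carrier M") (auto simp: lift_def extensional_def)
  qed
  ultimately show ?thesis by (rule that)
qed

lemma lift_comp:
  assumes "aut h" "aut h'"
  shows "lift h \<otimes>\<^bsub>Aut M\<^esub> lift h' = lift (h \<circ> h')"
proof -
  have "lift h \<in> Bij (carrier M)" "lift h' \<in> Bij (carrier M)"
    using lift_in_Aut assms by (auto simp: carrier_Aut)
  then show ?thesis by (auto simp: Aut_def BijGroup_def compose_def lift_def fun_eq_iff)
qed

lemma lift_inject: "lift h = lift h' \<Longrightarrow> h = h'"
  by (metis ext \<gamma>_\<beta> lift_\<beta>)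

lemma group_Aut: "group (Aut M)"
proof (rule groupI)
  fix x y assume "x \<in> carrier (Aut M)" "y \<in> carrier (Aut M)"
  then obtain h h' where h: "aut h" "lift h = x" "aut h'" "lift h' = y" by (metis Aut_is_lift)
  show "x \<otimes>\<^bsub>Aut M\<^esub> y \<in> carrier (Aut M)"
    using lift_in_Aut[OF aut_comp[OF h(1,3)]] lift_comp[OF h(1,3)] h(2,4) by simp
next
  show "\<one>\<^bsub>Aut M\<^esub> \<in> carrier (Aut M)" using lift_in_Aut[OF aut_id] by (simp add: one_Aut)
next
  fix x y z assume "x \<in> carrier (Aut M)" "y \<in> carrier (Aut M)" "z \<in> carrier (Aut M)"
  then obtain h h' h'' where h: "aut h" "lift h = x" "aut h'" "lift h' = y" "aut h''" "lift h'' = z"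
    by (metis Aut_is_lift)
  show "x \<otimes>\<^bsub>Aut M\<^esub> y \<otimes>\<^bsub>Aut M\<^esub> z = x \<otimes>\<^bsub>Aut M\<^esub> (y \<otimes>\<^bsub>Aut M\<^esub> z)"
    using lift_comp h aut_comp by (metis comp_assoc)
next
  fix x assume "x \<in> carrier (Aut M)"
  then obtain h where h: "aut h" "lift h = x" by (metis Aut_is_lift)
  show "\<one>\<^bsub>Aut M\<^esub> \<otimes>\<^bsub>Aut M\<^esub> x = x" using lift_comp[OF aut_id h(1)] h(2) by (simp add: one_Aut)
  have "inverse_fun h \<circ> h = id" using h(1) by (auto simp: fun_eq_iff)
  then have "lift (inverse_fun h) \<otimes>\<^bsub>Aut M\<^esub> x = \<one>\<^bsub>Aut M\<^esub>"
    using lift_comp[OF aut_inv[OF h(1)] h(1)] h(2) by (simp add: one_Aut)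
  then show "\<exists>y\<in>carrier (Aut M). y \<otimes>\<^bsub>Aut M\<^esub> x = \<one>\<^bsub>Aut M\<^esub>"
    using lift_in_Aut[OF aut_inv[OF h(1)]] by blast
qed

lemma lift_inverse:
  assumes h: "aut h"
  shows "inv\<^bsub>Aut M\<^esub> (lift h) = lift (inverse_fun h)"
proof (rule group.inv_equality[OF group_Aut _ lift_in_Aut[OF h] lift_in_Aut[OF aut_inv[OF h]]])
  have "inverse_fun h \<circ> h = id" using h by (auto simp: fun_eq_iff)
  then show "lift (inverse_fun h) \<otimes>\<^bsub>Aut M\<^esub> lift h = \<one>\<^bsub>Aut M\<^esub>"
    using lift_comp[OF aut_inv[OF h] h] by (simp add: one_Aut)
qed

lemma simple_Aut: "is_simple (Aut M)"
  unfolding is_simple_def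
proof (intro conjI allI impI)
  show "group (Aut M)" by (rule group_Aut)
  \<comment> \<open>All one-point structures are isomorphic, so some automorphism moves
    \<open>0\<close> to \<open>1\<close> and the group is not trivial.\<close>
  have "partial_iso {(0, 1)}" by (simp add: partial_iso_def)
  then obtain h where h: "aut h" "\<And>x y. (x, y) \<in> {(0, 1)} \<Longrightarrow> h x = y"
    by (rule homogeneity) auto
  have "h 0 = 1" using h(2) by blast
  then have "h \<noteq> id" by auto
  then have "lift h \<noteq> \<one>\<^bsub>Aut M\<^esub>" using lift_inject one_Aut by metis
  then show "carrier (Aut M) \<noteq> {\<one>\<^bsub>Aut M\<^esub>}" using lift_in_Aut[OF h(1)] by blast
next
  fix N assume N: "N \<lhd> Aut M"
  then have sub: "subgroup N (Aut M)" by (simp add: normal_def)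
  show "N = {\<one>\<^bsub>Aut M\<^esub>} \<or> N = carrier (Aut M)"
  proof (rule disjCI)
    assume "N \<noteq> carrier (Aut M)"
    show "N = {\<one>\<^bsub>Aut M\<^esub>}"
    proof (rule ccontr)
      assume "N \<noteq> {\<one>\<^bsub>Aut M\<^esub>}"
      then obtain n where n: "n \<in> N" "n \<noteq> \<one>\<^bsub>Aut M\<^esub>" using subgroup.one_closed[OF sub] by blast
      then have "n \<in> carrier (Aut M)" using subgroup.subset[OF sub] by blast
      then obtain g where g: "aut g" "lift g = n" by (rule Aut_is_lift)
      have "g \<noteq> id" using g(2) n(2) one_Aut by auto
      define N' where "N' = {h. aut h \<and> lift h \<in> N}"
      have "h \<in> N'" if h: "aut h" for h
      proof (rule normal_generation[OF g(1) \<open>g \<noteq> id\<close> _ _ _ _ h])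
        show "g \<in> N'" using g n(1) by (simp add: N'_def)
        show "a \<circ> b \<in> N'" if "a \<in> N'" "b \<in> N'" for a b
          using that subgroup.m_closed[OF sub, of "lift a" "lift b"]
          by (simp add: N'_def aut_comp lift_comp)
        show "inverse_fun a \<in> N'" if "a \<in> N'" for a
          using that subgroup.m_inv_closed[OF sub, of "lift a"] by (simp add: N'_def lift_inverse)
        show "inverse_fun k \<circ> a \<circ> k \<in> N'" if a: "a \<in> N'" and k: "aut k" for a k
        proof -
          have "inv\<^bsub>Aut M\<^esub> (lift k) \<otimes>\<^bsub>Aut M\<^esub> lift a \<otimes>\<^bsub>Aut M\<^esub> lift k \<in> N"
            using normal.inv_op_closed1[OF N lift_in_Aut[OF k], of "lift a"] a by (simp add: N'_def)
          then show ?thesis using a k by (simp add: N'_def lift_inverse lift_comp aut_comp)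
        qed
      qed
      then have all: "lift h \<in> N" if "aut h" for h using that by (simp add: N'_def)
      have "carrier (Aut M) \<subseteq> N"
      proof
        fix x assume "x \<in> carrier (Aut M)"
        then obtain h where "aut h" "lift h = x" by (rule Aut_is_lift)
        then show "x \<in> N" using all by blast
      qed
      then show False using \<open>N \<noteq> carrier (Aut M)\<close> subgroup.subset[OF sub] by blast
    qed
  qed
qed

end

section \<open>Every Fraisse limit has generic coordinates\<close>

context path_rule
begin

text \<open>The generic structure on \<open>nat\<close> has the same age and contains finite
  substructures of every size. The conclusion makes an enumeration by \<open>nat\<close>
  possible.\<close>

lemma fraisse_limit_infinite:
  fixes M :: "'m lstruct"
  assumes M: "fraisse_limit (Forb_c forbidden) M"
  shows "infinite (carrier M)"
proof
  assume fin: "finite (carrier M)"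
  obtain c :: "nat \<Rightarrow> nat \<Rightarrow> sym option" where "generic_structure P c"
    using generic_structure_exists by blast
  then interpret generic_structure P c .
  \<comment> \<open>One point more than \<open>M\<close> is assumed to have.\<close>
  define A :: "nat lstruct" where "A = model\<lparr>carrier := {..card (carrier M)}\<rparr>"
  have "embedding id A model" by (simp add: A_def embedding_def model_def)
  moreover have "lstructure A"
    using complete_model by (auto simp: A_def complete_struct_def lstructure_def)
  ultimately have "A \<in> age model" by (auto simp: age_def embeds_def A_def)
  then have "A \<in> age M" using M age_model by (simp add: fraisse_limit_def)
  then obtain f where "inj_on f (carrier A)" "f ` carrier A \<subseteq> carrier M"
    by (auto simp: age_def embeds_def embedding_def)
  then have "card (carrier A) \<le> card (carrier M)" using fin by (metis card_inj_on_le)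
  then show False by (simp add: A_def)
qed

text \<open>A type over \<open>U\<close> is realized abstractly by one additional point
  \<open>p\<close>. The resulting finite structure is in the age and has a copy in \<open>M\<close>;
  homogeneity moves the copy of \<open>U\<close> onto the given points, and the copy of
  \<open>p\<close> is moved to a realization.\<close>

lemma fraisse_limit_coordinates:
  fixes M :: "'m lstruct"
  assumes M: "fraisse_limit (Forb_c forbidden) M"
  obtains c \<beta> where "coordinatized P c M \<beta>"
proof -
  have age: "age M = Forb_c forbidden" and lM: "lstructure M" and hom: "homogeneous M"
    using M by (simp_all add: fraisse_limit_def)
  obtain \<beta> :: "nat \<Rightarrow> 'm" where \<beta>: "bij_betw \<beta> UNIV (carrier M)"
    using M fraisse_limit_infinite[OF M] bij_betw_from_nat_into
    by (auto simp: fraisse_limit_def)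
  have \<beta>M: "\<beta> i \<in> carrier M" for i using \<beta> by (auto simp: bij_betw_def)
  have \<beta>_inj: "\<beta> i = \<beta> j \<longleftrightarrow> i = j" for i j using \<beta> by (auto simp: bij_betw_def inj_def)
  define A where "A V = \<lparr>carrier = V, rel = (\<lambda>X i j. rel M X (\<beta> i) (\<beta> j))\<rparr>" for V :: "nat set"
  have "A V \<in> Forb_c forbidden" if "finite V" for V
  proof -
    have "lstructure (A V)"
      using lM \<beta>M unfolding lstructure_def A_def partial_object.simps lstruct.simps by blast
    moreover have "embedding \<beta> (A V) M" using \<beta>M \<beta>_inj by (auto simp: A_def embedding_def inj_on_def)
    ultimately show ?thesis using that unfolding age[symmetric] by (auto simp: age_def A_def embeds_def)
  qed
  then have A: "complete_struct (A V)" "structure_on V (lab (A V))" if "finite V" for V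
    using that unfolding Forb_c_iff by (simp_all add: A_def)
  \<comment> \<open>\<open>fraisse_limit\<close> speaks of \<open>lstructure\<close> only;
    completeness is read off from the two-point substructures, which belong to the age.\<close>
  have cM: "complete_struct M"
    unfolding complete_struct_def
  proof (intro conjI lM ballI impI)
    fix x y assume xy: "x \<in> carrier M" "y \<in> carrier M" "x \<noteq> y"
    then obtain i j where ij: "x = \<beta> i" "y = \<beta> j" using \<beta> by (metis bij_betw_def imageE)
    have "complete_struct (A {i, j})" using A(1) by simp
    then show "\<exists>!X. rel M X x y" using ij xy(3) by (auto simp: complete_struct_def A_def)
  qed
  define c where "c i j = lab M (\<beta> i) (\<beta> j)" for i j
  have lab_A: "lab (A V) i j = c i j" for V i j
    by (simp add: lab_def c_def edge_def A_def \<beta>_inj)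
  have c_rel: "rel M X (\<beta> i) (\<beta> j) \<longleftrightarrow> c i j = Some X" for X i j
    using lab_eq_Some_iff[OF cM \<beta>M \<beta>M] by (simp add: c_def)
  have c_structure: "structure_on UNIV c"
  proof (rule structure_onI)
    fix x y z
    have "structure_on {x, y, z} (lab (A {x, y, z}))" using A(2) by simp
    note D = structure_onD[OF this, of x y, unfolded lab_A]
    show "c x y = None \<longleftrightarrow> x = y" "c y x = opp (c x y)" "tri (c x y) (c x z) (c y z)"
      by (rule D(1) D(2) D(3); simp)+
  qed
  have "generic_structure P c"
  proof (unfold_locales, rule c_structure)
    fix U t assume U: "finite U" and t: "type_over c U t"
    obtain p where p: "p \<notin> U" using U ex_new_if_finite by (metis infinite_UNIV_nat)
    define L where "L = add_point c p t"
    note L = structure_on_add_point[OF structure_on_mono[OF c_structure subset_UNIV] p t, folded L_def]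
    define B where "B = \<lparr>carrier = insert p U, rel = (\<lambda>X i j. L i j = Some X)\<rparr>"
    have cB: "carrier B = insert p U" "\<And>X x y. rel B X x y \<longleftrightarrow> L x y = Some X" by (simp_all add: B_def)
    note from_L = complete_struct_from_labels[of B L, unfolded cB, OF refl structure_onD(1,2)[OF L(1)]]
    have B: "complete_struct B" by (rule from_L)
    have lab_B: "lab B x y = L x y" if "x \<in> insert p U" "y \<in> insert p U" for x y
      by (rule from_L(2)[OF _ _ _ _ that])
    have "structure_on (insert p U) (lab B)" by (rule structure_on_cong[OF L(1) lab_B])
    then have "B \<in> age M" using B U unfolding age Forb_c_iff cB by simp
    then obtain \<phi> where "embedding \<phi> B M" by (auto simp: age_def embeds_def)
    note \<phi>' = this[unfolded embedding_def cB]
    have \<phi>: "inj_on \<phi> (insert p U)" "\<phi> ` insert p U \<subseteq> carrier M"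
      using \<phi>' by (simp_all only: simp_thms)
    have rel_\<phi>: "L x y = Some X \<longleftrightarrow> rel M X (\<phi> x) (\<phi> y)"
      if "x \<in> insert p U" "y \<in> insert p U" for X x y
      by (rule \<phi>'[THEN conjunct2, THEN conjunct2, THEN spec, THEN bspec, OF that(1), THEN bspec, OF that(2)])
    have inj: "inj_on \<phi> U" using \<phi>(1) by (simp add: inj_on_insert)
    define \<theta> where "\<theta> m = \<beta> (inv_into U \<phi> m)" for m
    have \<theta>: "\<theta> (\<phi> u) = \<beta> u" if "u \<in> U" for u using inj that by (simp add: \<theta>_def)
    have rel_\<theta>: "rel M X (\<phi> u) (\<phi> v) \<longleftrightarrow> rel M X (\<beta> u) (\<beta> v)" if "u \<in> U" "v \<in> U" for u v X
      using rel_\<phi>[of u v X] L(2)[OF that] c_rel[of X u v] that by simp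
    have iso: "isomorphism \<theta> (M\<lparr>carrier := \<phi> ` U\<rparr>) (M\<lparr>carrier := \<beta> ` U\<rparr>)"
      unfolding isomorphism_def embedding_def
    proof (intro conjI allI ballI)
      show "inj_on \<theta> (carrier (M\<lparr>carrier := \<phi> ` U\<rparr>))"
        using \<theta> \<beta>_inj by (auto simp: inj_on_def)
      show "\<theta> ` carrier (M\<lparr>carrier := \<phi> ` U\<rparr>) = carrier (M\<lparr>carrier := \<beta> ` U\<rparr>)"
        using \<theta> by (simp add: image_image)
      then show "\<theta> ` carrier (M\<lparr>carrier := \<phi> ` U\<rparr>) \<subseteq> carrier (M\<lparr>carrier := \<beta> ` U\<rparr>)" by simp
    next
      fix X a b assume "a \<in> carrier (M\<lparr>carrier := \<phi> ` U\<rparr>)" "b \<in> carrier (M\<lparr>carrier := \<phi> ` U\<rparr>)"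
      then obtain u v where "a = \<phi> u" "b = \<phi> v" "u \<in> U" "v \<in> U" by auto
      then show "rel (M\<lparr>carrier := \<phi> ` U\<rparr>) X a b \<longleftrightarrow> rel (M\<lparr>carrier := \<beta> ` U\<rparr>) X (\<theta> a) (\<theta> b)"
        using \<theta> rel_\<theta> by simp
    qed
    have "finite (\<phi> ` U) \<and> \<phi> ` U \<subseteq> carrier M \<and> \<beta> ` U \<subseteq> carrier M \<and>
        isomorphism \<theta> (M\<lparr>carrier := \<phi> ` U\<rparr>) (M\<lparr>carrier := \<beta> ` U\<rparr>)"
      using U \<phi>(2) \<beta>M iso by auto
    then obtain \<alpha> where \<alpha>: "\<alpha> \<in> carrier (Aut M)" "\<forall>x\<in>\<phi> ` U. \<alpha> x = \<theta> x"
      using hom unfolding homogeneous_def by metis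
    have \<alpha>M: "\<alpha> m \<in> carrier M" "rel M X m m' \<longleftrightarrow> rel M X (\<alpha> m) (\<alpha> m')"
      if "m \<in> carrier M" "m' \<in> carrier M" for m m' X
      using \<alpha>(1) that by (auto simp: Aut_def isomorphism_def embedding_def)
    have \<phi>p: "\<phi> p \<in> carrier M" using \<phi>(2) by blast
    obtain x where x: "\<beta> x = \<alpha> (\<phi> p)"
      using \<alpha>M(1)[OF \<phi>p \<phi>p] \<beta> by (metis bij_betw_def imageE)
    have "c x u = t u" if u: "u \<in> U" for u
    proof -
      have "\<phi> u \<in> carrier M" using \<phi>(2) u by blast
      have "\<alpha> (\<phi> u) = \<beta> u" using \<alpha>(2) \<theta> u by simp
      then have "c x u = Some X \<longleftrightarrow> t u = Some X" for X
        using c_rel[of X x u] x \<alpha>M(2)[OF \<phi>p \<open>\<phi> u \<in> carrier M\<close>, of X] rel_\<phi>[of p u X] L(3)[OF u] u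
        by simp
      then show ?thesis by (metis option.exhaust)
    qed
    then show "\<exists>x. \<forall>u\<in>U. c x u = t u" by blast
  qed
  then have "coordinatized P c M \<beta>"
    by (rule coordinatized.intro) (unfold_locales, auto simp: cM \<beta> c_def)
  then show ?thesis by (rule that)
qed

end

theorem corollary3p11:
  fixes S :: "nat lstruct set"
  assumes "S = {triangle Gp Gm Gp, triangle Rp Gm Gp} \<or>
           S = {triangle Gp Gp Gp, triangle Rp Gm Gp} \<or>
           S = {triangle Gp Gp Gp, triangle Gp Gm Gp, triangle Rp Gm Gp}"
  shows "prioritised_semifree TYPE('a) S [Rp, Rm] \<and>
         (\<exists>M :: nat lstruct. fraisse_limit (Forb_c S) M) \<and>
         (\<forall>M :: 'b lstruct. fraisse_limit (Forb_c S) M \<longrightarrow> is_simple (Aut M))"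
proof -
  have "\<exists>P. path_rule P \<and> S = path_rule.forbidden P"
  proof -
    have P: "path_rule {Rp, Gp}" "path_rule {Rp, Gm}" "path_rule {Rp}"
      by unfold_locales auto
    have "path_rule.forbidden {Rp, Gp} = {triangle Gp Gm Gp, triangle Rp Gm Gp}"
      "path_rule.forbidden {Rp, Gm} = {triangle Gp Gp Gp, triangle Rp Gm Gp}"
      "path_rule.forbidden {Rp} = {triangle Gp Gp Gp, triangle Gp Gm Gp, triangle Rp Gm Gp}"
      unfolding P[THEN path_rule.forbidden_def] by auto
    then show ?thesis using assms P by metis
  qed
  then obtain P where "path_rule P" and S: "S = path_rule.forbidden P" by blast
  then interpret path_rule P by simp
  have "\<exists>M :: nat lstruct. fraisse_limit (Forb_c S) M"
    using generic_structure_exists generic_structure.fraisse_limit_model S by blast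
  moreover have "is_simple (Aut M)" if M: "fraisse_limit (Forb_c S) M" for M :: "'b lstruct"
  proof -
    obtain c \<beta> where "coordinatized P c M \<beta>"
      by (rule fraisse_limit_coordinates[OF M[unfolded S]])
    then show ?thesis by (rule coordinatized.simple_Aut)
  qed
  ultimately show ?thesis using prioritised_semifree_forbidden S by blast
qed

end
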